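(* Let $T,N\in\mathbb N$, $t\in[T]$, $\ell_1,\dots,\ell_T>0$, and let $\boldsymbol\pi_{T,D}=\pi_T^{\otimes D}$ be as in the context. Assume that for every $s\in[T]$: $\bar w_s=\log G_s+\log m_s$ is twice continuously differentiable; $\partial_s^2\bar w_s$, $\partial_s^2\bar w_{s+1}$ and $\partial_s\partial_{s+1}\bar w_{s+1}$ are Lipschitz-continuous and bounded; and $\pi_T(|\partial_s\bar w_s|^4)<\infty$, $\pi_T(|\partial_s\bar w_{s+1}|^4)<\infty$ (with $\bar w_{T+1}\equiv0$). For each version of the i-RW-CSMC algorithm (with or without backward sampling, with or without forced move), let $\bar\alpha^N_{T,D,\mathbf x_{1:T}}(t)$ be the probability of $\{K_t\ne0\}$ under one i-RW-CSMC update started from $\mathbf x_{1:T}$, and $\bar\alpha^N_T(t)$ the probability of $\{K_t\ne0\}$ under the corresponding limiting law $\overline{\mathbb P}^N_T$. Then $\bar\alpha^N_T(t)>0$. Furthermore, there is a family of Borel sets $\mathbf F_{T,D}\subseteq(\mathbb R^D)^T$ (not depending on $t$) with $\lim_{D\to\infty}\boldsymbol\pi_{T,D}(\mathbf F_{T,D})=1$, along which the law of $(A_{1:T-1},K_{1:T})$ under the i-RW-CSMC update converges in total variation to its law under $\overline{\mathbb P}^N_T$ uniformly in $\mathbf x_{1:T}\in\mathbf F_{T,D}$ as $D\to\infty$, and for which $$\lim_{D\to\infty}\ \sup_{\mathbf x_{1:T}\in\mathbf F_{T,D}}\bigl|\bar\alpha^N_{T,D,\mathbf x_{1:T}}(t)-\bar\alpha^N_T(t)\bigr|=0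 .$$
   Context: Notation: $[n]=\{1,\dots,n\}$, $[n]_0=\{0,\dots,n\}$; $\partial_t$ is the derivative with respect to $x_t$; $\pi_T(\varphi)=\int\varphi\,\pi_T$; $\mathbf 1_N$ is the all-ones vector, $I_N$ the identity. Quantities with time index $0$ are ignored. Model. $M_1$ is a probability measure on $\mathbb R$ with Lebesgue density $m_1$; for $t\ge2$, $M_t$ is a Markov kernel on $\mathbb R$ with transition density $m_t(x,y)$; $G_t:\mathbb R\to(0,\infty)$ is measurable. $\pi_T(x_{1:T})\propto m_1(x_1)G_1(x_1)\prod_{t=2}^T m_t(x_{t-1},x_t)G_t(x_t)$ is a probability density on $\mathbb R^T$. $\bar w_t(x_{t-1},x_t)=\log G_t(x_t)+\log m_t(x_{t-1},x_t)$ (a function of $x_1$ only if $t=1$), $\bar w_{T+1}\equiv0$. For $D\in\mathbb N$ and $\mathbf x_t=(x_{t,1},\dots,x_{t,D})\in\mathbb R^D$: $\mathbf m_t(\mathbf x_{t-1},\mathbf x_t)=\prod_d m_t(x_{t-1,d},x_{t,d})$, $\mathbf G_t(\mathbf x_t)=\prod_d G_t(x_{t,d})$, and the target $\boldsymbol\pi_{T,D}$ on $(\mathbb R^D)^T$ has density $\prod_{d=1}^D\pi_T(x_{1,d},\dots,x_{T,d})$. Selection functions. For $h^{1:N}\in\mathbb R^N$, $h^0:=0$: $\Psi^n(\{h^m\}_{m=1}^N)=\frac{e^{h^n}}{1+\sum_{m=1}^N e^{h^m}}$ for $n\in[N]_0$; $\Phi^n(\{h^m\}_{m=1}^N)=\frac{e^{h^n}}{1-1\wedge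 e^{h^n}+\sum_{m=1}^N e^{h^m}}$ for $n\in[N]$, $\Phi^0=1-\sum_{n=1}^N\Phi^n$. Let $\Sigma=\tfrac12(I_N+\mathbf 1_N\mathbf 1_N^{\mathsf T})$. One i-RW-CSMC update from $\mathbf x_{1:T}$. Particles: $\mathbf Z_t^0=\mathbf x_t$; independently over $(t,d)$ sample $U_{t,d}^{1:N}\sim\mathrm N(0,\Sigma)$ and set $Z_{t,d}^n=x_{t,d}+\sqrt{\ell_t/D}\,U_{t,d}^n$, $\mathbf Z_t^n=(Z_{t,d}^n)_{d\in[D]}$, $n\in[N]$. Ancestors: for $t=1,\dots,T-1$ set $A_t^0=0$ and, conditionally independently for $n\in[N]$, sample $A_t^n=l\in[N]_0$ with probability proportional to $\omega_t^l:=\mathbf m_t(\mathbf Z_{t-1}^{A_{t-1}^l},\mathbf Z_t^l)\mathbf G_t(\mathbf Z_t^l)$. Define $\omega_T^l$ in the same way and sample $K_T=k\in[N]_0$ with probability $\Psi^k(\{\log\omega_T^m-\log\omega_T^0\}_{m=1}^N)=\omega_T^k/\sum_{m=0}^N\omega_T^m$ (forced move: replace $\Psi^k$ by $\Phi^k$). For $t=T-1,\dots,1$: without backward sampling set $K_t=A_t^{K_{t+1}}$; with backward sampling sample $K_t=k\in[N]_0$ with probability proportional to $\omega_t^k\,\mathbf m_{t+1}(\mathbf Z_t^k,\mathbf Z_{t+1}^{K_{t+1}})$. New state: $(\mathbf Z_1^{K_1},\dots,\mathbf Z_T^{K_T})$. Limiting law $\overline{\mathbb P}^N_T$. (1) Independently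 over $t\in[T]$ sample the Gaussian vector $(V_t,W_t)$, $V_t=V_t^{1:N}$, $W_t=W_t^{1:N}$, with means $\mathbb E V_t=\tfrac12\ell_t\pi_T(\partial_t^2\bar w_t)\mathbf 1_N$, $\mathbb E W_t=\tfrac12\ell_t\pi_T(\partial_t^2\bar w_{t+1})\mathbf 1_N$ and covariances $\mathrm{var}(V_t)=\ell_t\pi_T([\partial_t\bar w_t]^2)\Sigma$, $\mathrm{var}(W_t)=\ell_t\pi_T([\partial_t\bar w_{t+1}]^2)\Sigma$, $\mathrm{cov}(V_t,W_t)=\ell_t\pi_T([\partial_t\bar w_t][\partial_t\bar w_{t+1}])\Sigma$; put $V_t^0=W_t^0=0$ and $W_0^n=0$. (2) For $t=1,\dots,T-1$ set $A_t^0=0$ and, conditionally independently for $n\in[N]$, sample $A_t^n=l\in[N]_0$ with probability $\Psi^l(\{V_t^m+W_{t-1}^{A_{t-1}^m}\}_{m=1}^N)$. (3) Sample $K_T=k$ with probability $\Psi^k(\{V_T^m+W_{T-1}^{A_{T-1}^m}\}_{m=1}^N)$ (forced move: $\Phi^k$ instead). (4) For $t=T-1,\dots,1$: without backward sampling $K_t=A_t^{K_{t+1}}$; with backward sampling sample $K_t=k\in[N]_0$ with probability $\Psi^k(\{V_t^m+W_t^m+W_{t-1}^{A_{t-1}^m}\}_{m=1}^N)$. *)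

theory Defs
  imports "HOL-Probability.Probability"
begin

section \<open>Feynman--Kac model\<close>

text \<open>Only \<open>trans_dens FK t\<close> with \<open>2 \<le> t\<close> is meaningful.\<close>

record fk_model =
  init_dens :: "real \<Rightarrow> real"
  trans_dens :: "nat \<Rightarrow> real \<Rightarrow> real \<Rightarrow> real"
  pot :: "nat \<Rightarrow> real \<Rightarrow> real"

text \<open>At time \<open>1\<close> the first argument (the state at time \<open>0\<close>) is a dummy. All functions of
  \<open>(x\<^bsub>t - 1\<^esub>, x\<^bsub>t\<^esub>)\<close> below follow this convention.\<close>

definition tdens :: "fk_model \<Rightarrow> nat \<Rightarrow> real \<Rightarrow> real \<Rightarrow> real" where
  "tdens FK t x y = (if t = 1 then init_dens FK y else trans_dens FK t x y)"

definition path_space :: "nat \<Rightarrow> (nat \<Rightarrow> real) measure" where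
  "path_space T = PiM {1..T} (\<lambda>_. lborel)"

definition path_weight :: "fk_model \<Rightarrow> nat \<Rightarrow> (nat \<Rightarrow> real) \<Rightarrow> real" where
  "path_weight FK T x = (\<Prod>t=1..T. tdens FK t (x (t - 1)) (x t) * pot FK t (x t))"

definition fk_valid :: "fk_model \<Rightarrow> nat \<Rightarrow> bool" where
  "fk_valid FK T \<longleftrightarrow>
     init_dens FK \<in> borel_measurable borel \<and> (\<forall>y. 0 \<le> init_dens FK y) \<and>
     (\<integral>\<^sup>+ y. ennreal (init_dens FK y) \<partial>lborel) = 1 \<and>
     (\<forall>t\<in>{2..T}. (\<lambda>(x, y). trans_dens FK t x y) \<in> borel_measurable (borel \<Otimes>\<^sub>M borel) \<and>
        (\<forall>x y. 0 \<le> trans_dens FK t x y) \<and>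
        (\<forall>x. (\<integral>\<^sup>+ y. ennreal (trans_dens FK t x y) \<partial>lborel) = 1)) \<and>
     (\<forall>t\<in>{1..T}. pot FK t \<in> borel_measurable borel \<and> (\<forall>y. 0 < pot FK t y)) \<and>
     integrable (path_space T) (path_weight FK T) \<and>
     0 < integral\<^sup>L (path_space T) (path_weight FK T)"

definition pi_dens :: "fk_model \<Rightarrow> nat \<Rightarrow> (nat \<Rightarrow> real) \<Rightarrow> real" where
  "pi_dens FK T x = path_weight FK T x / integral\<^sup>L (path_space T) (path_weight FK T)"

definition pi_law :: "fk_model \<Rightarrow> nat \<Rightarrow> (nat \<Rightarrow> real) measure" where
  "pi_law FK T = density (path_space T) (\<lambda>x. ennreal (pi_dens FK T x))"

text \<open>An element \<open>x\<close> of \<open>(\<real>\<^sup>D)\<^sup>T\<close> is written \<open>x t d\<close>.\<close>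

definition state_space :: "nat \<Rightarrow> nat \<Rightarrow> (nat \<Rightarrow> nat \<Rightarrow> real) measure" where
  "state_space T D = PiM {1..T} (\<lambda>_. PiM {1..D} (\<lambda>_. lborel))"

definition target_law :: "fk_model \<Rightarrow> nat \<Rightarrow> nat \<Rightarrow> (nat \<Rightarrow> nat \<Rightarrow> real) measure" where
  "target_law FK T D =
     density (state_space T D) (\<lambda>x. ennreal (\<Prod>d=1..D. pi_dens FK T (\<lambda>t. x t d)))"

definition wbar :: "fk_model \<Rightarrow> nat \<Rightarrow> nat \<Rightarrow> real \<times> real \<Rightarrow> real" where
  "wbar FK T t = (\<lambda>(x, y). if t = T + 1 then 0 else ln (pot FK t y) + ln (tdens FK t x y))"


section \<open>Smoothness\<close>

definition twice_cont_diff :: "('a::real_normed_vector \<Rightarrow> real) \<Rightarrow> bool" where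
  "twice_cont_diff f \<longleftrightarrow>
     (\<exists>(f' :: 'a \<Rightarrow> 'a \<Rightarrow>\<^sub>L real) (f'' :: 'a \<Rightarrow> 'a \<Rightarrow>\<^sub>L ('a \<Rightarrow>\<^sub>L real)).
        (\<forall>z. (f has_derivative blinfun_apply (f' z)) (at z)) \<and>
        (\<forall>z. (f' has_derivative blinfun_apply (f'' z)) (at z)) \<and>
        continuous_on UNIV f'')"

text \<open>Partial derivatives with respect to the first and second argument. For a function of
  \<open>(x\<^bsub>t - 1\<^esub>, x\<^bsub>t\<^esub>)\<close>, these are the derivatives with respect to \<open>x\<^bsub>t - 1\<^esub>\<close> and \<open>x\<^bsub>t\<^esub>\<close>.\<close>

definition pd1 :: "(real \<times> real \<Rightarrow> real) \<Rightarrow> real \<times> real \<Rightarrow> real" where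
  "pd1 f = (\<lambda>(x, y). deriv (\<lambda>x. f (x, y)) x)"

definition pd2 :: "(real \<times> real \<Rightarrow> real) \<Rightarrow> real \<times> real \<Rightarrow> real" where
  "pd2 f = (\<lambda>(x, y). deriv (\<lambda>y. f (x, y)) y)"

text \<open>A function of \<open>(x\<^bsub>t - 1\<^esub>, x\<^bsub>t\<^esub>)\<close> as a function of the whole path.\<close>

definition on_path :: "nat \<Rightarrow> (real \<times> real \<Rightarrow> real) \<Rightarrow> (nat \<Rightarrow> real) \<Rightarrow> real" where
  "on_path t f x = f (x (t - 1), x t)"

definition lipschitz_bounded :: "(real \<times> real \<Rightarrow> real) \<Rightarrow> bool" where
  "lipschitz_bounded f \<longleftrightarrow> (\<exists>L. L-lipschitz_on UNIV f) \<and> bounded (range f)"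


section \<open>Gaussian vectors\<close>

text \<open>The law of \<open>\<mu> + L Z\<close> with \<open>Z\<close> standard normal and \<open>L L\<^sup>T = C\<close>; it does not depend on
  the choice of \<open>L\<close>. The covariance \<open>C\<close> may be singular.\<close>

definition mvnormal ::
  "'i set \<Rightarrow> ('i \<Rightarrow> real) \<Rightarrow> ('i \<Rightarrow> 'i \<Rightarrow> real) \<Rightarrow> ('i \<Rightarrow> real) measure" where
  "mvnormal I \<mu> C =
     (let L = (SOME L. \<forall>i\<in>I. \<forall>j\<in>I. (\<Sum>k\<in>I. L i k * L j k) = C i j)
      in distr (PiM I (\<lambda>_. density lborel std_normal_density)) (PiM I (\<lambda>_. borel))
           (\<lambda>z. \<lambda>i\<in>I. \<mu> i + (\<Sum>k\<in>I. L i k * z k)))"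

lemma prob_space_mvnormal:
  assumes "finite I"
  shows "prob_space (mvnormal I \<mu> C)"
proof -
  interpret N: prob_space "density lborel std_normal_density"
    by (rule prob_space_normal_density) simp
  interpret P: product_prob_space "\<lambda>_. density lborel std_normal_density" I
    by unfold_locales
  have [measurable]: "(\<lambda>z. z i) \<in> borel_measurable (PiM I (\<lambda>_. density lborel std_normal_density))"
    if "i \<in> I" for i
    using measurable_component_singleton[OF that, of "\<lambda>_. density lborel std_normal_density"] by simp
  show ?thesis
    unfolding mvnormal_def Let_def
    by (rule P.prob_space_distr) (auto intro!: measurable_restrict borel_measurable_sum)
qed

definition Sigma_mat :: "nat \<Rightarrow> nat \<Rightarrow> real" where
  "Sigma_mat m n = ((if m = n then 1 else 0) + 1) / 2"

text \<open>A factor \<open>L\<close> exists for all covariance matrices that occur below: the Kronecker product of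
  a positive semidefinite \<open>2 \<times> 2\<close> matrix with \<^const>\<open>Sigma_mat\<close>, and \<^const>\<open>Sigma_mat\<close> itself.\<close>

lemma Sigma_mat_factor:
  assumes "1 \<le> N"
  obtains S :: "nat \<Rightarrow> nat \<Rightarrow> real"
  where "\<And>i j. i \<in> {1..N} \<Longrightarrow> j \<in> {1..N} \<Longrightarrow> (\<Sum>k=1..N. S i k * S j k) = Sigma_mat i j"
proof
  define s u where "s = sqrt (1 / 2)" and "u = (sqrt ((1 + real N) / 2) - s) / real N"
  have s: "s * s = 1 / 2" by (simp add: s_def)
  have "s + real N * u = sqrt ((1 + real N) / 2)" using assms by (simp add: u_def)
  then have "(s + real N * u) * (s + real N * u) = (1 + real N) / 2" by simp
  then have "real N * (2 * s * u + real N * u * u) = real N * (1 / 2)"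
    using s by (simp add: algebra_simps)
  then have u: "2 * s * u + real N * u * u = 1 / 2" using assms by (metis mult_cancel_left not_one_le_zero of_nat_eq_0_iff)
  fix i j assume ij: "i \<in> {1..N}" "j \<in> {1..N}"
  have "(\<Sum>k=1..N. (s * (if i = k then 1 else 0) + u) * (s * (if j = k then 1 else 0) + u))
      = (\<Sum>k=1..N. (if k = i then (if i = j then s * s else 0) else 0)
           + (if k = i then s * u else 0) + (if k = j then s * u else 0) + u * u)"
    by (intro sum.cong) (auto simp: algebra_simps)
  also have "\<dots> = (if i = j then s * s else 0) + 2 * s * u + real N * u * u"
    using ij by (simp add: sum.distrib)
  also have "\<dots> = Sigma_mat i j" using s u by (simp add: Sigma_mat_def)
  finally show "(\<Sum>k=1..N. (s * (if i = k then 1 else 0) + u) * (s * (if j = k then 1 else 0) + u))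
      = Sigma_mat i j" .
qed

lemma Kronecker_Sigma_mat_factor:
  fixes c :: "nat \<Rightarrow> nat \<Rightarrow> real"
  assumes "1 \<le> N" "0 \<le> c 0 0" "0 \<le> c 1 1" "c 0 1 = c 1 0" "(c 0 1)\<^sup>2 \<le> c 0 0 * c 1 1"
  shows "\<exists>L :: nat \<times> nat \<Rightarrow> nat \<times> nat \<Rightarrow> real. \<forall>p\<in>{0,1} \<times> {1..N}. \<forall>q\<in>{0,1} \<times> {1..N}.
    (\<Sum>r\<in>{0,1} \<times> {1..N}. L p r * L q r) = c (fst p) (fst q) * Sigma_mat (snd p) (snd q)"
proof -
  obtain S where S: "\<And>i j. i \<in> {1..N} \<Longrightarrow> j \<in> {1..N} \<Longrightarrow> (\<Sum>k=1..N. S i k * S j k) = Sigma_mat i j"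
    using Sigma_mat_factor[OF assms(1)] by blast
  define a b where "a = sqrt (c 0 0)" and "b = c 0 1 / a"
  have aa: "a * a = c 0 0" using assms by (simp add: a_def)
  have ab: "a * b = c 0 1" using assms by (cases "c 0 0 = 0") (auto simp: a_def b_def)
  have "b * b \<le> c 1 1"
  proof (cases "c 0 0 = 0")
    case False
    then have "0 < c 0 0" using assms by simp
    moreover have "c 0 0 * (b * b) = (c 0 1)\<^sup>2"
      unfolding aa[symmetric] ab[symmetric] by (simp add: power2_eq_square algebra_simps)
    ultimately show ?thesis using assms(5) by (metis mult_le_cancel_left_pos)
  qed (use assms in \<open>simp add: a_def b_def\<close>)
  define e where "e = sqrt (c 1 1 - b * b)"
  have e: "e * e = c 1 1 - b * b" using \<open>b * b \<le> c 1 1\<close> by (simp add: e_def)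
  define P :: "nat \<Rightarrow> nat \<Rightarrow> real" where
    "P i k = (if i = 0 then (if k = 0 then a else 0) else (if k = 0 then b else e))" for i k
  have P: "(\<Sum>k\<in>{0,1}. P i k * P j k) = c i j" if "i \<in> {0,1}" "j \<in> {0,1}" for i j
    using that aa ab e assms(4) by (auto simp: P_def algebra_simps)
  have "(\<Sum>r\<in>{0,1} \<times> {1..N}. (P (fst p) (fst r) * S (snd p) (snd r)) * (P (fst q) (fst r) * S (snd q) (snd r)))
      = c (fst p) (fst q) * Sigma_mat (snd p) (snd q)"
    if "p \<in> {0,1} \<times> {1..N}" "q \<in> {0,1} \<times> {1..N}" for p q
  proof -
    have "(\<Sum>r\<in>{0,1} \<times> {1..N}. (P (fst p) (fst r) * S (snd p) (snd r)) * (P (fst q) (fst r) * S (snd q) (snd r)))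
      = (\<Sum>k\<in>{0,1}. P (fst p) k * P (fst q) k) * (\<Sum>n=1..N. S (snd p) n * S (snd q) n)"
      unfolding sum_product sum.cartesian_product
      by (intro sum.cong) (auto simp: mult_ac)
    then show ?thesis using P[of "fst p" "fst q"] S[of "snd p" "snd q"] that
      by (auto simp: mem_Times_iff)
  qed
  then show ?thesis by (intro exI[of _ "\<lambda>p r. P (fst p) (fst r) * S (snd p) (snd r)"]) blast
qed


section \<open>Selection functions\<close>

text \<open>\<open>h 0\<close> is ignored: the value at index \<open>0\<close> is \<open>0\<close> by convention.\<close>

definition Psi :: "nat \<Rightarrow> (nat \<Rightarrow> real) \<Rightarrow> nat \<Rightarrow> real" where
  "Psi N h n = (if n \<le> N
     then exp (if n = 0 then 0 else h n) / (1 + (\<Sum>m=1..N. exp (h m))) else 0)"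

definition Phi_pos :: "nat \<Rightarrow> (nat \<Rightarrow> real) \<Rightarrow> nat \<Rightarrow> real" where
  "Phi_pos N h n = exp (h n) / (1 - min 1 (exp (h n)) + (\<Sum>m=1..N. exp (h m)))"

definition Phi :: "nat \<Rightarrow> (nat \<Rightarrow> real) \<Rightarrow> nat \<Rightarrow> real" where
  "Phi N h n = (if n = 0 then 1 - (\<Sum>m=1..N. Phi_pos N h m)
     else if n \<le> N then Phi_pos N h n else 0)"

definition select_pmf :: "bool \<Rightarrow> nat \<Rightarrow> (nat \<Rightarrow> real) \<Rightarrow> nat pmf" where
  "select_pmf forced N h = embed_pmf (if forced then Phi N h else Psi N h)"

text \<open>\<open>l \<in> {0..N}\<close> with probability proportional to \<open>w l\<close>\<close>

definition weighted_pmf :: "nat \<Rightarrow> (nat \<Rightarrow> real) \<Rightarrow> nat pmf" where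
  "weighted_pmf N w = embed_pmf (\<lambda>l. if l \<le> N then w l / (\<Sum>m=0..N. w m) else 0)"

lemma pmf_embed_atMost:
  fixes f :: "nat \<Rightarrow> real"
  assumes "\<And>n. 0 \<le> f n" "\<And>n. N < n \<Longrightarrow> f n = 0" "(\<Sum>n=0..N. f n) = 1"
  shows "pmf (embed_pmf f) n = f n"
proof (rule pmf_embed_pmf)
  have "(\<integral>\<^sup>+ x. ennreal (f x) \<partial>count_space UNIV) = (\<Sum>n=0..N. ennreal (f n))"
    using assms(2) by (intro nn_integral_count_space'[of "{0..N}"]) (auto simp: not_le)
  also have "\<dots> = 1" using assms by (simp add: sum_ennreal)
  finally show "(\<integral>\<^sup>+ x. ennreal (f x) \<partial>count_space UNIV) = 1" .
qed (use assms in auto)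

lemma pmf_select_pmf:
  "pmf (select_pmf forced N h) n = (if forced then Phi N h n else Psi N h n)"
proof -
  have nn: "0 \<le> (\<Sum>m=1..N. exp (h m))" by (intro sum_nonneg) auto
  have "pmf (embed_pmf (Psi N h)) n = Psi N h n"
  proof (rule pmf_embed_atMost)
    show "0 \<le> Psi N h n" for n using nn by (simp add: Psi_def)
    have "(\<Sum>n=0..N. Psi N h n) = Psi N h 0 + (\<Sum>n=1..N. Psi N h n)"
      by (simp add: sum.atLeast_Suc_atMost)
    also have "(\<Sum>n=1..N. Psi N h n) = (\<Sum>n=1..N. exp (h n)) / (1 + (\<Sum>m=1..N. exp (h m)))"
      unfolding sum_divide_distrib by (intro sum.cong) (auto simp: Psi_def)
    also have "Psi N h 0 + \<dots> = 1" using nn by (simp add: Psi_def add_divide_distrib[symmetric])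
    finally show "(\<Sum>n=0..N. Psi N h n) = 1" .
  qed (simp add: Psi_def)
  moreover have "pmf (embed_pmf (Phi N h)) n = Phi N h n"
  proof (rule pmf_embed_atMost)
    have "(\<Sum>m=1..N. Phi_pos N h m) \<le> (\<Sum>n=1..N. exp (h n) / (\<Sum>m=1..N. exp (h m)))"
    proof (intro sum_mono)
      fix n assume "n \<in> {1..N}"
      then have "0 < (\<Sum>m=1..N. exp (h m))" by (intro sum_pos) auto
      then show "Phi_pos N h n \<le> exp (h n) / (\<Sum>m=1..N. exp (h m))"
        unfolding Phi_pos_def by (intro divide_left_mono mult_pos_pos add_nonneg_pos) auto
    qed
    also have "\<dots> \<le> 1" by (simp add: sum_divide_distrib[symmetric])
    finally have le1: "(\<Sum>m=1..N. Phi_pos N h m) \<le> 1" .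
    show "0 \<le> Phi N h n" for n
      using le1 nn by (auto simp: Phi_def Phi_pos_def intro!: divide_nonneg_nonneg add_nonneg_nonneg)
    have "(\<Sum>n=0..N. Phi N h n) = Phi N h 0 + (\<Sum>n=1..N. Phi N h n)"
      by (simp add: sum.atLeast_Suc_atMost)
    also have "(\<Sum>n=1..N. Phi N h n) = (\<Sum>n=1..N. Phi_pos N h n)"
      by (intro sum.cong) (auto simp: Phi_def)
    finally show "(\<Sum>n=0..N. Phi N h n) = 1" by (simp add: Phi_def)
  qed (simp add: Phi_def)
  ultimately show ?thesis by (simp add: select_pmf_def)
qed

lemma pmf_weighted_pmf:
  assumes "\<And>l. l \<le> N \<Longrightarrow> 0 < w l"
  shows "pmf (weighted_pmf N w) l = (if l \<le> N then w l / (\<Sum>m=0..N. w m) else 0)"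
proof -
  have pos: "0 < (\<Sum>m=0..N. w m)" using assms by (intro sum_pos) auto
  show ?thesis unfolding weighted_pmf_def
  proof (rule pmf_embed_atMost)
    show "(\<Sum>n=0..N. if n \<le> N then w n / (\<Sum>m=0..N. w m) else 0) = 1"
      using pos by (simp add: sum_divide_distrib[symmetric])
  qed (use pos assms in \<open>auto intro: less_imp_le\<close>)
qed


section \<open>Ancestral lineages\<close>

text \<open>The sampling scheme shared by the algorithm and its limit. \<open>sel t a\<close> is the law of each
  ancestor index at time \<open>t\<close> given the indices \<open>a\<close> at time \<open>t - 1\<close>; \<open>fin a\<close> is the law of the
  index at time \<open>T\<close>; \<open>bwd t a k\<close> is the backward-sampling law of the index at time \<open>t\<close> given
  the index \<open>k\<close> at time \<open>t + 1\<close>. Ancestor indices \<open>A t n\<close> vanish outside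
  \<open>{1..T - 1} \<times> {1..N}\<close> and path indices \<open>K t\<close> outside \<open>{1..T}\<close>. In particular \<open>A t 0 = 0\<close>.\<close>

primrec ancestors_pmf ::
  "nat \<Rightarrow> (nat \<Rightarrow> (nat \<Rightarrow> nat) \<Rightarrow> nat pmf) \<Rightarrow> nat \<Rightarrow> (nat \<Rightarrow> nat \<Rightarrow> nat) pmf" where
  "ancestors_pmf N sel 0 = return_pmf (\<lambda>_ _. 0)"
| "ancestors_pmf N sel (Suc t) =
     bind_pmf (ancestors_pmf N sel t) (\<lambda>A.
       map_pmf (\<lambda>a. A(Suc t := a)) (Pi_pmf {1..N} 0 (\<lambda>_. sel (Suc t) (A t))))"

text \<open>\<open>lineage_pmf bs fin bwd T A j\<close>: law of the indices at times \<open>T, T - 1, \<dots>, T - j\<close>\<close>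

primrec lineage_pmf ::
  "bool \<Rightarrow> ((nat \<Rightarrow> nat) \<Rightarrow> nat pmf) \<Rightarrow> (nat \<Rightarrow> (nat \<Rightarrow> nat) \<Rightarrow> nat \<Rightarrow> nat pmf) \<Rightarrow>
   nat \<Rightarrow> (nat \<Rightarrow> nat \<Rightarrow> nat) \<Rightarrow> nat \<Rightarrow> (nat \<Rightarrow> nat) pmf" where
  "lineage_pmf bs fin bwd T A 0 = map_pmf (\<lambda>k. (\<lambda>_. 0)(T := k)) (fin (A (T - 1)))"
| "lineage_pmf bs fin bwd T A (Suc j) =
     bind_pmf (lineage_pmf bs fin bwd T A j) (\<lambda>K.
       let t = T - Suc j in
       map_pmf (\<lambda>k. K(t := k))
         (if bs then bwd t (A (t - 1)) (K (t + 1)) else return_pmf (A t (K (t + 1)))))"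

definition genealogy_pmf ::
  "nat \<Rightarrow> nat \<Rightarrow> bool \<Rightarrow> (nat \<Rightarrow> (nat \<Rightarrow> nat) \<Rightarrow> nat pmf) \<Rightarrow> ((nat \<Rightarrow> nat) \<Rightarrow> nat pmf) \<Rightarrow>
   (nat \<Rightarrow> (nat \<Rightarrow> nat) \<Rightarrow> nat \<Rightarrow> nat pmf) \<Rightarrow> ((nat \<Rightarrow> nat \<Rightarrow> nat) \<times> (nat \<Rightarrow> nat)) pmf" where
  "genealogy_pmf T N bs sel fin bwd =
     bind_pmf (ancestors_pmf N sel (T - 1)) (\<lambda>A.
       map_pmf (\<lambda>K. (A, K)) (lineage_pmf bs fin bwd T A (T - 1)))"


section \<open>The i-RW-CSMC update\<close>

text \<open>\<open>u (t, d) n\<close> is the standardised proposal increment; \<open>Z t n d\<close> is component \<open>d\<close> of particle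
  \<open>n\<close> at time \<open>t\<close>. Throughout, \<open>bs\<close> switches backward sampling on, and \<open>fm\<close> the forced move.\<close>

definition particles ::
  "(nat \<Rightarrow> real) \<Rightarrow> nat \<Rightarrow> (nat \<Rightarrow> nat \<Rightarrow> real) \<Rightarrow> (nat \<times> nat \<Rightarrow> nat \<Rightarrow> real) \<Rightarrow>
   nat \<Rightarrow> nat \<Rightarrow> nat \<Rightarrow> real" where
  "particles ell D x u t n d =
     (if n = 0 then x t d else x t d + sqrt (ell t / real D) * u (t, d) n)"

definition prod_tdens :: "fk_model \<Rightarrow> nat \<Rightarrow> nat \<Rightarrow> (nat \<Rightarrow> real) \<Rightarrow> (nat \<Rightarrow> real) \<Rightarrow> real" where
  "prod_tdens FK D t x y = (\<Prod>d=1..D. tdens FK t (x d) (y d))"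

definition prod_pot :: "fk_model \<Rightarrow> nat \<Rightarrow> nat \<Rightarrow> (nat \<Rightarrow> real) \<Rightarrow> real" where
  "prod_pot FK D t y = (\<Prod>d=1..D. pot FK t (y d))"

text \<open>\<open>a\<close> are the ancestor indices at time \<open>t - 1\<close>.\<close>

definition csmc_weight ::
  "fk_model \<Rightarrow> nat \<Rightarrow> (nat \<Rightarrow> nat \<Rightarrow> nat \<Rightarrow> real) \<Rightarrow> nat \<Rightarrow> (nat \<Rightarrow> nat) \<Rightarrow> nat \<Rightarrow> real" where
  "csmc_weight FK D Z t a l = prod_tdens FK D t (Z (t - 1) (a l)) (Z t l) * prod_pot FK D t (Z t l)"

definition csmc_genealogy ::
  "fk_model \<Rightarrow> nat \<Rightarrow> nat \<Rightarrow> nat \<Rightarrow> bool \<Rightarrow> bool \<Rightarrow> (nat \<Rightarrow> nat \<Rightarrow> nat \<Rightarrow> real) \<Rightarrow>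
   ((nat \<Rightarrow> nat \<Rightarrow> nat) \<times> (nat \<Rightarrow> nat)) pmf" where
  "csmc_genealogy FK T N D bs fm Z =
     genealogy_pmf T N bs
       (\<lambda>t a. weighted_pmf N (csmc_weight FK D Z t a))
       (\<lambda>a. select_pmf fm N
          (\<lambda>m. ln (csmc_weight FK D Z T a m) - ln (csmc_weight FK D Z T a 0)))
       (\<lambda>t a k'. weighted_pmf N
          (\<lambda>k. csmc_weight FK D Z t a k * prod_tdens FK D (t + 1) (Z t k) (Z (t + 1) k')))"

definition csmc_law ::
  "fk_model \<Rightarrow> nat \<Rightarrow> nat \<Rightarrow> (nat \<Rightarrow> real) \<Rightarrow> bool \<Rightarrow> bool \<Rightarrow> nat \<Rightarrow> (nat \<Rightarrow> nat \<Rightarrow> real) \<Rightarrow>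
   ((nat \<Rightarrow> nat \<Rightarrow> nat) \<times> (nat \<Rightarrow> nat)) measure" where
  "csmc_law FK T N ell bs fm D x =
     bind (PiM ({1..T} \<times> {1..D}) (\<lambda>_. mvnormal {1..N} (\<lambda>_. 0) Sigma_mat))
       (\<lambda>u. measure_pmf (csmc_genealogy FK T N D bs fm (particles ell D x u)))"


section \<open>The limiting law\<close>

text \<open>The vector \<open>(V\<^bsub>t\<^esub>, W\<^bsub>t\<^esub>)\<close> is indexed by \<open>{0, 1} \<times> {1..N}\<close>: block \<open>0\<close> is \<open>V\<^bsub>t\<^esub>\<close>, built from
  \<open>wbar t\<close>, and block \<open>1\<close> is \<open>W\<^bsub>t\<^esub>\<close>, built from \<open>wbar (t + 1)\<close>. Thus \<open>dwbar FK T t i\<close> and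
  \<open>ddwbar FK T t i\<close> are the first and second derivatives of \<open>wbar (t + i)\<close> with respect to
  \<open>x\<^bsub>t\<^esub>\<close>.\<close>

definition dwbar :: "fk_model \<Rightarrow> nat \<Rightarrow> nat \<Rightarrow> nat \<Rightarrow> real \<times> real \<Rightarrow> real" where
  "dwbar FK T t i = (if i = 0 then pd2 (wbar FK T t) else pd1 (wbar FK T (t + 1)))"

definition ddwbar :: "fk_model \<Rightarrow> nat \<Rightarrow> nat \<Rightarrow> nat \<Rightarrow> real \<times> real \<Rightarrow> real" where
  "ddwbar FK T t i =
     (if i = 0 then pd2 (pd2 (wbar FK T t)) else pd1 (pd1 (wbar FK T (t + 1))))"

definition VW_law ::
  "fk_model \<Rightarrow> nat \<Rightarrow> nat \<Rightarrow> (nat \<Rightarrow> real) \<Rightarrow> nat \<Rightarrow> (nat \<times> nat \<Rightarrow> real) measure" where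
  "VW_law FK T N ell t =
     mvnormal ({0, 1} \<times> {1..N})
       (\<lambda>(i, n). ell t / 2 * (\<integral>x. on_path (t + i) (ddwbar FK T t i) x \<partial>pi_law FK T))
       (\<lambda>(i, m) (j, n). ell t *
          (\<integral>x. on_path (t + i) (dwbar FK T t i) x * on_path (t + j) (dwbar FK T t j) x \<partial>pi_law FK T)
          * Sigma_mat m n)"

definition V_part :: "(nat \<Rightarrow> nat \<times> nat \<Rightarrow> real) \<Rightarrow> nat \<Rightarrow> nat \<Rightarrow> real" where
  "V_part v t n = (if n = 0 then 0 else v t (0, n))"

definition W_part :: "(nat \<Rightarrow> nat \<times> nat \<Rightarrow> real) \<Rightarrow> nat \<Rightarrow> nat \<Rightarrow> real" where
  "W_part v t n = (if t = 0 \<or> n = 0 then 0 else v t (1, n))"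

definition limit_genealogy ::
  "nat \<Rightarrow> nat \<Rightarrow> bool \<Rightarrow> bool \<Rightarrow> (nat \<Rightarrow> nat \<Rightarrow> real) \<Rightarrow> (nat \<Rightarrow> nat \<Rightarrow> real) \<Rightarrow>
   ((nat \<Rightarrow> nat \<Rightarrow> nat) \<times> (nat \<Rightarrow> nat)) pmf" where
  "limit_genealogy T N bs fm V W =
     genealogy_pmf T N bs
       (\<lambda>t a. select_pmf False N (\<lambda>m. V t m + W (t - 1) (a m)))
       (\<lambda>a. select_pmf fm N (\<lambda>m. V T m + W (T - 1) (a m)))
       (\<lambda>t a k'. select_pmf False N (\<lambda>m. V t m + W t m + W (t - 1) (a m)))"

definition limit_law ::
  "fk_model \<Rightarrow> nat \<Rightarrow> nat \<Rightarrow> (nat \<Rightarrow> real) \<Rightarrow> bool \<Rightarrow> bool \<Rightarrow>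
   ((nat \<Rightarrow> nat \<Rightarrow> nat) \<times> (nat \<Rightarrow> nat)) measure" where
  "limit_law FK T N ell bs fm =
     bind (PiM {1..T} (VW_law FK T N ell))
       (\<lambda>v. measure_pmf (limit_genealogy T N bs fm (V_part v) (W_part v)))"


section \<open>Acceptance rates and total variation\<close>

definition accept_rate ::
  "((nat \<Rightarrow> nat \<Rightarrow> nat) \<times> (nat \<Rightarrow> nat)) measure \<Rightarrow> nat \<Rightarrow> real" where
  "accept_rate P t = measure P {(A, K). K t \<noteq> 0}"

definition tv_dist :: "'a measure \<Rightarrow> 'a measure \<Rightarrow> real" where
  "tv_dist P Q = (SUP E\<in>sets P. \<bar>measure P E - measure Q E\<bar>)"

end

theory Submission
  imports Defs
begin

text \<open>Write the log-weights of the algorithm, relative to those of the reference path, as sums over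
  the \<open>D\<close> coordinates and expand them to second order in the proposal increments. Given the
  reference path, the linear part is exactly Gaussian, with covariance an empirical average over the
  coordinates; the quadratic part concentrates around an empirical average of second derivatives; the
  mixed part and the cubic remainder vanish in mean. On the set of paths whose empirical averages are
  within \<open>D\<^bsup>-1/4\<^esup>\<close> of their expectations under the target, which has probability
  tending to one by Chebyshev's inequality, the characteristic functions of the log-weights
  therefore converge to those of the limiting Gaussian vectors, along every sequence of such paths.
  Since the law of the indices has finite support and its point masses are bounded continuous
  functions of the log-weights, this gives convergence in total variation.\<close>

section \<open>Weak convergence from characteristic functions\<close>

text \<open>Uniformity over the typical set is reduced to sequences by picking near-maximisers of
  the supremum: afterwards the path is deterministic and only the Gaussian increments are random. No
  central limit theorem enters, because the linear part is Gaussian for every \<open>D\<close>; what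
  converges is a finite family of covariance entries. All errors are measured in mean absolute
  value, which serves twice: cosine is 1-Lipschitz, so a remainder that is small in mean leaves the
  limits of characteristic functions unchanged, and bounded means give tightness. The tolerance is a
  compromise: empirical means fluctuate on the scale D^(-1/2), so a tolerance D^(-1/4) still tends
  to zero while Markov's inequality leaves probability of order D^(-1/4) outside. Fourth moments are
  the natural assumption because the averaged functions include products of two first derivatives,
  and these products must be square integrable. Positivity of the limit needs no convergence:
  whatever the log-weights are, the lineage that runs through particle 1 at all times has positive
  probability.\<close>

inductive_set cos_span :: "'i set \<Rightarrow> (('i \<Rightarrow> real) \<Rightarrow> real) set" for I :: "'i set" where
  cos: "(\<lambda>x. c * cos ((\<Sum>i\<in>I. \<theta> i * x i) + b)) \<in> cos_span I"
| add: "f \<in> cos_span I \<Longrightarrow> g \<in> cos_span I \<Longrightarrow> (\<lambda>x. f x + g x) \<in> cos_span I"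

text \<open>The product-to-sum formula for cosines. The phase \<open>b\<close> in the generators is
  what puts sines and constants into the span as well, so that it is an algebra to which the
  Stone-Weierstrass theorem applies.\<close>

lemma cos_span_mult:
  assumes "f \<in> cos_span I" "g \<in> cos_span I"
  shows "(\<lambda>x. f x * g x) \<in> cos_span I"
  using assms
proof (induction arbitrary: g)
  case (cos c \<theta> b)
  from cos.prems show ?case
  proof induction
    case (cos c' \<theta>' b')
    have eq: "(\<lambda>x. c * cos ((\<Sum>i\<in>I. \<theta> i * x i) + b) * (c' * cos ((\<Sum>i\<in>I. \<theta>' i * x i) + b')))
      = (\<lambda>x. c * c' / 2 * cos ((\<Sum>i\<in>I. (\<theta> i - \<theta>' i) * x i) + (b - b'))
           + c * c' / 2 * cos ((\<Sum>i\<in>I. (\<theta> i + \<theta>' i) * x i) + (b + b')))"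
      (is "?l = ?r")
    proof
      fix x
      let ?p = "\<Sum>i\<in>I. \<theta> i * x i" and ?q = "\<Sum>i\<in>I. \<theta>' i * x i"
      have 1: "(\<Sum>i\<in>I. (\<theta> i - \<theta>' i) * x i) + (b - b') = (?p + b) - (?q + b')"
        by (simp add: algebra_simps sum_subtractf)
      have 2: "(\<Sum>i\<in>I. (\<theta> i + \<theta>' i) * x i) + (b + b') = (?p + b) + (?q + b')"
        by (simp add: algebra_simps sum.distrib)
      show "?l x = ?r x" unfolding 1 2 cos_diff cos_add by (simp add: algebra_simps)
    qed
    show ?case unfolding eq by (intro cos_span.intros)
  next
    case (add f g)
    show ?case unfolding distrib_left by (rule cos_span.add[OF add.IH])
  qed
next
  case (add f1 f2)
  show ?case unfolding distrib_right by (rule cos_span.add[OF add.IH(1,2)[OF add.prems]])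
qed

lemma cos_span_const: "(\<lambda>x. c) \<in> cos_span I"
  using cos_span.cos[where c = c and \<theta> = "\<lambda>_. 0" and b = 0 and I = I] by simp

lemma cos_span_sin:
  fixes I :: "'i set"
  assumes "finite I" "i \<in> I"
  shows "(\<lambda>x. sin (\<kappa> * x i)) \<in> cos_span I"
proof -
  have "(\<lambda>x. sin (\<kappa> * x i)) = (\<lambda>x. 1 * cos ((\<Sum>j\<in>I. (if j = i then \<kappa> else 0) * x j) + (- pi / 2)))"
  proof
    fix x :: "'i \<Rightarrow> real"
    have "(\<Sum>j\<in>I. (if j = i then \<kappa> else 0) * x j) = (\<Sum>j\<in>I. if j = i then \<kappa> * x j else 0)"
      by (rule sum.cong) auto
    then show "sin (\<kappa> * x i) = 1 * cos ((\<Sum>j\<in>I. (if j = i then \<kappa> else 0) * x j) + (- pi / 2))"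
      using assms by (simp add: cos_diff)
  qed
  then show ?thesis by (simp only: cos_span.cos)
qed

text \<open>Tychonoff's theorem. A function type carries the product topology over its whole index
  type, so the compact set for Stone-Weierstrass sits in a possibly infinite product although only
  the coordinates in \<open>I\<close> vary.\<close>

lemma compact_cube: "compact {s :: 'i \<Rightarrow> real. \<forall>i. s i \<in> {a..b}}"
proof -
  have "compactin (product_topology (\<lambda>_::'i. euclidean) UNIV) (PiE UNIV (\<lambda>_. {a..b::real}))"
    unfolding compactin_PiE by (simp add: compactin_euclidean_iff)
  moreover have "PiE UNIV (\<lambda>_. {a..b::real}) = {s :: 'i \<Rightarrow> real. \<forall>i. s i \<in> {a..b}}"
    by (auto simp: PiE_def Pi_def)
  ultimately show ?thesis
    by (simp add: euclidean_product_topology compactin_euclidean_iff)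
qed

text \<open>A triangle wave, equal to the identity on \<open>[- K, K]\<close>. Continuous functions of triangle waves
  are continuous functions of sines on the cube, hence limits of trigonometric sums.\<close>

definition tri_wave :: "real \<Rightarrow> real \<Rightarrow> real" where
  "tri_wave K v = 2 * K / pi * arcsin (sin (pi / (2 * K) * v))"

lemma tri_wave_id:
  assumes "0 < K" "\<bar>v\<bar> \<le> K"
  shows "tri_wave K v = v"
proof -
  have b: "\<bar>pi / (2 * K) * v\<bar> \<le> pi / 2"
    using assms by (simp add: abs_mult field_simps)
  show ?thesis
    unfolding tri_wave_def using assms b by (subst arcsin_sin) (simp_all only: abs_le_iff, auto)
qed

text \<open>Uniform approximation on the whole, non-compact space: the argument of \<open>f\<close>
  sees each coordinate only through its sine, and the vector of sines always lies in the compact set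
  \<open>S\<close>. Stone-Weierstrass is applied there and the result is pulled back.\<close>

lemma tri_wave_approx:
  fixes f :: "('i::countable \<Rightarrow> real) \<Rightarrow> real"
  assumes I: "finite I" and f: "continuous_on UNIV f" and e: "0 < e"
  obtains g where "g \<in> cos_span I"
    "\<And>x. \<bar>f (\<lambda>i. if i \<in> I then tri_wave K (x i) else 0) - g x\<bar> < e"
proof -
  define S where "S = {s :: 'i \<Rightarrow> real. (\<forall>i\<in>I. s i \<in> {-1..1}) \<and> (\<forall>i. i \<notin> I \<longrightarrow> s i = 0)}"
  define sn where "sn x = (\<lambda>i. if i \<in> I then sin (pi / (2 * K) * x i) else 0)" for x :: "'i \<Rightarrow> real"
  \<comment> \<open>The algebra on \<open>S\<close> is defined through the pullback: it contains
    every continuous \<open>g\<close> whose composition with the sines is a trigonometric sum.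
    Coordinates belong to it, which separates points.\<close>
  define R where "R = {g. continuous_on S g \<and> (\<lambda>x. g (sn x)) \<in> cos_span I}"
  have S_eq: "S = {s. \<forall>i. s i \<in> {-1..1}} \<inter> (\<Inter>i\<in>-I. {s. s i = 0})"
    by (auto simp: S_def split: if_splits)
  have "compact S" unfolding S_eq
    by (intro compact_Int_closed compact_cube closed_INT ballI closed_Collect_eq
        continuous_on_product_coordinates continuous_on_const)
  interpret function_ring_on R S
  proof
    show "compact S" by fact
    show "\<exists>f\<in>R. f x \<noteq> f y" if xy: "x \<in> S" "y \<in> S" "x \<noteq> y" for x y
    proof -
      obtain i where i: "x i \<noteq> y i" using xy(3) by blast
      then have iI: "i \<in> I" using xy by (auto simp: S_def)
      have "continuous_on S (\<lambda>s. s i)"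
        by (rule continuous_on_subset[OF continuous_on_product_coordinates]) auto
      moreover have "(\<lambda>x. sn x i) \<in> cos_span I"
        using cos_span_sin[OF I iI, of "pi / (2 * K)"] iI unfolding sn_def by (simp only: if_True)
      ultimately have "(\<lambda>s. s i) \<in> R" unfolding R_def mem_Collect_eq by (rule conjI)
      then show ?thesis by (rule bexI[of _ "\<lambda>s. s i", rotated]) (rule i)
    qed
  qed (simp_all add: R_def continuous_on_add continuous_on_mult cos_span.add cos_span_mult cos_span_const)
  \<comment> \<open>\<open>arcsin\<close> undoes the sine up to folding, and the folded identity is
    \<open>tri_wave\<close>; hence \<open>h\<close> composed with \<open>sn\<close> is
    \<open>f\<close> evaluated at the triangle waves.\<close>
  define h where "h s = f (\<lambda>i. if i \<in> I then 2 * K / pi * arcsin (s i) else 0)" for s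
  have "continuous_on S (\<lambda>s. if i \<in> I then 2 * K / pi * arcsin (s i) else 0)" for i
  proof (cases "i \<in> I")
    case True
    have "continuous_on S (\<lambda>s. arcsin (s i))"
      by (intro continuous_on_arcsin continuous_on_subset[OF continuous_on_product_coordinates])
        (use True in \<open>auto simp: S_def\<close>)
    with True show ?thesis by (simp only: if_True) (rule continuous_on_mult_left)
  qed auto
  then have "continuous_on S h"
    unfolding h_def
    by (intro continuous_on_compose2[OF f] continuous_on_coordinatewise_then_product) auto
  from Stone_Weierstrass_basic[OF this e] obtain g where g: "g \<in> R" "\<And>s. s \<in> S \<Longrightarrow> \<bar>h s - g s\<bar> < e"
    by blast
  show ?thesis
  proof (rule that[of "\<lambda>x. g (sn x)"])
    show "(\<lambda>x. g (sn x)) \<in> cos_span I" using g(1) by (simp add: R_def)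
    fix x
    have "sn x \<in> S" by (auto simp: S_def sn_def)
    moreover have "h (sn x) = f (\<lambda>i. if i \<in> I then tri_wave K (x i) else 0)"
      unfolding h_def sn_def tri_wave_def by (rule arg_cong[of _ _ f]) auto
    ultimately show "\<bar>f (\<lambda>i. if i \<in> I then tri_wave K (x i) else 0) - g (sn x)\<bar> < e"
      using g(2)[of "sn x"] by simp
  qed
qed

text \<open>Countability of the index type enters here: it makes coordinatewise measurability enough
  for measurability into the Borel sets of the product topology.\<close>

lemma continuous_family_borel:
  fixes f :: "('i::countable \<Rightarrow> real) \<Rightarrow> real"
  assumes f: "continuous_on UNIV f" and X: "\<And>i. (\<lambda>w. X w i) \<in> borel_measurable M"
  shows "(\<lambda>w. f (X w)) \<in> borel_measurable M"
  using borel_measurable_continuous_onI[OF f] measurable_coordinatewise_then_product[OF X]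
  by (rule measurable_compose_rev)

text \<open>If all coordinates are at most \<open>K\<close> in absolute value, the triangle waves
  change nothing. Otherwise some coordinate exceeds \<open>K\<close>, and the trivial error
  \<open>2 * B\<close> is dominated by \<open>2 * B / K\<close> times its absolute value. Thus
  Markov's inequality and the union bound are carried out pointwise, before integration.\<close>

lemma (in prob_space) expectation_truncation_error:
  fixes f g :: "('i::countable \<Rightarrow> real) \<Rightarrow> real"
  assumes I: "finite I" and f: "continuous_on UNIV f" and B: "\<And>x. \<bar>f x\<bar> \<le> B"
    and X: "\<And>i. i \<in> I \<Longrightarrow> integrable M (\<lambda>w. X w i)" and X0: "\<And>w i. i \<notin> I \<Longrightarrow> X w i = 0"
    and C: "\<And>i. i \<in> I \<Longrightarrow> expectation (\<lambda>w. \<bar>X w i\<bar>) \<le> C" and K: "0 < K"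
    and g: "integrable M (\<lambda>w. g (X w))"
    and fg: "\<And>x. \<bar>f (\<lambda>i. if i \<in> I then tri_wave K (x i) else 0) - g x\<bar> < e"
  shows "\<bar>expectation (\<lambda>w. f (X w)) - expectation (\<lambda>w. g (X w))\<bar> \<le> 2 * B * card I * C / K + e"
proof -
  have B0: "0 \<le> B" using B[of undefined] by linarith
  have Xm: "(\<lambda>w. X w i) \<in> borel_measurable M" for i
    using X[of i] X0[of i] by (cases "i \<in> I") auto
  let ?Y = "\<lambda>w i. if i \<in> I then tri_wave K (X w i) else 0"
  have i1: "integrable M (\<lambda>w. f (X w))"
    by (rule integrable_const_bound[of _ B]) (use B continuous_family_borel[OF f Xm] in auto)
  have i3: "integrable M (\<lambda>w. (\<Sum>i\<in>I. 2 * B / K * \<bar>X w i\<bar>) + e)"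
    using X by (intro Bochner_Integration.integrable_add Bochner_Integration.integrable_sum
        integrable_mult_right integrable_abs) auto
  have pw: "\<bar>f (X w) - g (X w)\<bar> \<le> (\<Sum>i\<in>I. 2 * B / K * \<bar>X w i\<bar>) + e" for w
  proof -
    have "\<bar>f (X w) - f (?Y w)\<bar> \<le> (\<Sum>i\<in>I. 2 * B / K * \<bar>X w i\<bar>)"
    proof (cases "\<forall>i\<in>I. \<bar>X w i\<bar> \<le> K")
      case True
      then have "?Y w = X w" using tri_wave_id[OF K] X0 by (intro ext) auto
      then show ?thesis using B0 K by (simp add: sum_nonneg)
    next
      case False
      then obtain j where j: "j \<in> I" "K < \<bar>X w j\<bar>" by auto
      have "\<bar>f (X w) - f (?Y w)\<bar> \<le> 2 * B" using B[of "X w"] B[of "?Y w"] by linarith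
      also have "\<dots> = 2 * B / K * K" using K by simp
      also have "\<dots> \<le> 2 * B / K * \<bar>X w j\<bar>" using j B0 K by (intro mult_left_mono) auto
      also have "\<dots> \<le> (\<Sum>i\<in>I. 2 * B / K * \<bar>X w i\<bar>)"
        using j I B0 K by (intro member_le_sum) auto
      finally show ?thesis .
    qed
    then show ?thesis using fg[of "X w"] by linarith
  qed
  have "\<bar>expectation (\<lambda>w. f (X w)) - expectation (\<lambda>w. g (X w))\<bar>
     = \<bar>expectation (\<lambda>w. f (X w) - g (X w))\<bar>" using i1 g by simp
  also have "\<dots> \<le> expectation (\<lambda>w. \<bar>f (X w) - g (X w)\<bar>)" by (rule integral_abs_bound)
  also have "\<dots> \<le> expectation (\<lambda>w. (\<Sum>i\<in>I. 2 * B / K * \<bar>X w i\<bar>) + e)"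
    using i1 g i3 pw by (intro integral_mono) auto
  also have "\<dots> = (\<Sum>i\<in>I. 2 * B / K * expectation (\<lambda>w. \<bar>X w i\<bar>)) + e"
    using X by (simp add: Bochner_Integration.integral_sum Bochner_Integration.integrable_sum prob_space)
  also have "\<dots> \<le> (\<Sum>i\<in>I. 2 * B / K * C) + e"
    using C B0 K by (intro add_right_mono sum_mono mult_left_mono) auto
  finally show ?thesis by (simp add: field_simps)
qed

text \<open>A form of Levy's continuity theorem for finitely many coordinates on varying probability
  spaces. Cosines with arbitrary phase carry the real and the imaginary part of the characteristic
  function; the bounded first absolute moments play the part of tightness.\<close>

theorem weak_convergence_from_cos:
  fixes f :: "('i::countable \<Rightarrow> real) \<Rightarrow> real"
    and M :: "nat \<Rightarrow> 'a measure" and L :: "'b measure"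
  assumes I: "finite I" and f: "continuous_on UNIV f" and B: "\<And>x. \<bar>f x\<bar> \<le> B"
    and M: "\<And>n. prob_space (M n)" and L: "prob_space L"
    and X: "\<And>n i. i \<in> I \<Longrightarrow> integrable (M n) (\<lambda>w. X n w i)"
    and X0: "\<And>n w i. i \<notin> I \<Longrightarrow> X n w i = 0"
    and XC: "\<And>i. i \<in> I \<Longrightarrow> Bseq (\<lambda>n. \<integral>w. \<bar>X n w i\<bar> \<partial>M n)"
    and Y: "\<And>i. i \<in> I \<Longrightarrow> integrable L (\<lambda>w. Y w i)" and Y0: "\<And>w i. i \<notin> I \<Longrightarrow> Y w i = 0"
    and lim: "\<And>\<theta> b. (\<lambda>n. \<integral>w. cos ((\<Sum>i\<in>I. \<theta> i * X n w i) + b) \<partial>M n)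
        \<longlonglongrightarrow> (\<integral>w. cos ((\<Sum>i\<in>I. \<theta> i * Y w i) + b) \<partial>L)"
  shows "(\<lambda>n. \<integral>w. f (X n w) \<partial>M n) \<longlonglongrightarrow> (\<integral>w. f (Y w) \<partial>L)"
proof -
  interpret L: prob_space L by fact
  interpret M: prob_space "M n" for n by (rule M)
  have B0: "0 \<le> B" using B[of undefined] by linarith
  have "\<forall>i\<in>I. \<exists>c. \<forall>n. (\<integral>w. \<bar>X n w i\<bar> \<partial>M n) \<le> c"
    using XC unfolding Bseq_def real_norm_def abs_le_iff by blast
  from bchoice[OF this] obtain c where c: "\<And>i n. i \<in> I \<Longrightarrow> (\<integral>w. \<bar>X n w i\<bar> \<partial>M n) \<le> c i" by blast
  \<comment> \<open>One bound for all coordinates, for all \<open>X n\<close> and for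
    \<open>Y\<close>. The summand 1 keeps it positive when \<open>I\<close> is empty or all moments
    vanish, so that the truncation level below is positive.\<close>
  define C' where "C' = 1 + (\<Sum>i\<in>I. \<bar>c i\<bar> + (\<integral>w. \<bar>Y w i\<bar> \<partial>L))"
  have Y0': "0 \<le> (\<integral>w. \<bar>Y w i\<bar> \<partial>L)" for i by (rule integral_nonneg_AE) simp
  have C1: "1 \<le> C'" using Y0' by (simp add: C'_def sum_nonneg)
  have CXY: "\<bar>c i\<bar> + (\<integral>w. \<bar>Y w i\<bar> \<partial>L) \<le> C'" if "i \<in> I" for i
    using member_le_sum[OF that, of "\<lambda>i. \<bar>c i\<bar> + (\<integral>w. \<bar>Y w i\<bar> \<partial>L)"] I Y0' by (simp add: C'_def)
  have CY: "(\<integral>w. \<bar>Y w i\<bar> \<partial>L) \<le> C'" if "i \<in> I" for i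
    using CXY[OF that] by linarith
  have CX: "(\<integral>w. \<bar>X n w i\<bar> \<partial>M n) \<le> C'" if "i \<in> I" for i n
    using CXY[OF that] c[OF that, of n] Y0'[of i] by linarith
  have Xm: "(\<lambda>w. X n w i) \<in> borel_measurable (M n)" for i n
    using X[of i n] X0[of i n] by (cases "i \<in> I") auto
  have Ym: "(\<lambda>w. Y w i) \<in> borel_measurable L" for i
    using Y[of i] Y0[of i] by (cases "i \<in> I") auto
  have span: "integrable L (\<lambda>w. g (Y w)) \<and> (\<forall>n. integrable (M n) (\<lambda>w. g (X n w)))
     \<and> (\<lambda>n. \<integral>w. g (X n w) \<partial>M n) \<longlonglongrightarrow> (\<integral>w. g (Y w) \<partial>L)" if "g \<in> cos_span I" for g
    using that
  proof induction
    case (cos c \<theta> b)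
    have [measurable]: "(\<lambda>w. X n w i) \<in> borel_measurable (M n)" "(\<lambda>w. Y w i) \<in> borel_measurable L" for n i
      using Xm Ym by auto
    have "integrable L (\<lambda>w. cos ((\<Sum>i\<in>I. \<theta> i * Y w i) + b))"
      by (rule L.integrable_const_bound[of _ 1]) auto
    moreover have "integrable (M n) (\<lambda>w. cos ((\<Sum>i\<in>I. \<theta> i * X n w i) + b))" for n
      by (rule M.integrable_const_bound[of _ 1]) auto
    ultimately show ?case using lim[of \<theta> b] by (auto intro: tendsto_intros)
  next
    case (add f g)
    then show ?case by (auto intro: tendsto_intros)
  qed
  show ?thesis
  proof (rule LIMSEQ_I)
    fix r :: real assume r: "0 < r"
    \<comment> \<open>Chosen so that the truncation error is at most \<open>r / 6\<close>. The final
      budget is twice \<open>r / 4 + r / 8\<close> for replacing \<open>f\<close> by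
      \<open>g\<close>, and \<open>r / 8\<close> for the convergence of the integrals of
      \<open>g\<close>: in total \<open>7 * r / 8\<close>.\<close>
    define K where "K = 12 * (B + 1) * (card I + 1) * C' / r"
    have K: "0 < K" using B0 C1 r by (simp add: K_def)
    have small: "2 * B * card I * C' / K < r / 4"
    proof -
      have p: "0 < B + 1" "0 < real (card I) + 1" "0 < C'" using B0 C1 by auto
      have "2 * B * card I * C' / K = r / 6 * ((B / (B + 1)) * (card I / (card I + 1)))"
        using p r by (simp add: K_def divide_simps)
      also have "\<dots> \<le> r / 6 * (1 * 1)"
        using B0 r by (intro mult_left_mono mult_mono) auto
      also have "\<dots> < r / 4" using r by simp
      finally show ?thesis .
    qed
    let ?t = "\<lambda>x i. if i \<in> I then tri_wave K (x i) else (0::real)"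
    obtain g where g: "g \<in> cos_span I" "\<And>x. \<bar>f (?t x) - g x\<bar> < r / 8"
      using tri_wave_approx[OF I f, of "r / 8" K] r by auto
    note sg = span[OF g(1)]
    have eX: "\<bar>(\<integral>w. f (X n w) \<partial>M n) - (\<integral>w. g (X n w) \<partial>M n)\<bar> < r / 4 + r / 8" for n
      using M.expectation_truncation_error[OF I f B X X0 CX K conjunct1[OF conjunct2[OF sg], rule_format] g(2)] small
      by (rule le_less_trans[OF _ add_strict_right_mono])
    have eY: "\<bar>(\<integral>w. f (Y w) \<partial>L) - (\<integral>w. g (Y w) \<partial>L)\<bar> < r / 4 + r / 8"
      using L.expectation_truncation_error[OF I f B Y Y0 CY K conjunct1[OF sg] g(2)] small
      by (rule le_less_trans[OF _ add_strict_right_mono])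
    obtain n0 where n0: "\<And>n. n \<ge> n0 \<Longrightarrow> \<bar>(\<integral>w. g (X n w) \<partial>M n) - (\<integral>w. g (Y w) \<partial>L)\<bar> < r / 8"
      using LIMSEQ_D[OF conjunct2[OF conjunct2[OF sg]], of "r / 8"] r by auto
    have "norm ((\<integral>w. f (X n w) \<partial>M n) - (\<integral>w. f (Y w) \<partial>L)) < r" if "n \<ge> n0" for n
      using eX[of n] eY n0[OF that] unfolding real_norm_def by linarith
    then show "\<exists>no. \<forall>n\<ge>no. norm ((\<integral>w. f (X n w) \<partial>M n) - (\<integral>w. f (Y w) \<partial>L)) < r" by blast
  qed
qed

section \<open>Genealogies as functions of log-weights\<close>

lemma pmf_bind_finite:
  assumes "finite S" "set_pmf p \<subseteq> S"
  shows "pmf (bind_pmf p f) y = (\<Sum>x\<in>S. pmf p x * pmf (f x) y)"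
  using assms by (simp add: pmf_bind integral_measure_pmf[of S] subset_iff mult.commute)

text \<open>The finite support common to all parameters makes the notion stable under
  \<open>bind_pmf\<close>, where point masses become finite sums of continuous products. It also
  reduces total variation to finitely many point masses.\<close>

definition cont_pmf :: "('h::topological_space \<Rightarrow> 'a pmf) \<Rightarrow> bool" where
  "cont_pmf p \<longleftrightarrow> (\<forall>y. continuous_on UNIV (\<lambda>h. pmf (p h) y)) \<and>
     (\<exists>S. finite S \<and> (\<forall>h. set_pmf (p h) \<subseteq> S))"

lemma cont_pmf_return [simp]: "cont_pmf (\<lambda>h. return_pmf x)"
  unfolding cont_pmf_def by (auto intro!: exI[of _ "{x}"])

lemma cont_pmf_bind:
  assumes p: "cont_pmf p" and f: "\<And>x. cont_pmf (\<lambda>h. f h x)"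
  shows "cont_pmf (\<lambda>h. bind_pmf (p h) (f h))"
proof -
  obtain S where S: "finite S" "\<And>h. set_pmf (p h) \<subseteq> S" using p unfolding cont_pmf_def by blast
  obtain R where R: "\<And>x. finite (R x)" "\<And>h x. set_pmf (f h x) \<subseteq> R x"
    using f unfolding cont_pmf_def by metis
  have c: "continuous_on UNIV (\<lambda>h. pmf (p h) y)" "continuous_on UNIV (\<lambda>h. pmf (f h x) z)" for y x z
    using p f[of x] unfolding cont_pmf_def by blast+
  show ?thesis unfolding cont_pmf_def pmf_bind_finite[OF S]
  proof (intro conjI allI exI[of _ "\<Union>x\<in>S. R x"])
    show "continuous_on UNIV (\<lambda>h. \<Sum>x\<in>S. pmf (p h) x * pmf (f h x) y)" for y
      by (intro continuous_on_sum continuous_on_mult c)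
    show "finite (\<Union>x\<in>S. R x)" using S R by auto
    show "set_pmf (bind_pmf (p h) (f h)) \<subseteq> (\<Union>x\<in>S. R x)" for h
      using S(2)[of h] R(2)[of h] by (auto simp: set_bind_pmf)
  qed
qed

lemma cont_pmf_map: "cont_pmf p \<Longrightarrow> cont_pmf (\<lambda>h. map_pmf g (p h))"
  unfolding map_pmf_def by (rule cont_pmf_bind) simp_all

lemma cont_pmf_Pi:
  assumes A: "finite A" and p: "\<And>x. x \<in> A \<Longrightarrow> cont_pmf (\<lambda>h. p h x)"
  shows "cont_pmf (\<lambda>h. Pi_pmf A dflt (p h))"
proof -
  have "\<forall>x. \<exists>R. x \<in> A \<longrightarrow> finite R \<and> (\<forall>h. set_pmf (p h x) \<subseteq> R)"
    using p unfolding cont_pmf_def by (meson le_less)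
  from choice[OF this] obtain R where "\<forall>x. x \<in> A \<longrightarrow> finite (R x) \<and> (\<forall>h. set_pmf (p h x) \<subseteq> R x)"
    by blast
  then have R: "\<And>x. x \<in> A \<Longrightarrow> finite (R x)" "\<And>h x. x \<in> A \<Longrightarrow> set_pmf (p h x) \<subseteq> R x"
    by blast+
  have c: "continuous_on UNIV (\<lambda>h. pmf (p h x) z)" if "x \<in> A" for x z
    using p[OF that] unfolding cont_pmf_def by blast
  show ?thesis unfolding cont_pmf_def pmf_Pi[OF A]
  proof (intro conjI allI exI[of _ "PiE_dflt A dflt R"])
    show "continuous_on UNIV (\<lambda>h. if \<forall>x. x \<notin> A \<longrightarrow> y x = dflt then \<Prod>x\<in>A. pmf (p h x) (y x) else 0)" for y
    proof (cases "\<forall>x. x \<notin> A \<longrightarrow> y x = dflt")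
      case True
      show ?thesis unfolding if_P[OF True] by (intro continuous_on_prod c)
    next
      case False
      show ?thesis unfolding if_not_P[OF False] by (rule continuous_on_const)
    qed
    show "finite (PiE_dflt A dflt R)" using A R by (intro finite_PiE_dflt) auto
    show "set_pmf (Pi_pmf A dflt (p h)) \<subseteq> PiE_dflt A dflt R" for h
      using R(2)[of _ h] by (auto simp: set_Pi_pmf[OF A] PiE_dflt_def)
  qed
qed

lemma cont_pmf_genealogy:
  assumes sel: "\<And>t a. cont_pmf (\<lambda>h. sel h t a)" and fin: "\<And>a. cont_pmf (\<lambda>h. fin h a)"
    and bwd: "\<And>t a k. cont_pmf (\<lambda>h. bwd h t a k)"
  shows "cont_pmf (\<lambda>h. genealogy_pmf T N bs (sel h) (fin h) (bwd h))"
proof -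
  have anc: "cont_pmf (\<lambda>h. ancestors_pmf N (sel h) t)" for t
    by (induction t) (auto intro!: cont_pmf_bind cont_pmf_map cont_pmf_Pi sel)
  have lin: "cont_pmf (\<lambda>h. lineage_pmf bs (fin h) (bwd h) T A j)" for A j
    by (induction j) (cases bs; auto simp: Let_def intro!: cont_pmf_bind cont_pmf_map fin bwd)+
  show ?thesis unfolding genealogy_pmf_def by (intro cont_pmf_bind cont_pmf_map anc lin)
qed

lemma set_select_pmf: "set_pmf (select_pmf forced N h) \<subseteq> {0..N}"
  by (auto simp: set_pmf_iff pmf_select_pmf Phi_def Psi_def split: if_splits)

text \<open>The first two terms add up to a nonnegative number, and the sum is positive because its
  range contains \<open>n\<close>. Continuity and positivity of the forced-move probabilities rest
  on this.\<close>

lemma Phi_pos_denominator: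
  fixes n N :: nat
  assumes "n \<in> {1..N}"
  shows "0 < 1 - min 1 (exp (h n)) + (\<Sum>m=1..N. exp (h m :: real))"
proof -
  have "0 < (\<Sum>m=1..N. exp (h m))" using assms by (intro sum_pos) auto
  moreover have "min 1 (exp (h n)) \<le> 1" by simp
  ultimately show ?thesis by linarith
qed

lemma cont_pmf_select:
  assumes g: "\<And>m. m \<in> {1..N} \<Longrightarrow> continuous_on UNIV (\<lambda>h. g h m)"
  shows "cont_pmf (\<lambda>h. select_pmf forced N (g h))"
proof -
  have S: "continuous_on UNIV (\<lambda>h. \<Sum>m=1..N. exp (g h m))"
    by (intro continuous_intros g)
  have phi: "continuous_on UNIV (\<lambda>h. Phi_pos N (g h) n)" if n: "n \<in> {1..N}" for n
    unfolding Phi_pos_def using Phi_pos_denominator[OF n]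
    by (intro continuous_on_divide continuous_on_add continuous_on_diff continuous_on_min
        continuous_on_const continuous_on_exp g[OF n] S ballI less_imp_neq[symmetric])
  have den: "1 + (\<Sum>m=1..N. exp (g h m)) \<noteq> 0" for h
    using sum_nonneg[of "{1..N}" "\<lambda>m. exp (g h m)"] by (simp add: add_nonneg_eq_0_iff)
  have "continuous_on UNIV (\<lambda>h. Phi N (g h) n)" for n
    by (cases "n = 0"; cases "n \<le> N")
      (auto simp: Phi_def intro!: continuous_intros phi)
  moreover have "continuous_on UNIV (\<lambda>h. Psi N (g h) n)" for n
    by (cases "n = 0"; cases "n \<le> N")
      (auto simp: Psi_def den simp del: One_nat_def intro!: continuous_on_divide continuous_on_add continuous_on_exp S g)
  ultimately have "continuous_on UNIV (\<lambda>h. pmf (select_pmf forced N (g h)) n)" for n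
    unfolding pmf_select_pmf by (cases forced) simp_all
  then show ?thesis
    unfolding cont_pmf_def using set_select_pmf by (intro conjI allI exI[of _ "{0..N}"]) auto
qed

lemma select_pmf_cong:
  assumes "\<And>m. m \<in> {1..N} \<Longrightarrow> h m = h' m"
  shows "select_pmf forced N h = select_pmf forced N h'"
proof (rule pmf_eqI)
  have "(\<Sum>m=1..N. exp (h m)) = (\<Sum>m=1..N. exp (h' m))" using assms by (intro sum.cong) auto
  moreover from this have "Phi_pos N h n = Phi_pos N h' n" if "n \<in> {1..N}" for n
    using assms that by (simp add: Phi_pos_def)
  ultimately show "pmf (select_pmf forced N h) n = pmf (select_pmf forced N h') n" for n
    using assms by (auto simp: pmf_select_pmf Phi_def Psi_def intro!: sum.cong)
qed

text \<open>Index 0 is left out on purpose: under the forced move it may have probability zero, for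
  instance if \<open>N = 1\<close> and \<open>h 1 \<ge> 0\<close>, where all mass goes to index
  1.\<close>

lemma pmf_select_pos:
  assumes "n \<in> {1..N}"
  shows "0 < pmf (select_pmf forced N h) n"
proof -
  have "0 < 1 + (\<Sum>m=1..N. exp (h m))" by (intro add_pos_nonneg sum_nonneg) auto
  then show ?thesis using assms Phi_pos_denominator[OF assms, of h]
    by (auto simp: pmf_select_pmf Phi_def Psi_def Phi_pos_def)
qed

text \<open>Numerator and denominator are divided by \<open>w 0\<close>. This removes the absolute
  size of the weights, which are products of \<open>D\<close> factors, and leaves only log-ratios to
  the reference particle.\<close>

lemma weighted_pmf_eq_select:
  assumes w: "\<And>l. l \<le> N \<Longrightarrow> 0 < w l"
  shows "weighted_pmf N w = select_pmf False N (\<lambda>m. ln (w m) - ln (w 0))"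
proof (rule pmf_eqI)
  fix n
  have e: "exp (ln (w m) - ln (w 0)) = w m / w 0" if "m \<le> N" for m
    using w[OF that] w[of 0] by (simp add: exp_diff)
  have "(\<Sum>m=0..N. w m) = w 0 + (\<Sum>m=1..N. w m)" by (simp add: sum.atLeast_Suc_atMost)
  moreover have "(\<Sum>m=1..N. exp (ln (w m) - ln (w 0))) = (\<Sum>m=1..N. w m) / w 0"
    unfolding sum_divide_distrib by (intro sum.cong) (auto simp: e)
  ultimately have "1 + (\<Sum>m=1..N. exp (ln (w m) - ln (w 0))) = (\<Sum>m=0..N. w m) / w 0"
    using w[of 0] by (simp add: add_divide_distrib)
  then show "pmf (weighted_pmf N w) n = pmf (select_pmf False N (\<lambda>m. ln (w m) - ln (w 0))) n"
    using w[of 0] by (auto simp: pmf_weighted_pmf[OF w] pmf_select_pmf Psi_def e)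
qed

text \<open>Kernels of two descriptions of the same algorithm agree only on ancestor vectors that
  can occur: index 0 keeps ancestor 0, and no index exceeds \<open>N\<close>. Both properties hold
  on the support, by induction over time, since the kernels on the left charge \<open>{0..N}\<close>
  only.\<close>

lemma genealogy_pmf_cong:
  fixes T N :: nat and bs :: bool
  defines "good \<equiv> \<lambda>a :: nat \<Rightarrow> nat. a 0 = 0 \<and> (\<forall>m. a m \<le> N)"
  assumes sel: "\<And>t a. t \<in> {1..T - 1} \<Longrightarrow> good a \<Longrightarrow> sel t a = sel' t a"
    and fin: "\<And>a. good a \<Longrightarrow> fin a = fin' a"
    and bwd: "\<And>t a k. bs \<Longrightarrow> t \<in> {1..T - 1} \<Longrightarrow> good a \<Longrightarrow> k \<le> N \<Longrightarrow> bwd t a k = bwd' t a k"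
    and sel_N: "\<And>t a. set_pmf (sel t a) \<subseteq> {0..N}"
    and fin_N: "\<And>a. set_pmf (fin a) \<subseteq> {0..N}"
    and bwd_N: "\<And>t a k. set_pmf (bwd t a k) \<subseteq> {0..N}"
  shows "genealogy_pmf T N bs sel fin bwd = genealogy_pmf T N bs sel' fin' bwd'"
proof -
  have anc_good: "A \<in> set_pmf (ancestors_pmf N sel t) \<Longrightarrow> good (A s)" for A t s
  proof (induction t arbitrary: A s)
    case (Suc t)
    from Suc.prems obtain A' a where A: "A = A'(Suc t := a)" "A' \<in> set_pmf (ancestors_pmf N sel t)"
      "a \<in> set_pmf (Pi_pmf {1..N} 0 (\<lambda>_. sel (Suc t) (A' t)))"
      by (auto simp: set_bind_pmf)
    have "a m \<in> set_pmf (sel (Suc t) (A' t)) \<or> a m = 0" for m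
      using A(3) by (cases "m \<in> {1..N}") (auto simp: set_Pi_pmf PiE_dflt_def)
    moreover have "a 0 = 0" using A(3) by (auto simp: set_Pi_pmf PiE_dflt_def)
    ultimately have "good a" using sel_N[of "Suc t" "A' t"] unfolding good_def
      by (metis atLeastAtMost_iff subsetD le0)
    then show ?case using A Suc.IH by auto
  qed (simp add: good_def)
  have anc: "ancestors_pmf N sel t = ancestors_pmf N sel' t" if "t \<le> T - 1" for t
    using that
  proof (induction t)
    case (Suc t)
    show ?case unfolding ancestors_pmf.simps
    proof (rule bind_pmf_cong)
      show "ancestors_pmf N sel t = ancestors_pmf N sel' t" using Suc by simp
      fix A assume "A \<in> set_pmf (ancestors_pmf N sel' t)"
      then have "A \<in> set_pmf (ancestors_pmf N sel t)" using Suc by simp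
      then have "good (A t)" by (rule anc_good)
      then show "map_pmf (\<lambda>a. A(Suc t := a)) (Pi_pmf {1..N} 0 (\<lambda>_. sel (Suc t) (A t)))
          = map_pmf (\<lambda>a. A(Suc t := a)) (Pi_pmf {1..N} 0 (\<lambda>_. sel' (Suc t) (A t)))"
        using sel[of "Suc t" "A t"] Suc.prems by simp
    qed
  qed simp
  have lin_N: "K \<in> set_pmf (lineage_pmf bs fin bwd T A j) \<Longrightarrow> K s \<le> N"
    if "\<And>s. good (A s)" for A K j s
  proof (induction j arbitrary: K s)
    case 0
    then show ?case using fin_N[of "A (T - 1)"] by auto
  next
    case (Suc j)
    then show ?case
      using bwd_N that unfolding good_def by (fastforce simp: set_bind_pmf Let_def split: if_splits)
  qed
  have lin: "lineage_pmf bs fin bwd T A j = lineage_pmf bs fin' bwd' T A j"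
    if A: "\<And>s. good (A s)" and "j \<le> T - 1" for A j
    using that(2)
  proof (induction j)
    case 0
    then show ?case using fin[OF A] by simp
  next
    case (Suc j)
    show ?case unfolding lineage_pmf.simps
    proof (rule bind_pmf_cong)
      show "lineage_pmf bs fin bwd T A j = lineage_pmf bs fin' bwd' T A j" using Suc by simp
      fix K assume "K \<in> set_pmf (lineage_pmf bs fin' bwd' T A j)"
      then have "K \<in> set_pmf (lineage_pmf bs fin bwd T A j)" using Suc by simp
      then have K: "K s \<le> N" for s by (rule lin_N[OF A])
      show "(let t = T - Suc j in map_pmf (\<lambda>k. K(t := k))
            (if bs then bwd t (A (t - 1)) (K (t + 1)) else return_pmf (A t (K (t + 1)))))
          = (let t = T - Suc j in map_pmf (\<lambda>k. K(t := k))
            (if bs then bwd' t (A (t - 1)) (K (t + 1)) else return_pmf (A t (K (t + 1)))))"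
      proof (cases bs)
        case True
        have "T - Suc j \<in> {1..T - 1}" using Suc.prems by auto
        from bwd[OF True this A K] show ?thesis by (simp add: Let_def)
      qed simp
    qed
  qed
  show ?thesis unfolding genealogy_pmf_def
  proof (rule bind_pmf_cong)
    show "ancestors_pmf N sel (T - 1) = ancestors_pmf N sel' (T - 1)" by (rule anc) simp
    fix A assume "A \<in> set_pmf (ancestors_pmf N sel' (T - 1))"
    then have "A \<in> set_pmf (ancestors_pmf N sel (T - 1))" using anc[OF order_refl] by simp
    then have "\<And>s. good (A s)" by (rule anc_good)
    then show "map_pmf (Pair A) (lineage_pmf bs fin bwd T A (T - 1))
        = map_pmf (Pair A) (lineage_pmf bs fin' bwd' T A (T - 1))"
      using lin by simp
  qed
qed

text \<open>Let every ancestor and every path index be 1. Ancestor tracing then yields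
  \<open>A t 1 = 1\<close>, and backward sampling can draw 1 directly, so one configuration serves
  both versions.\<close>

lemma genealogy_pmf_all_ones:
  assumes T: "1 \<le> T" and N: "1 \<le> N" and t: "t \<in> {1..T}"
    and sel: "\<And>t a. 1 \<in> set_pmf (sel t a)" and fin: "\<And>a. 1 \<in> set_pmf (fin a)"
    and bwd: "\<And>t a k. 1 \<in> set_pmf (bwd t a k)"
  shows "\<exists>A K. (A, K) \<in> set_pmf (genealogy_pmf T N bs sel fin bwd) \<and> K t = 1"
proof -
  have anc: "\<exists>A\<in>set_pmf (ancestors_pmf N sel t). \<forall>s\<in>{1..t}. \<forall>n\<in>{1..N}. A s n = 1" for t
  proof (induction t)
    case (Suc t)
    then obtain A where A: "A \<in> set_pmf (ancestors_pmf N sel t)" "\<forall>s\<in>{1..t}. \<forall>n\<in>{1..N}. A s n = 1"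
      by blast
    \<comment> \<open>Outside \<open>{1..N}\<close> the vector takes the default value 0 of
      \<open>Pi_pmf\<close>, as membership in the support demands.\<close>
    define a where "a n = (if n \<in> {1..N} then 1 else 0 :: nat)" for n
    have "a \<in> set_pmf (Pi_pmf {1..N} 0 (\<lambda>_. sel (Suc t) (A t)))"
      using sel by (auto simp: set_Pi_pmf PiE_dflt_def a_def)
    then have "A(Suc t := a) \<in> set_pmf (ancestors_pmf N sel (Suc t))"
      using A(1) by (auto simp: set_bind_pmf)
    moreover have "\<forall>s\<in>{1..Suc t}. \<forall>n\<in>{1..N}. (A(Suc t := a)) s n = 1"
      using A(2) by (auto simp: a_def)
    ultimately show ?case by blast
  qed simp
  from anc[of "T - 1"] obtain A where A: "A \<in> set_pmf (ancestors_pmf N sel (T - 1))"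
    "\<forall>s\<in>{1..T - 1}. \<forall>n\<in>{1..N}. A s n = 1" by blast
  have "\<exists>K\<in>set_pmf (lineage_pmf bs fin bwd T A j). \<forall>s\<in>{T - j..T}. K s = 1" if "j \<le> T - 1" for j
    using that
  proof (induction j)
    case 0
    then show ?case using fin[of "A (T - 1)"] by (auto intro!: bexI[of _ 1])
  next
    case (Suc j)
    then obtain K where K: "K \<in> set_pmf (lineage_pmf bs fin bwd T A j)" "\<forall>s\<in>{T - j..T}. K s = 1"
      by auto
    define t where "t = T - Suc j"
    have t: "t \<in> {1..T - 1}" "t + 1 = T - j" using Suc.prems by (auto simp: t_def)
    have K1: "K (t + 1) = 1" using K(2) t by auto
    have "K(t := 1) \<in> set_pmf (lineage_pmf bs fin bwd T A (Suc j))"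
      using K(1) bwd[of t "A (t - 1)" "K (t + 1)"] A(2) t(1) K1 N
      by (auto simp: set_bind_pmf Let_def t_def[symmetric] intro!: bexI[of _ K])
    moreover have "\<forall>s\<in>{T - Suc j..T}. (K(t := 1)) s = 1"
    proof
      fix s assume "s \<in> {T - Suc j..T}"
      then have "s = t \<or> s \<in> {T - j..T}" using t by (auto simp: t_def)
      then show "(K(t := 1)) s = 1" using K(2) by auto
    qed
    ultimately show ?case by blast
  qed
  from this[of "T - 1"] obtain K where K: "K \<in> set_pmf (lineage_pmf bs fin bwd T A (T - 1))"
    "\<forall>s\<in>{T - (T - 1)..T}. K s = 1" by auto
  have "(A, K) \<in> set_pmf (genealogy_pmf T N bs sel fin bwd)"
    using A(1) K(1) by (auto simp: genealogy_pmf_def set_bind_pmf)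
  moreover have "K t = 1" using K(2) t T by auto
  ultimately show ?thesis by blast
qed

text \<open>Both the algorithm and its limit depend on their randomness only through the log-weights
  \<open>h (t, a, l)\<close> of the moves from particle \<open>a\<close> at time \<open>t - 1\<close> to particle \<open>l\<close> at time \<open>t\<close>,
  relative to the move along the reference path.\<close>

definition log_genealogy ::
  "nat \<Rightarrow> nat \<Rightarrow> bool \<Rightarrow> bool \<Rightarrow> (nat \<times> nat \<times> nat \<Rightarrow> real) \<Rightarrow> ((nat \<Rightarrow> nat \<Rightarrow> nat) \<times> (nat \<Rightarrow> nat)) pmf" where
  "log_genealogy T N bs fm h =
     genealogy_pmf T N bs
       (\<lambda>t a. select_pmf False N (\<lambda>m. h (t, a m, m)))
       (\<lambda>a. select_pmf fm N (\<lambda>m. h (T, a m, m)))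
       (\<lambda>t a k'. select_pmf False N (\<lambda>k. h (t, a k, k) + h (t + 1, k, k') - h (t + 1, 0, k')))"

lemma cont_pmf_log_genealogy: "cont_pmf (log_genealogy T N bs fm)"
  unfolding log_genealogy_def
  by (intro cont_pmf_genealogy cont_pmf_select continuous_on_add continuous_on_diff
      continuous_on_product_coordinates)

lemma log_genealogy_all_ones:
  assumes "1 \<le> T" "1 \<le> N" "t \<in> {1..T}"
  shows "0 < measure_pmf.prob (log_genealogy T N bs fm h) {(A, K). K t \<noteq> 0}"
proof -
  have 1: "1 \<in> set_pmf (select_pmf forced N g)" for forced g
    using pmf_select_pos[of 1 N forced g] assms by (simp add: set_pmf_iff)
  have "\<exists>A K. (A, K) \<in> set_pmf (log_genealogy T N bs fm h) \<and> K t = 1"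
    unfolding log_genealogy_def by (rule genealogy_pmf_all_ones[OF assms 1 1 1])
  then obtain A K where g: "(A, K) \<in> set_pmf (log_genealogy T N bs fm h)" "K t = 1" by blast
  have "0 < measure_pmf.prob (log_genealogy T N bs fm h) {(A, K)}"
    using g(1) by (simp add: measure_pmf_single pmf_positive)
  also have "\<dots> \<le> measure_pmf.prob (log_genealogy T N bs fm h) {(A, K). K t \<noteq> 0}"
    using g(2) by (intro measure_pmf.finite_measure_mono) auto
  finally show ?thesis .
qed

lemma log_genealogy_cong:
  assumes T: "1 \<le> T" and eq: "\<And>t a l. t \<in> {1..T} \<Longrightarrow> a \<le> N \<Longrightarrow> l \<le> N \<Longrightarrow> h (t, a, l) = h' (t, a, l)"
  shows "log_genealogy T N bs fm h = log_genealogy T N bs fm h'"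
  unfolding log_genealogy_def
proof (rule genealogy_pmf_cong)
  fix t k :: nat and a :: "nat \<Rightarrow> nat"
  assume "t \<in> {1..T - 1}" "a 0 = 0 \<and> (\<forall>m. a m \<le> N)" "k \<le> N"
  then show "select_pmf False N (\<lambda>m. h (t, a m, m) + h (t + 1, m, k) - h (t + 1, 0, k))
    = select_pmf False N (\<lambda>m. h' (t, a m, m) + h' (t + 1, m, k) - h' (t + 1, 0, k))"
    using T eq by (intro select_pmf_cong) auto
qed (use T eq in \<open>auto intro!: select_pmf_cong set_select_pmf\<close>)

text \<open>In the backward step the log-weight from \<open>m\<close> to \<open>k'\<close> at time
  \<open>t + 1\<close>, relative to that from 0 to \<open>k'\<close>, is
  \<open>W t m - W t 0 = W t m\<close>: the term \<open>V (t + 1) k'\<close> cancels. This is why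
  the limiting backward kernel does not depend on \<open>k'\<close>.\<close>

lemma limit_genealogy_eq:
  assumes T: "1 \<le> T" and 0: "\<And>t. V t 0 = 0" "\<And>t. W t 0 = 0"
  shows "limit_genealogy T N bs fm V W = log_genealogy T N bs fm (\<lambda>(t, a, l). V t l + W (t - 1) a)"
  unfolding limit_genealogy_def log_genealogy_def
proof (rule genealogy_pmf_cong)
  fix t k :: nat and a :: "nat \<Rightarrow> nat"
  assume "t \<in> {1..T - 1}" "a 0 = 0 \<and> (\<forall>m. a m \<le> N)" "k \<le> N"
  then show "select_pmf False N (\<lambda>m. V t m + W t m + W (t - 1) (a m))
    = select_pmf False N (\<lambda>m. (case (t, a m, m) of (t, a, l) \<Rightarrow> V t l + W (t - 1) a)
        + (case (t + 1, m, k) of (t, a, l) \<Rightarrow> V t l + W (t - 1) a)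
        - (case (t + 1, 0, k) of (t, a, l) \<Rightarrow> V t l + W (t - 1) a))"
    using 0 by (intro select_pmf_cong) auto
qed (auto intro!: select_pmf_cong set_select_pmf)

text \<open>Positivity of all densities and potentials turns products over coordinates into sums of
  \<open>wbar\<close>. The backward weight involves \<open>prod_tdens\<close> alone, whereas
  \<open>wbar\<close> also contains the potential at time \<open>t + 1\<close>; that potential does
  not depend on the source particle and cancels in the difference.\<close>

lemma csmc_genealogy_eq:
  assumes T: "1 \<le> T" and dens: "\<And>s x y. s \<in> {1..T} \<Longrightarrow> 0 < tdens FK s x y"
    and pot: "\<And>s y. s \<in> {1..T} \<Longrightarrow> 0 < pot FK s y"
  shows "csmc_genealogy FK T N D bs fm Z = log_genealogy T N bs fm (\<lambda>(t, a, l).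
    \<Sum>d=1..D. wbar FK T t (Z (t - 1) a d, Z t l d) - wbar FK T t (Z (t - 1) 0 d, Z t 0 d))"
    (is "_ = log_genealogy T N bs fm ?h")
proof -
  have td_pos: "0 < prod_tdens FK D t x y" if "t \<in> {1..T}" for t x y
    using dens[OF that] by (auto simp: prod_tdens_def intro!: prod_pos)
  have pot_pos: "0 < prod_pot FK D t y" if "t \<in> {1..T}" for t y
    using pot[OF that] by (auto simp: prod_pot_def intro!: prod_pos)
  have w_pos: "0 < csmc_weight FK D Z t a l" if "t \<in> {1..T}" for t a l
    using td_pos[OF that] pot_pos[OF that] by (simp add: csmc_weight_def)
  have ln_td: "ln (prod_tdens FK D t x y) = (\<Sum>d=1..D. ln (tdens FK t (x d) (y d)))" if "t \<in> {1..T}" for t x y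
    unfolding prod_tdens_def using dens[OF that] by (subst ln_prod) (auto simp: less_imp_neq[symmetric])
  have ln_pot: "ln (prod_pot FK D t y) = (\<Sum>d=1..D. ln (pot FK t (y d)))" if "t \<in> {1..T}" for t y
    unfolding prod_pot_def using pot[OF that] by (subst ln_prod) (auto simp: less_imp_neq[symmetric])
  have ln_w: "ln (csmc_weight FK D Z t a l) = (\<Sum>d=1..D. wbar FK T t (Z (t - 1) (a l) d, Z t l d))"
    if t: "t \<in> {1..T}" for t a l
    using t td_pos[OF t] pot_pos[OF t]
    by (simp add: csmc_weight_def ln_mult_pos ln_td ln_pot wbar_def sum.distrib add.commute)
  have ratio: "ln (csmc_weight FK D Z t a m) - ln (csmc_weight FK D Z t a 0) = ?h (t, a m, m)"
    if "t \<in> {1..T}" "a 0 = 0" for t a m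
    using that by (simp add: ln_w sum_subtractf)
  show ?thesis unfolding csmc_genealogy_def
    apply (subst log_genealogy_def)
  proof (rule genealogy_pmf_cong[symmetric])
    fix t and a :: "nat \<Rightarrow> nat" assume t: "t \<in> {1..T - 1}" and a: "a 0 = 0 \<and> (\<forall>m. a m \<le> N)"
    have tT: "t \<in> {1..T}" using t by auto
    have "weighted_pmf N (csmc_weight FK D Z t a)
      = select_pmf False N (\<lambda>m. ln (csmc_weight FK D Z t a m) - ln (csmc_weight FK D Z t a 0))"
      by (rule weighted_pmf_eq_select) (rule w_pos[OF tT])
    also have "\<dots> = select_pmf False N (\<lambda>m. ?h (t, a m, m))"
      by (rule select_pmf_cong) (rule ratio, use tT a in auto)
    finally show "select_pmf False N (\<lambda>m. ?h (t, a m, m)) = weighted_pmf N (csmc_weight FK D Z t a)" ..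
  next
    fix a :: "nat \<Rightarrow> nat" assume a: "a 0 = 0 \<and> (\<forall>m. a m \<le> N)"
    show "select_pmf fm N (\<lambda>m. ?h (T, a m, m))
      = select_pmf fm N (\<lambda>m. ln (csmc_weight FK D Z T a m) - ln (csmc_weight FK D Z T a 0))"
      by (rule select_pmf_cong, rule ratio[symmetric]) (use T a in auto)
  next
    fix t k and a :: "nat \<Rightarrow> nat" assume t: "t \<in> {1..T - 1}" and a: "a 0 = 0 \<and> (\<forall>m. a m \<le> N)"
    have tT: "t \<in> {1..T}" and tT1: "t + 1 \<in> {1..T}" using t by auto
    let ?w = "\<lambda>m. csmc_weight FK D Z t a m * prod_tdens FK D (t + 1) (Z t m) (Z (t + 1) k)"
    have "weighted_pmf N ?w = select_pmf False N (\<lambda>m. ln (?w m) - ln (?w 0))"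
      by (rule weighted_pmf_eq_select) (intro mult_pos_pos w_pos td_pos tT tT1)
    also have "\<dots> = select_pmf False N (\<lambda>m. ?h (t, a m, m) + ?h (t + 1, m, k) - ?h (t + 1, 0, k))"
    proof (rule select_pmf_cong)
      fix m
      have "ln (?w m) - ln (?w 0) = ?h (t, a m, m)
          + (ln (prod_tdens FK D (t + 1) (Z t m) (Z (t + 1) k))
             - ln (prod_tdens FK D (t + 1) (Z t 0) (Z (t + 1) k)))"
        using w_pos[OF tT] td_pos[OF tT1] ratio[OF tT, of a m] a by (simp add: ln_mult_pos)
      also have "ln (prod_tdens FK D (t + 1) (Z t m) (Z (t + 1) k))
             - ln (prod_tdens FK D (t + 1) (Z t 0) (Z (t + 1) k))
          = ?h (t + 1, m, k) - ?h (t + 1, 0, k)"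
        unfolding ln_td[OF tT1] using t
        by (auto simp: wbar_def sum_subtractf[symmetric] intro!: sum.cong)
      finally show "ln (?w m) - ln (?w 0) = ?h (t, a m, m) + ?h (t + 1, m, k) - ?h (t + 1, 0, k)"
        by simp
    qed
    finally show "select_pmf False N (\<lambda>m. ?h (t, a m, m) + ?h (t + 1, m, k) - ?h (t + 1, 0, k))
      = weighted_pmf N ?w" ..
  qed (rule set_select_pmf)+
qed

section \<open>Mixing such families over random log-weights\<close>

lemma prob_finite_support:
  assumes S: "finite S" "\<And>h. set_pmf (p h) \<subseteq> S"
  shows "measure_pmf.prob (p h) E = (\<Sum>y\<in>S \<inter> E. pmf (p h) y)"
proof -
  have "measure_pmf.prob (p h) E = measure_pmf.prob (p h) (S \<inter> E)"
    using S(2)[of h] by (intro measure_pmf.finite_measure_eq_AE) (auto simp: AE_measure_pmf_iff)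
  then show ?thesis using S(1) by (simp add: measure_measure_pmf_finite)
qed

text \<open>Genealogies carry the discrete sigma-algebra, so \<open>E\<close> is arbitrary. The
  kernel is measurable since each event probability is a finite sum of point masses that are
  continuous in the log-weights.\<close>

lemma
  fixes p :: "('i::countable \<Rightarrow> real) \<Rightarrow> 'a pmf"
  assumes M: "prob_space M" and p: "cont_pmf p" and X: "\<And>i. (\<lambda>w. X w i) \<in> borel_measurable M"
  shows measure_bind_cont_pmf:
      "measure (bind M (\<lambda>w. measure_pmf (p (X w)))) E = (\<integral>w. measure_pmf.prob (p (X w)) E \<partial>M)"
    and cont_pmf_prob_borel: "(\<lambda>w. measure_pmf.prob (p (X w)) E) \<in> borel_measurable M"
proof -
  interpret prob_space M by fact
  obtain S where S: "finite S" "\<And>h. set_pmf (p h) \<subseteq> S" using p unfolding cont_pmf_def by blast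
  have m: "(\<lambda>w. pmf (p (X w)) y) \<in> borel_measurable M" for y
  proof -
    have "continuous_on UNIV (\<lambda>h. pmf (p h) y)" using p unfolding cont_pmf_def by blast
    from borel_measurable_continuous_onI[OF this] measurable_coordinatewise_then_product[OF X]
    show ?thesis by (rule measurable_compose_rev)
  qed
  note prob = prob_finite_support[OF S]
  show prob_m: "(\<lambda>w. measure_pmf.prob (p (X w)) E) \<in> borel_measurable M" for E
    unfolding prob using m by (intro borel_measurable_sum) auto
  have k: "(\<lambda>w. measure_pmf (p (X w))) \<in> M \<rightarrow>\<^sub>M subprob_algebra (count_space UNIV)"
    using prob_m by (intro measurable_subprob_algebra)
      (auto simp: measure_pmf.emeasure_eq_measure measure_pmf.subprob_space_axioms)
  show "measure (bind M (\<lambda>w. measure_pmf (p (X w)))) E = (\<integral>w. measure_pmf.prob (p (X w)) E \<partial>M)"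
    using k by (rule measure_bind) simp
qed

text \<open>The right-hand side is the l1 distance of the mean point masses and is free of
  \<open>E\<close>. One bound therefore controls total variation and acceptance rates
  together.\<close>

lemma sum_abs_bound_cont_pmf:
  fixes p :: "('i::countable \<Rightarrow> real) \<Rightarrow> 'a pmf"
  assumes p: "cont_pmf p" and S: "finite S" "\<And>h. set_pmf (p h) \<subseteq> S"
    and M: "prob_space M" and X: "\<And>i. (\<lambda>w. X w i) \<in> borel_measurable M"
    and L: "prob_space L" and Y: "\<And>i. (\<lambda>w. Y w i) \<in> borel_measurable L"
  shows "\<bar>measure (bind M (\<lambda>w. measure_pmf (p (X w)))) E - measure (bind L (\<lambda>w. measure_pmf (p (Y w)))) E\<bar>
    \<le> (\<Sum>y\<in>S. \<bar>(\<integral>w. pmf (p (X w)) y \<partial>M) - (\<integral>w. pmf (p (Y w)) y \<partial>L)\<bar>)"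
proof -
  interpret M: prob_space M by fact
  interpret L: prob_space L by fact
  note prob = prob_finite_support[OF S]
  have iM: "integrable M (\<lambda>w. pmf (p (X w)) y)" for y
    using cont_pmf_prob_borel[OF M p X, where E = "{y}"]
    by (intro M.integrable_const_bound[of _ 1]) (auto simp: pmf_le_1 measure_pmf_single)
  have iL: "integrable L (\<lambda>w. pmf (p (Y w)) y)" for y
    using cont_pmf_prob_borel[OF L p Y, where E = "{y}"]
    by (intro L.integrable_const_bound[of _ 1]) (auto simp: pmf_le_1 measure_pmf_single)
  have "\<bar>measure (bind M (\<lambda>w. measure_pmf (p (X w)))) E - measure (bind L (\<lambda>w. measure_pmf (p (Y w)))) E\<bar>
    = \<bar>\<Sum>y\<in>S \<inter> E. (\<integral>w. pmf (p (X w)) y \<partial>M) - (\<integral>w. pmf (p (Y w)) y \<partial>L)\<bar>"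
    unfolding measure_bind_cont_pmf[OF M p X] measure_bind_cont_pmf[OF L p Y] prob
    using iM iL by (simp add: Bochner_Integration.integral_sum sum_subtractf)
  also have "\<dots> \<le> (\<Sum>y\<in>S \<inter> E. \<bar>(\<integral>w. pmf (p (X w)) y \<partial>M) - (\<integral>w. pmf (p (Y w)) y \<partial>L)\<bar>)"
    by (rule sum_abs)
  also have "\<dots> \<le> (\<Sum>y\<in>S. \<bar>(\<integral>w. pmf (p (X w)) y \<partial>M) - (\<integral>w. pmf (p (Y w)) y \<partial>L)\<bar>)"
    using S(1) by (intro sum_mono2) auto
  finally show ?thesis .
qed

section \<open>Orthogonal sums and Gaussian vectors\<close>

lemma integrable_product_of_squares:
  fixes f g :: "'a \<Rightarrow> real"
  assumes [measurable]: "f \<in> borel_measurable M" "g \<in> borel_measurable M"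
    and f: "integrable M (\<lambda>x. (f x)\<^sup>2)" and g: "integrable M (\<lambda>x. (g x)\<^sup>2)"
  shows "integrable M (\<lambda>x. f x * g x)"
proof (rule Bochner_Integration.integrable_bound[OF Bochner_Integration.integrable_add[OF f g]])
  have "\<bar>f x * g x\<bar> \<le> (f x)\<^sup>2 + (g x)\<^sup>2" for x
  proof -
    have "2 * (\<bar>f x\<bar> * \<bar>g x\<bar>) \<le> (f x)\<^sup>2 + (g x)\<^sup>2"
      using sum_squares_bound[of "\<bar>f x\<bar>" "\<bar>g x\<bar>"] by simp
    moreover have "0 \<le> \<bar>f x\<bar> * \<bar>g x\<bar>" by simp
    ultimately show ?thesis unfolding abs_mult by linarith
  qed
  then show "AE x in M. norm (f x * g x) \<le> norm ((f x)\<^sup>2 + (g x)\<^sup>2)" by simp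
qed simp

text \<open>The quadratic \<open>s\<^sup>2 * A + 2 * s * B + C\<close> is nonnegative for all
  \<open>s\<close>; evaluation at its minimiser \<open>- B / A\<close> gives the claim. Applied to
  the two first derivatives, it makes the 2 by 2 block of limiting covariances positive
  semidefinite.\<close>

lemma Cauchy_Schwarz_integral:
  fixes f g :: "'a \<Rightarrow> real"
  assumes m: "f \<in> borel_measurable M" "g \<in> borel_measurable M"
    and f: "integrable M (\<lambda>x. (f x)\<^sup>2)" and g: "integrable M (\<lambda>x. (g x)\<^sup>2)"
  shows "(\<integral>x. f x * g x \<partial>M)\<^sup>2 \<le> (\<integral>x. (f x)\<^sup>2 \<partial>M) * (\<integral>x. (g x)\<^sup>2 \<partial>M)"
proof -
  define A B C where "A = (\<integral>x. (f x)\<^sup>2 \<partial>M)" and "B = (\<integral>x. f x * g x \<partial>M)" and "C = (\<integral>x. (g x)\<^sup>2 \<partial>M)"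
  note fg = integrable_product_of_squares[OF m f g]
  have q: "0 \<le> s\<^sup>2 * A + 2 * s * B + C" for s
  proof -
    have "0 \<le> (\<integral>x. (s * f x + g x)\<^sup>2 \<partial>M)" by (rule integral_nonneg_AE) simp
    also have "(\<lambda>x. (s * f x + g x)\<^sup>2) = (\<lambda>x. s\<^sup>2 * (f x)\<^sup>2 + 2 * s * (f x * g x) + (g x)\<^sup>2)"
      by (simp add: power2_eq_square algebra_simps)
    also have "(\<integral>x. s\<^sup>2 * (f x)\<^sup>2 + 2 * s * (f x * g x) + (g x)\<^sup>2 \<partial>M) = s\<^sup>2 * A + 2 * s * B + C"
      using f g fg by (simp add: A_def B_def C_def)
    finally show ?thesis .
  qed
  have A0: "0 \<le> A" "0 \<le> C" unfolding A_def C_def by (intro integral_nonneg_AE, simp)+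
  show ?thesis
  proof (cases "A = 0")
    case True
    have "B = 0"
    proof (rule ccontr)
      assume "B \<noteq> 0"
      \<comment> \<open>With \<open>A = 0\<close> the quadratic is affine in \<open>s\<close>; at
        this point its value would be -1.\<close>
      then have "2 * (- (C + 1) / (2 * B)) * B = - (C + 1)" by simp
      then show False using q[of "- (C + 1) / (2 * B)"] True by simp
    qed
    then show ?thesis using A0 by (simp add: A_def[symmetric] B_def[symmetric] C_def[symmetric])
  next
    case False
    then have "0 < A" using A0 by simp
    have "(- B / A)\<^sup>2 * A + 2 * (- B / A) * B + C = C - B\<^sup>2 / A"
      using \<open>0 < A\<close> by (simp add: field_simps power2_eq_square)
    with q[of "- B / A"] have "B\<^sup>2 / A \<le> C" by simp
    then show ?thesis using \<open>0 < A\<close>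
      by (simp add: A_def[symmetric] B_def[symmetric] C_def[symmetric] pos_divide_le_eq mult.commute)
  qed
qed

text \<open>The variance of the absolute value is nonnegative.\<close>

lemma (in prob_space) expectation_abs_le_sqrt:
  fixes X :: "'a \<Rightarrow> real"
  assumes m: "X \<in> borel_measurable M" and X: "integrable M (\<lambda>x. (X x)\<^sup>2)"
  shows "expectation (\<lambda>x. \<bar>X x\<bar>) \<le> sqrt (expectation (\<lambda>x. (X x)\<^sup>2))"
proof -
  have "integrable M X" using m X by (rule square_integrable_imp_integrable)
  then have "0 \<le> expectation (\<lambda>x. \<bar>X x\<bar>\<^sup>2) - (expectation (\<lambda>x. \<bar>X x\<bar>))\<^sup>2"
    using X variance_positive[of "\<lambda>x. \<bar>X x\<bar>"] by (subst variance_eq[symmetric]) auto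
  then show ?thesis by (intro real_le_rsqrt) simp
qed

text \<open>Orthogonality removes the off-diagonal terms of the squared sum; the mean absolute value
  is then bounded by the root of the second moment. Pairwise orthogonality suffices, which suits the
  products of increments in the mixed part.\<close>

lemma (in prob_space) orthogonal_sum_bound:
  fixes X :: "'j \<Rightarrow> 'a \<Rightarrow> real"
  assumes J: "finite J" and m: "\<And>j. j \<in> J \<Longrightarrow> X j \<in> borel_measurable M"
    and sq: "\<And>j. j \<in> J \<Longrightarrow> integrable M (\<lambda>w. (X j w)\<^sup>2)"
    and C: "\<And>j. j \<in> J \<Longrightarrow> expectation (\<lambda>w. (X j w)\<^sup>2) \<le> C"
    and orth: "\<And>j k. j \<in> J \<Longrightarrow> k \<in> J \<Longrightarrow> j \<noteq> k \<Longrightarrow> expectation (\<lambda>w. X j w * X k w) = 0"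
  shows "integrable M (\<lambda>w. \<Sum>j\<in>J. c j * X j w)"
    and "expectation (\<lambda>w. \<bar>\<Sum>j\<in>J. c j * X j w\<bar>) \<le> sqrt (C * (\<Sum>j\<in>J. (c j)\<^sup>2))"
proof -
  have prod: "integrable M (\<lambda>w. X j w * X k w)" if "j \<in> J" "k \<in> J" for j k
    using that m sq by (intro integrable_product_of_squares) auto
  have ex: "(\<Sum>j\<in>J. c j * X j w)\<^sup>2 = (\<Sum>j\<in>J. \<Sum>k\<in>J. c j * c k * (X j w * X k w))" for w
    by (simp add: power2_eq_square sum_product mult_ac)
  have int: "integrable M (\<lambda>w. (\<Sum>j\<in>J. c j * X j w)\<^sup>2)"
    unfolding ex using prod by (intro Bochner_Integration.integrable_sum integrable_mult_right) auto
  have mS: "(\<lambda>w. \<Sum>j\<in>J. c j * X j w) \<in> borel_measurable M" using m by auto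
  show "integrable M (\<lambda>w. \<Sum>j\<in>J. c j * X j w)"
    using mS int by (rule square_integrable_imp_integrable)
  have "expectation (\<lambda>w. (\<Sum>j\<in>J. c j * X j w)\<^sup>2)
      = (\<Sum>j\<in>J. \<Sum>k\<in>J. c j * c k * expectation (\<lambda>w. X j w * X k w))"
    unfolding ex using prod
    by (simp add: Bochner_Integration.integral_sum Bochner_Integration.integrable_sum)
  also have "\<dots> = (\<Sum>j\<in>J. \<Sum>k\<in>J. if j = k then (c j)\<^sup>2 * expectation (\<lambda>w. (X j w)\<^sup>2) else 0)"
    using orth by (intro sum.cong refl) (auto simp: power2_eq_square)
  also have "\<dots> = (\<Sum>j\<in>J. (c j)\<^sup>2 * expectation (\<lambda>w. (X j w)\<^sup>2))"
    using J by (simp add: sum.delta)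
  also have "\<dots> \<le> (\<Sum>j\<in>J. (c j)\<^sup>2 * C)" using C by (intro sum_mono mult_left_mono) auto
  finally have "expectation (\<lambda>w. (\<Sum>j\<in>J. c j * X j w)\<^sup>2) \<le> C * (\<Sum>j\<in>J. (c j)\<^sup>2)"
    by (simp add: sum_distrib_left mult.commute)
  then show "expectation (\<lambda>w. \<bar>\<Sum>j\<in>J. c j * X j w\<bar>) \<le> sqrt (C * (\<Sum>j\<in>J. (c j)\<^sup>2))"
    by (intro order_trans[OF expectation_abs_le_sqrt[OF mS int]] real_sqrt_le_mono)
qed

text \<open>A quantitative weak law of large numbers with deterministic bounded coefficients. It is
  applied to the columns of the target path (coefficients 1), to centred squared increments, and to
  products of increments at consecutive times.\<close>

lemma (in prob_space) orthogonal_average_bound: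
  fixes X :: "nat \<Rightarrow> 'a \<Rightarrow> real"
  assumes "\<And>d. d \<in> {1..D} \<Longrightarrow> X d \<in> borel_measurable M"
    "\<And>d. d \<in> {1..D} \<Longrightarrow> integrable M (\<lambda>w. (X d w)\<^sup>2)"
    "\<And>d. d \<in> {1..D} \<Longrightarrow> expectation (\<lambda>w. (X d w)\<^sup>2) \<le> C"
    "\<And>d e. d \<in> {1..D} \<Longrightarrow> e \<in> {1..D} \<Longrightarrow> d \<noteq> e \<Longrightarrow> expectation (\<lambda>w. X d w * X e w) = 0"
    and c: "\<And>d. d \<in> {1..D} \<Longrightarrow> \<bar>c d\<bar> \<le> B" and C: "0 \<le> C" and D: "1 \<le> D"
  shows "integrable M (\<lambda>w. (\<Sum>d=1..D. c d * X d w) / D)"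
    and "expectation (\<lambda>w. \<bar>(\<Sum>d=1..D. c d * X d w) / D\<bar>) \<le> B * sqrt (C / D)"
proof -
  note b = orthogonal_sum_bound[where J = "{1..D}" and c = c, OF finite_atLeastAtMost assms(1-4)]
  show "integrable M (\<lambda>w. (\<Sum>d=1..D. c d * X d w) / D)" using b(1) by simp
  have B0: "0 \<le> B" using c[of 1] D by auto
  have "(\<Sum>d=1..D. (c d)\<^sup>2) \<le> (\<Sum>d=1..D. B\<^sup>2)"
    using c B0 by (intro sum_mono) (auto intro: abs_le_square_iff[THEN iffD1])
  then have "C * (\<Sum>d=1..D. (c d)\<^sup>2) \<le> C * (D * B\<^sup>2)" using C by (intro mult_left_mono) auto
  then have "expectation (\<lambda>w. \<bar>\<Sum>d=1..D. c d * X d w\<bar>) \<le> sqrt (C * (D * B\<^sup>2))"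
    by (intro order_trans[OF b(2)] real_sqrt_le_mono)
  also have "\<dots> = D * (B * sqrt (C / D))"
  proof (rule real_sqrt_unique)
    have "(real D * (B * sqrt (C / D)))\<^sup>2 = real D * real D * B\<^sup>2 * (C / D)"
      using C by (simp add: power_mult_distrib power2_eq_square[of "real D"])
    then show "(real D * (B * sqrt (C / D)))\<^sup>2 = C * (D * B\<^sup>2)" using D by simp
  qed (use B0 C in simp)
  finally have "expectation (\<lambda>w. \<bar>\<Sum>d=1..D. c d * X d w\<bar>) / D \<le> B * sqrt (C / D)"
    using D by (simp add: divide_le_eq mult.commute)
  then show "expectation (\<lambda>w. \<bar>(\<Sum>d=1..D. c d * X d w) / D\<bar>) \<le> B * sqrt (C / D)"
    by simp
qed

text \<open>Coordinates outside \<open>S\<close> contribute the constant 1, whose integral is 1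
  under a probability measure. The codomain is a general normed field so that complex exponentials
  and real moments are covered alike.\<close>

lemma
  fixes f :: "'i \<Rightarrow> 'a \<Rightarrow> 'b::{real_normed_field,banach,second_countable_topology}"
  assumes M: "\<And>i. prob_space (M i)" and J: "finite J" and S: "S \<subseteq> J"
    and f: "\<And>j. j \<in> S \<Longrightarrow> integrable (M j) (f j)"
  shows PiM_integrable_prod: "integrable (PiM J M) (\<lambda>w. \<Prod>j\<in>S. f j (w j))"
    and PiM_integral_prod: "(\<integral>w. (\<Prod>j\<in>S. f j (w j)) \<partial>PiM J M) = (\<Prod>j\<in>S. \<integral>v. f j v \<partial>M j)"
proof -
  interpret product_prob_space M J using M by (rule product_prob_spaceI)
  define g where "g j v = (if j \<in> S then f j v else 1)" for j v
  have g: "integrable (M j) (g j)" for j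
    using f[of j] M[of j] by (cases "j \<in> S") (auto simp: g_def[abs_def] prob_space_def finite_measure.integrable_const)
  have gS: "(\<Prod>j\<in>J. g j (w j)) = (\<Prod>j\<in>S. f j (w j))" for w
    unfolding g_def using J S by (intro prod.mono_neutral_cong_right) auto
  have gI: "(\<Prod>j\<in>J. \<integral>v. g j v \<partial>M j) = (\<Prod>j\<in>S. \<integral>v. f j v \<partial>M j)"
    using J S M unfolding g_def by (intro prod.mono_neutral_cong_right) (auto simp: prob_space.prob_space)
  show "integrable (PiM J M) (\<lambda>w. \<Prod>j\<in>S. f j (w j))"
    using product_integrable_prod[OF J, of g] g by (simp add: gS)
  show "(\<integral>w. (\<Prod>j\<in>S. f j (w j)) \<partial>PiM J M) = (\<Prod>j\<in>S. \<integral>v. f j v \<partial>M j)"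
    using product_integral_prod[OF J, of g] g by (simp add: gS gI)
qed

lemma
  fixes f :: "'a \<Rightarrow> 'b::{real_normed_field,banach,second_countable_topology}"
  assumes M: "\<And>i. prob_space (M i)" and J: "finite J" and j: "j \<in> J" and f: "integrable (M j) f"
  shows PiM_integrable_component: "integrable (PiM J M) (\<lambda>w. f (w j))"
    and PiM_integral_component: "(\<integral>w. f (w j) \<partial>PiM J M) = (\<integral>v. f v \<partial>M j)"
  using PiM_integrable_prod[OF M J, where S = "{j}" and f = "\<lambda>_. f"] PiM_integral_prod[OF M J, where S = "{j}" and f = "\<lambda>_. f"] j f
  by simp_all

lemma PiM_integral_two_components:
  fixes f g :: "'a \<Rightarrow> 'b::{real_normed_field,banach,second_countable_topology}"
  assumes M: "\<And>i. prob_space (M i)" and J: "finite J" and jk: "j \<in> J" "k \<in> J" "j \<noteq> k"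
    and f: "integrable (M j) f" and g: "integrable (M k) g"
  shows "(\<integral>w. f (w j) * g (w k) \<partial>PiM J M) = (\<integral>v. f v \<partial>M j) * (\<integral>v. g v \<partial>M k)"
proof -
  have "integrable (M i) (if i = j then f else g)" if "i \<in> {j, k}" for i using that f g by auto
  then show ?thesis
    using PiM_integral_prod[where M = M and J = J and S = "{j, k}" and f = "\<lambda>i. if i = j then f else g", OF M J] jk
    by simp
qed

section \<open>Fourth moments\<close>

lemma power4_add_le: "(a + b) ^ 4 \<le> 8 * a ^ 4 + 8 * b ^ 4" for a b :: real
proof -
  have "(a + b)\<^sup>2 \<le> 2 * a\<^sup>2 + 2 * b\<^sup>2" using sum_squares_bound[of a b] by (simp add: power2_sum)
  then have "((a + b)\<^sup>2)\<^sup>2 \<le> (2 * a\<^sup>2 + 2 * b\<^sup>2)\<^sup>2" by (intro power_mono) auto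
  also have "\<dots> \<le> 8 * (a\<^sup>2)\<^sup>2 + 8 * (b\<^sup>2)\<^sup>2"
    using sum_squares_bound[of "a\<^sup>2" "b\<^sup>2"] by (simp add: power2_eq_square algebra_simps)
  finally show ?thesis by (simp add: power_mult[symmetric])
qed

lemma integrable_power4_add:
  fixes X Y :: "'a \<Rightarrow> real"
  assumes [measurable]: "X \<in> borel_measurable M" "Y \<in> borel_measurable M"
    and X: "integrable M (\<lambda>w. X w ^ 4)" and Y: "integrable M (\<lambda>w. Y w ^ 4)"
  shows "integrable M (\<lambda>w. (X w + Y w) ^ 4)"
  by (rule Bochner_Integration.integrable_bound[of _ "\<lambda>w. 8 * X w ^ 4 + 8 * Y w ^ 4"])
    (use X Y power4_add_le in auto)

lemma integrable_power4_sum: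
  fixes X :: "'j \<Rightarrow> 'a \<Rightarrow> real"
  assumes "finite J" "\<And>j. j \<in> J \<Longrightarrow> X j \<in> borel_measurable M"
    "\<And>j. j \<in> J \<Longrightarrow> integrable M (\<lambda>w. X j w ^ 4)"
  shows "integrable M (\<lambda>w. (\<Sum>j\<in>J. X j w) ^ 4)"
  using assms
proof (induction J)
  case (insert j J)
  have "integrable M (\<lambda>w. (X j w + (\<Sum>j\<in>J. X j w)) ^ 4)"
    using insert by (intro integrable_power4_add) auto
  then show ?case using insert by simp
qed simp

lemma (in finite_measure) integrable_lower_power:
  fixes X :: "'a \<Rightarrow> real"
  assumes [measurable]: "X \<in> borel_measurable M" and X: "integrable M (\<lambda>w. X w ^ 4)" and k: "k \<le> 4"
  shows "integrable M (\<lambda>w. \<bar>X w\<bar> ^ k)" "integrable M (\<lambda>w. X w ^ k)"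
proof -
  have le: "\<bar>a\<bar> ^ k \<le> 1 + a ^ 4" for a :: real
  proof (cases "\<bar>a\<bar> \<le> 1")
    case True
    then have "\<bar>a\<bar> ^ k \<le> 1" by (simp add: power_le_one)
    moreover have "0 \<le> a ^ 4" by (simp add: zero_le_even_power)
    ultimately show ?thesis by linarith
  next
    case False
    then have "\<bar>a\<bar> ^ k \<le> \<bar>a\<bar> ^ 4" using k by (intro power_increasing) auto
    then show ?thesis by (simp add: power_even_abs)
  qed
  have i: "integrable M (\<lambda>w. 1 + X w ^ 4)" using X by simp
  have b: "\<bar>X w\<bar> ^ k \<le> \<bar>1 + X w ^ 4\<bar>" for w using le[of "X w"] abs_ge_self by (rule order_trans)
  show "integrable M (\<lambda>w. \<bar>X w\<bar> ^ k)" "integrable M (\<lambda>w. X w ^ k)"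
    using b by (auto intro!: Bochner_Integration.integrable_bound[OF i] simp: power_abs)
qed

section \<open>Gaussian vectors given by a factor of their covariance\<close>

lemma prob_space_std_normal: "prob_space std_normal_distribution"
  using real_dist_normal_dist by (simp add: real_distribution_def)

text \<open>The condition under which \<open>mvnormal\<close> is the intended law: the
  \<open>SOME\<close> in its definition then picks a genuine factor of \<open>C\<close>.\<close>

definition has_cov_factor :: "'i set \<Rightarrow> ('i \<Rightarrow> 'i \<Rightarrow> real) \<Rightarrow> bool" where
  "has_cov_factor I C \<longleftrightarrow> (\<exists>L. \<forall>i\<in>I. \<forall>j\<in>I. (\<Sum>k\<in>I. L i k * L j k) = C i j)"

lemma mvnormal_rep:
  assumes "has_cov_factor I C"
  obtains L where "\<And>i j. i \<in> I \<Longrightarrow> j \<in> I \<Longrightarrow> (\<Sum>k\<in>I. L i k * L j k) = C i j"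
    "mvnormal I \<mu> C = distr (PiM I (\<lambda>_. std_normal_distribution)) (PiM I (\<lambda>_. borel))
           (\<lambda>z. \<lambda>i\<in>I. \<mu> i + (\<Sum>k\<in>I. L i k * z k))"
proof -
  define L where "L = (SOME L. \<forall>i\<in>I. \<forall>j\<in>I. (\<Sum>k\<in>I. L i k * L j k) = C i j)"
  have "\<forall>i\<in>I. \<forall>j\<in>I. (\<Sum>k\<in>I. L i k * L j k) = C i j"
    unfolding L_def by (rule someI_ex[OF assms[unfolded has_cov_factor_def]])
  then show ?thesis by (intro that[of L]) (simp_all add: mvnormal_def L_def[symmetric])
qed

lemma measurable_std_normal_component [measurable]:
  assumes "k \<in> I"
  shows "(\<lambda>z. z k) \<in> borel_measurable (PiM I (\<lambda>_. std_normal_distribution))"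
  using measurable_component_singleton[OF assms, of "\<lambda>_. std_normal_distribution"] by simp

lemma measurable_affine_std_normal:
  "(\<lambda>z. \<lambda>i\<in>I. \<mu> i + (\<Sum>k\<in>I. L i k * z k))
    \<in> PiM I (\<lambda>_. std_normal_distribution) \<rightarrow>\<^sub>M PiM I (\<lambda>_. borel :: real measure)"
  by (intro measurable_restrict borel_measurable_add borel_measurable_sum) auto

lemma sets_mvnormal [measurable_cong]: "sets (mvnormal I \<mu> C) = sets (PiM I (\<lambda>_. borel))"
  by (simp add: mvnormal_def Let_def)

lemma measurable_mvnormal_component [measurable]:
  assumes "i \<in> I"
  shows "(\<lambda>v. v i) \<in> borel_measurable (mvnormal I \<mu> C)"
  unfolding measurable_cong_sets[OF sets_mvnormal refl]
  by (rule measurable_component_singleton[OF assms])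

text \<open>With v = \<mu> + L z, the exponent is linear in the independent standard normals
  \<open>z k\<close>, so the integral factorises. The factor survives only through its Gram matrix,
  which is \<open>C\<close>.\<close>

lemma mvnormal_char:
  assumes I: "finite I" and C: "has_cov_factor I C"
  shows "(\<integral>v. iexp (\<Sum>i\<in>I. \<theta> i * v i) \<partial>mvnormal I \<mu> C)
    = iexp (\<Sum>i\<in>I. \<theta> i * \<mu> i) * of_real (exp (- (\<Sum>i\<in>I. \<Sum>j\<in>I. \<theta> i * \<theta> j * C i j) / 2))"
proof -
  obtain L where L: "\<And>i j. i \<in> I \<Longrightarrow> j \<in> I \<Longrightarrow> (\<Sum>k\<in>I. L i k * L j k) = C i j"
    and rep: "mvnormal I \<mu> C = distr (PiM I (\<lambda>_. std_normal_distribution)) (PiM I (\<lambda>_. borel))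
           (\<lambda>z. \<lambda>i\<in>I. \<mu> i + (\<Sum>k\<in>I. L i k * z k))"
    using mvnormal_rep[OF C] by blast
  \<comment> \<open>The transpose of \<open>L\<close> applied to \<theta>: the coefficients of the
    linear form in \<open>z\<close>. Their sum of squares is the quadratic form of \<open>C\<close>
    at \<theta>.\<close>
  define c where "c k = (\<Sum>i\<in>I. \<theta> i * L i k)" for k
  interpret N: prob_space std_normal_distribution by (rule prob_space_std_normal)
  have lin: "(\<Sum>i\<in>I. \<theta> i * (\<mu> i + (\<Sum>k\<in>I. L i k * z k))) = (\<Sum>i\<in>I. \<theta> i * \<mu> i) + (\<Sum>k\<in>I. c k * z k)" for z
  proof -
    have "(\<Sum>i\<in>I. \<theta> i * (\<Sum>k\<in>I. L i k * z k)) = (\<Sum>k\<in>I. c k * z k)"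
      unfolding c_def sum_distrib_left sum_distrib_right by (subst sum.swap) (simp add: mult_ac)
    then show ?thesis by (simp add: distrib_left sum.distrib)
  qed
  have int: "integrable std_normal_distribution (\<lambda>x. iexp (c k * x))" for k
    by (rule N.integrable_const_bound[of _ 1]) auto
  have "(\<integral>v. iexp (\<Sum>i\<in>I. \<theta> i * v i) \<partial>mvnormal I \<mu> C)
      = (\<integral>z. iexp (\<Sum>i\<in>I. \<theta> i * (\<lambda>i\<in>I. \<mu> i + (\<Sum>k\<in>I. L i k * z k)) i) \<partial>PiM I (\<lambda>_. std_normal_distribution))"
    unfolding rep by (rule integral_distr[OF measurable_affine_std_normal]) measurable
  also have "\<dots> = (\<integral>z. iexp (\<Sum>i\<in>I. \<theta> i * \<mu> i) * (\<Prod>k\<in>I. iexp (c k * z k)) \<partial>PiM I (\<lambda>_. std_normal_distribution))"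
  proof (rule Bochner_Integration.integral_cong[OF refl])
    fix z :: "'a \<Rightarrow> real"
    have "(\<Sum>i\<in>I. \<theta> i * (\<lambda>i\<in>I. \<mu> i + (\<Sum>k\<in>I. L i k * z k)) i) = (\<Sum>i\<in>I. \<theta> i * \<mu> i) + (\<Sum>k\<in>I. c k * z k)"
      by (simp add: lin)
    then show "iexp (\<Sum>i\<in>I. \<theta> i * (\<lambda>i\<in>I. \<mu> i + (\<Sum>k\<in>I. L i k * z k)) i)
        = iexp (\<Sum>i\<in>I. \<theta> i * \<mu> i) * (\<Prod>k\<in>I. iexp (c k * z k))"
      using I by (simp add: distrib_left exp_add sum_distrib_left exp_sum)
  qed
  also have "\<dots> = iexp (\<Sum>i\<in>I. \<theta> i * \<mu> i) * (\<Prod>k\<in>I. \<integral>x. iexp (c k * x) \<partial>std_normal_distribution)"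
    using PiM_integral_prod[OF prob_space_std_normal I subset_refl, where f = "\<lambda>k x. iexp (c k * x)"] int by simp
  also have "(\<lambda>k. \<integral>x. iexp (c k * x) \<partial>std_normal_distribution) = (\<lambda>k. of_real (exp (- (c k)\<^sup>2 / 2)))"
    using char_std_normal_distribution by (simp add: char_def fun_eq_iff)
  also have "(\<Prod>k\<in>I. of_real (exp (- (c k)\<^sup>2 / 2))) = complex_of_real (exp (- (\<Sum>k\<in>I. (c k)\<^sup>2) / 2))"
    using I by (simp add: exp_sum[symmetric] sum_negf sum_divide_distrib flip: of_real_prod)
  also have "(\<Sum>k\<in>I. (c k)\<^sup>2) = (\<Sum>i\<in>I. \<Sum>j\<in>I. \<theta> i * \<theta> j * C i j)"
  proof -
    have "(\<Sum>k\<in>I. (c k)\<^sup>2) = (\<Sum>k\<in>I. \<Sum>i\<in>I. \<Sum>j\<in>I. \<theta> i * \<theta> j * (L i k * L j k))"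
      by (simp add: c_def power2_eq_square sum_product mult_ac)
    also have "\<dots> = (\<Sum>i\<in>I. \<Sum>j\<in>I. \<Sum>k\<in>I. \<theta> i * \<theta> j * (L i k * L j k))"
      by (subst sum.swap, rule sum.cong[OF refl], rule sum.swap)
    also have "\<dots> = (\<Sum>i\<in>I. \<Sum>j\<in>I. \<theta> i * \<theta> j * C i j)"
      by (intro sum.cong refl) (simp add: L[symmetric] sum_distrib_left)
    finally show ?thesis .
  qed
  finally show ?thesis .
qed

text \<open>Independence over \<open>j\<close> multiplies the characteristic functions; the cosine
  is the real part after rotation by \<open>iexp b\<close>. The formula is used twice: for the
  increments, indexed by time and coordinate, and for the limiting vectors, indexed by time.\<close>

lemma PiM_mvnormal_cos:
  assumes J: "finite J" and I: "finite I" and C: "\<And>j. j \<in> J \<Longrightarrow> has_cov_factor I (C j)"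
  shows "(\<integral>w. cos ((\<Sum>j\<in>J. \<Sum>i\<in>I. \<theta> j i * w j i) + b) \<partial>PiM J (\<lambda>j. mvnormal I (\<mu> j) (C j)))
    = cos ((\<Sum>j\<in>J. \<Sum>i\<in>I. \<theta> j i * \<mu> j i) + b)
      * exp (- (\<Sum>j\<in>J. \<Sum>i\<in>I. \<Sum>k\<in>I. \<theta> j i * \<theta> j k * C j i k) / 2)"
proof -
  let ?M = "\<lambda>j. mvnormal I (\<mu> j) (C j)"
  note M = prob_space_mvnormal[OF I]
  interpret P: prob_space "PiM J ?M" by (intro prob_space_PiM M)
  define e where "e j v = iexp (\<Sum>i\<in>I. \<theta> j i * v i)" for j v
  have e: "integrable (?M j) (e j)" for j
    unfolding e_def
    by (rule finite_measure.integrable_const_bound[of _ _ 1]) (use M[of "\<mu> j" "C j"] in \<open>auto simp: prob_space_def\<close>)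
  have int: "integrable (PiM J ?M) (\<lambda>w. \<Prod>j\<in>J. e j (w j))"
    by (rule PiM_integrable_prod[OF M J subset_refl e])
  have "(\<integral>w. (\<Prod>j\<in>J. e j (w j)) \<partial>PiM J ?M) = (\<Prod>j\<in>J. \<integral>v. e j v \<partial>?M j)"
    by (rule PiM_integral_prod[OF M J subset_refl e])
  also have "\<dots> = (\<Prod>j\<in>J. iexp (\<Sum>i\<in>I. \<theta> j i * \<mu> j i)
      * of_real (exp (- (\<Sum>i\<in>I. \<Sum>k\<in>I. \<theta> j i * \<theta> j k * C j i k) / 2)))"
    unfolding e_def by (intro prod.cong refl mvnormal_char I C)
  also have "\<dots> = iexp (\<Sum>j\<in>J. \<Sum>i\<in>I. \<theta> j i * \<mu> j i)
      * of_real (exp (- (\<Sum>j\<in>J. \<Sum>i\<in>I. \<Sum>k\<in>I. \<theta> j i * \<theta> j k * C j i k) / 2))"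
    using J by (simp add: prod.distrib exp_sum[symmetric] sum_distrib_left sum_divide_distrib sum_negf
        flip: of_real_prod)
  finally have *: "(\<integral>w. (\<Prod>j\<in>J. e j (w j)) \<partial>PiM J ?M) = \<dots>" .
  have cos: "cos ((\<Sum>j\<in>J. \<Sum>i\<in>I. \<theta> j i * w j i) + b) = Re (iexp b * (\<Prod>j\<in>J. e j (w j)))" for w
  proof -
    have "(\<Prod>j\<in>J. e j (w j)) = iexp (\<Sum>j\<in>J. \<Sum>i\<in>I. \<theta> j i * w j i)"
      using J by (simp add: e_def exp_sum[symmetric] sum_distrib_left)
    then have "iexp b * (\<Prod>j\<in>J. e j (w j)) = iexp ((\<Sum>j\<in>J. \<Sum>i\<in>I. \<theta> j i * w j i) + b)"
      by (simp add: distrib_left exp_add mult.commute)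
    then show ?thesis by (simp only: Re_exp) simp
  qed
  have "(\<integral>w. cos ((\<Sum>j\<in>J. \<Sum>i\<in>I. \<theta> j i * w j i) + b) \<partial>PiM J ?M)
      = Re (iexp b * (\<integral>w. (\<Prod>j\<in>J. e j (w j)) \<partial>PiM J ?M))"
    unfolding cos using int by (simp add: integral_mult_right[symmetric] del: integral_mult_right)
  also have "\<dots> = Re (iexp ((\<Sum>j\<in>J. \<Sum>i\<in>I. \<theta> j i * \<mu> j i) + b)
      * of_real (exp (- (\<Sum>j\<in>J. \<Sum>i\<in>I. \<Sum>k\<in>I. \<theta> j i * \<theta> j k * C j i k) / 2)))"
    unfolding * by (simp add: distrib_left exp_add mult_ac)
  finally show ?thesis by (simp add: Re_exp)
qed

lemma mvnormal_power4:
  assumes I: "finite I" and C: "has_cov_factor I C" and i: "i \<in> I"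
  shows "integrable (mvnormal I \<mu> C) (\<lambda>v. v i ^ 4)"
proof -
  obtain L where rep: "mvnormal I \<mu> C = distr (PiM I (\<lambda>_. std_normal_distribution)) (PiM I (\<lambda>_. borel))
           (\<lambda>z. \<lambda>i\<in>I. \<mu> i + (\<Sum>k\<in>I. L i k * z k))"
    using mvnormal_rep[OF C] by blast
  interpret P: prob_space "PiM I (\<lambda>_. std_normal_distribution)"
    by (intro prob_space_PiM prob_space_std_normal)
  have "integrable (PiM I (\<lambda>_. std_normal_distribution)) (\<lambda>z. (L i k * z k) ^ 4)" if "k \<in> I" for k
    using PiM_integrable_component[OF prob_space_std_normal I that integrable_std_normal_distribution_moment[of 4]]
    by (simp add: power_mult_distrib)
  then have "integrable (PiM I (\<lambda>_. std_normal_distribution)) (\<lambda>z. (\<mu> i + (\<Sum>k\<in>I. L i k * z k)) ^ 4)"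
    using I by (intro integrable_power4_add integrable_power4_sum) auto
  then show ?thesis
    unfolding rep using i
    by (subst integrable_distr_eq[OF measurable_affine_std_normal]) auto
qed

lemma mvnormal_centred_moments:
  assumes I: "finite I" and C: "has_cov_factor I C" and i: "i \<in> I"
  shows "(\<integral>v. v i \<partial>mvnormal I (\<lambda>_. 0) C) = 0" "(\<integral>v. (v i)\<^sup>2 \<partial>mvnormal I (\<lambda>_. 0) C) = C i i"
proof -
  let ?P = "PiM I (\<lambda>_. std_normal_distribution)"
  obtain L where L: "\<And>i j. i \<in> I \<Longrightarrow> j \<in> I \<Longrightarrow> (\<Sum>k\<in>I. L i k * L j k) = C i j"
    and rep: "mvnormal I (\<lambda>_. 0) C = distr ?P (PiM I (\<lambda>_. borel))
           (\<lambda>z. \<lambda>i\<in>I. 0 + (\<Sum>k\<in>I. L i k * z k))"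
    using mvnormal_rep[OF C] by blast
  note N = prob_space_std_normal
  have i1: "integrable std_normal_distribution (\<lambda>x. x)"
    using integrable_std_normal_distribution_moment[of 1] by simp
  have e1: "(\<integral>x. x \<partial>std_normal_distribution) = 0"
    using integral_std_normal_distribution_moment_odd[of 1] by simp
  have i2: "integrable std_normal_distribution (\<lambda>x. x * x)"
    using integrable_std_normal_distribution_moment[of 2] by (simp add: power2_eq_square)
  have e2: "(\<integral>x. x * x \<partial>std_normal_distribution) = 1"
    using std_normal_distribution_even_moments(1)[of 1] by (simp add: power2_eq_square)
  have zz: "integrable ?P (\<lambda>z. z k * z l) \<and> (\<integral>z. z k * z l \<partial>?P) = (if k = l then 1 else 0)"
    if "k \<in> I" "l \<in> I" for k l
  proof (cases "k = l")
    case True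
    then show ?thesis
      using PiM_integrable_component[OF N I that(1) i2] PiM_integral_component[OF N I that(1) i2] e2 by simp
  next
    case False
    then show ?thesis
      using PiM_integral_two_components[OF N I that False i1 i1] e1
        PiM_integrable_prod[OF N I, where S = "{k, l}" and f = "\<lambda>_ x. x"] that i1 by simp
  qed
  have "(\<integral>v. v i \<partial>mvnormal I (\<lambda>_. 0) C) = (\<integral>z. (\<Sum>k\<in>I. L i k * z k) \<partial>?P)"
    unfolding rep using i by (subst integral_distr[OF measurable_affine_std_normal]) auto
  also have "\<dots> = 0"
    using PiM_integrable_component[OF N I _ i1] PiM_integral_component[OF N I _ i1] e1
    by (subst Bochner_Integration.integral_sum) auto
  finally show "(\<integral>v. v i \<partial>mvnormal I (\<lambda>_. 0) C) = 0" .
  have "(\<integral>v. (v i)\<^sup>2 \<partial>mvnormal I (\<lambda>_. 0) C) = (\<integral>z. (\<Sum>k\<in>I. L i k * z k)\<^sup>2 \<partial>?P)"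
    unfolding rep using i by (subst integral_distr[OF measurable_affine_std_normal]) auto
  also have "\<dots> = (\<integral>z. (\<Sum>k\<in>I. \<Sum>l\<in>I. L i k * L i l * (z k * z l)) \<partial>?P)"
    by (simp add: power2_eq_square sum_product mult_ac)
  also have "\<dots> = (\<Sum>k\<in>I. \<Sum>l\<in>I. L i k * L i l * (\<integral>z. z k * z l \<partial>?P))"
    using zz by (simp add: Bochner_Integration.integral_sum Bochner_Integration.integrable_sum)
  also have "\<dots> = (\<Sum>k\<in>I. \<Sum>l\<in>I. if k = l then L i k * L i l else 0)"
    using zz by (intro sum.cong refl) auto
  also have "\<dots> = C i i" using I L[OF i i] by (simp add: sum.delta)
  finally show "(\<integral>v. (v i)\<^sup>2 \<partial>mvnormal I (\<lambda>_. 0) C) = C i i" .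
qed

section \<open>The target law and its typical set\<close>

lemma sigma_finite_product_const: "sigma_finite_measure M \<Longrightarrow> product_sigma_finite (\<lambda>_. M)"
  by (simp add: product_sigma_finite_def)

lemma distr_PiM_reindex_const:
  assumes M: "sigma_finite_measure M" and J: "finite J" and h: "bij_betw h J K"
  shows "distr (PiM K (\<lambda>_. M)) (PiM J (\<lambda>_. M)) (\<lambda>y. \<lambda>j\<in>J. y (h j)) = PiM J (\<lambda>_. M)"
proof -
  interpret product_sigma_finite "\<lambda>_. M" by (rule sigma_finite_product_const[OF M])
  have K: "finite K" using h J by (simp add: bij_betw_finite)
  have hK: "h j \<in> K" if "j \<in> J" for j using h that by (rule bij_betwE[THEN bspec])
  have m: "(\<lambda>y. \<lambda>j\<in>J. y (h j)) \<in> PiM K (\<lambda>_. M) \<rightarrow>\<^sub>M PiM J (\<lambda>_. M)"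
    by (intro measurable_restrict measurable_component_singleton hK)
  show ?thesis
  proof (rule PiM_eqI[OF J])
    fix A assume A: "\<And>i. i \<in> J \<Longrightarrow> A i \<in> sets M"
    let ?B = "\<lambda>k. A (inv_into J h k)"
    have inv: "inv_into J h (h j) = j" if "j \<in> J" for j
      using h that by (simp add: bij_betw_def inv_into_f_f)
    have invK: "inv_into J h k \<in> J" "h (inv_into J h k) = k" if "k \<in> K" for k
      using h that by (auto simp: bij_betw_def inv_into_into f_inv_into_f)
    have "(\<lambda>y. \<lambda>j\<in>J. y (h j)) -` PiE J A \<inter> space (PiM K (\<lambda>_. M)) = PiE K ?B"
    proof (intro equalityI subsetI)
      fix y assume y: "y \<in> (\<lambda>y. \<lambda>j\<in>J. y (h j)) -` PiE J A \<inter> space (PiM K (\<lambda>_. M))"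
      have yA: "y (h j) \<in> A j" if "j \<in> J" for j
      proof -
        have "(\<lambda>j\<in>J. y (h j)) j \<in> A j" using y that by (intro PiE_mem[of _ J A]) auto
        then show ?thesis using that by simp
      qed
      show "y \<in> PiE K ?B"
      proof (rule PiE_I)
        fix k assume "k \<in> K"
        then show "y k \<in> ?B k" using yA[of "inv_into J h k"] invK by simp
      next
        fix k assume "k \<notin> K"
        then show "y k = undefined" using y by (auto simp: space_PiM PiE_def extensional_def)
      qed
    next
      fix y assume y: "y \<in> PiE K ?B"
      have "y \<in> space (PiM K (\<lambda>_. M))"
        using y A[THEN sets.sets_into_space] invK by (fastforce simp: space_PiM PiE_def Pi_def)
      moreover have "y (h j) \<in> A j" if "j \<in> J" for j
        using PiE_mem[OF y hK[OF that]] inv[OF that] by simp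
      ultimately show "y \<in> (\<lambda>y. \<lambda>j\<in>J. y (h j)) -` PiE J A \<inter> space (PiM K (\<lambda>_. M))" by auto
    qed
    then have "emeasure (distr (PiM K (\<lambda>_. M)) (PiM J (\<lambda>_. M)) (\<lambda>y. \<lambda>j\<in>J. y (h j))) (PiE J A)
        = emeasure (PiM K (\<lambda>_. M)) (PiE K ?B)"
      using A J by (subst emeasure_distr[OF m]) (auto intro!: sets_PiM_I_finite)
    also have "\<dots> = (\<Prod>k\<in>K. emeasure M (?B k))"
      using A K invK by (intro emeasure_PiM) auto
    also have "\<dots> = (\<Prod>j\<in>J. emeasure M (A j))"
      using inv by (intro prod.reindex_bij_betw[OF h, symmetric, THEN trans] prod.cong) auto
    finally show "emeasure (distr (PiM K (\<lambda>_. M)) (PiM J (\<lambda>_. M)) (\<lambda>y. \<lambda>j\<in>J. y (h j))) (PiE J A)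
        = (\<Prod>j\<in>J. emeasure M (A j))" .
  qed simp
qed

lemma measurable_curry:
  "(\<lambda>x. \<lambda>i\<in>I. \<lambda>j\<in>J. x (i, j)) \<in> PiM (I \<times> J) (\<lambda>_. M) \<rightarrow>\<^sub>M PiM I (\<lambda>_. PiM J (\<lambda>_. M))"
  by (intro measurable_restrict measurable_component_singleton) auto

text \<open>Induction over the rows: Fubini splits off the row over \<open>{i} \<times> J\<close>,
  the bijection that pairs \<open>i\<close> with \<open>j\<close> identifies it with a product over
  \<open>J\<close>, and the induction hypothesis treats the remaining rows.\<close>

lemma nn_integral_PiM_curry:
  assumes M: "sigma_finite_measure M" and I: "finite I" and J: "finite J"
    and f: "f \<in> borel_measurable (PiM I (\<lambda>_. PiM J (\<lambda>_. M)))"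
  shows "(\<integral>\<^sup>+ x. f (\<lambda>i\<in>I. \<lambda>j\<in>J. x (i, j)) \<partial>PiM (I \<times> J) (\<lambda>_. M)) = (\<integral>\<^sup>+ x. f x \<partial>PiM I (\<lambda>_. PiM J (\<lambda>_. M)))"
  using I f
proof (induction I arbitrary: f)
  case empty
  interpret product_sigma_finite "\<lambda>_. M" by (rule sigma_finite_product_const[OF M])
  show ?case by (simp add: PiM_empty nn_integral_count_space_finite)
next
  case (insert i I)
  interpret P: product_sigma_finite "\<lambda>_. M" by (rule sigma_finite_product_const[OF M])
  have PJ: "sigma_finite_measure (PiM J (\<lambda>_. M))" by (rule P.sigma_finite[OF J])
  interpret Q: product_sigma_finite "\<lambda>_. PiM J (\<lambda>_. M)" by (rule sigma_finite_product_const[OF PJ])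
  note f[measurable] = insert.prems
  have eq: "insert i I \<times> J = (I \<times> J) \<union> ({i} \<times> J)" by auto
  have bij: "bij_betw (\<lambda>j. (i, j)) J ({i} \<times> J)" by (auto simp: bij_betw_def inj_on_def)
  have cm: "(\<lambda>x. f (\<lambda>k\<in>insert i I. \<lambda>j\<in>J. x (k, j))) \<in> borel_measurable (PiM (I \<times> J \<union> {i} \<times> J) (\<lambda>_. M))"
    using measurable_compose[OF measurable_curry f] unfolding eq .
  have fu: "(\<lambda>p. f ((fst p)(i := snd p))) \<in> borel_measurable (PiM I (\<lambda>_. PiM J (\<lambda>_. M)) \<Otimes>\<^sub>M PiM J (\<lambda>_. M))"
    using measurable_compose[OF measurable_add_dim[of i I "\<lambda>_. PiM J (\<lambda>_. M)"] f]
    by (simp add: case_prod_beta)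
  have "(\<integral>\<^sup>+ x. f (\<lambda>k\<in>insert i I. \<lambda>j\<in>J. x (k, j)) \<partial>PiM (insert i I \<times> J) (\<lambda>_. M))
    = (\<integral>\<^sup>+ x. \<integral>\<^sup>+ y. f (\<lambda>k\<in>insert i I. \<lambda>j\<in>J. merge (I \<times> J) ({i} \<times> J) (x, y) (k, j))
        \<partial>PiM ({i} \<times> J) (\<lambda>_. M) \<partial>PiM (I \<times> J) (\<lambda>_. M))"
    unfolding eq using insert.hyps J by (intro P.product_nn_integral_fold cm) auto
  also have "\<dots> = (\<integral>\<^sup>+ x. \<integral>\<^sup>+ y. f ((\<lambda>k\<in>I. \<lambda>j\<in>J. x (k, j))(i := \<lambda>j\<in>J. y (i, j)))
        \<partial>PiM ({i} \<times> J) (\<lambda>_. M) \<partial>PiM (I \<times> J) (\<lambda>_. M))"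
    using insert.hyps(2) by (intro nn_integral_cong arg_cong[of _ _ f]) (auto simp: merge_def fun_eq_iff)
  also have "\<dots> = (\<integral>\<^sup>+ x. \<integral>\<^sup>+ r. f ((\<lambda>k\<in>I. \<lambda>j\<in>J. x (k, j))(i := r))
        \<partial>PiM J (\<lambda>_. M) \<partial>PiM (I \<times> J) (\<lambda>_. M))"
  proof (rule nn_integral_cong)
    fix x assume x: "x \<in> space (PiM (I \<times> J) (\<lambda>_. M))"
    let ?x = "\<lambda>k\<in>I. \<lambda>j\<in>J. x (k, j)"
    have xs: "?x \<in> space (PiM I (\<lambda>_. PiM J (\<lambda>_. M)))" using measurable_space[OF measurable_curry x] .
    have m: "(\<lambda>r. f (?x(i := r))) \<in> borel_measurable (PiM J (\<lambda>_. M))"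
      using measurable_compose[OF measurable_Pair1'[OF xs] fu] by simp
    have "(\<integral>\<^sup>+ r. f (?x(i := r)) \<partial>PiM J (\<lambda>_. M))
      = (\<integral>\<^sup>+ r. f (?x(i := r)) \<partial>distr (PiM ({i} \<times> J) (\<lambda>_. M)) (PiM J (\<lambda>_. M)) (\<lambda>y. \<lambda>j\<in>J. y (i, j)))"
      by (simp only: distr_PiM_reindex_const[OF M J bij])
    also have "\<dots> = (\<integral>\<^sup>+ y. f (?x(i := \<lambda>j\<in>J. y (i, j))) \<partial>PiM ({i} \<times> J) (\<lambda>_. M))"
      using m by (intro nn_integral_distr measurable_restrict measurable_component_singleton) auto
    finally show "(\<integral>\<^sup>+ y. f (?x(i := \<lambda>j\<in>J. y (i, j))) \<partial>PiM ({i} \<times> J) (\<lambda>_. M))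
      = (\<integral>\<^sup>+ r. f (?x(i := r)) \<partial>PiM J (\<lambda>_. M))" ..
  qed
  also have "\<dots> = (\<integral>\<^sup>+ x. \<integral>\<^sup>+ r. f (x(i := r)) \<partial>PiM J (\<lambda>_. M) \<partial>PiM I (\<lambda>_. PiM J (\<lambda>_. M)))"
    using sigma_finite_measure.borel_measurable_nn_integral_fst[OF PJ fu]
    by (intro insert.IH) (simp only: fst_conv snd_conv)
  also have "\<dots> = (\<integral>\<^sup>+ x. f x \<partial>PiM (insert i I) (\<lambda>_. PiM J (\<lambda>_. M)))"
    using insert.hyps by (intro Q.product_nn_integral_insert[symmetric] f)
  finally show ?case .
qed

lemma measurable_transpose:
  "(\<lambda>y. \<lambda>i\<in>I. \<lambda>j\<in>J. y j i) \<in> PiM J (\<lambda>_. PiM I (\<lambda>_. M)) \<rightarrow>\<^sub>M PiM I (\<lambda>_. PiM J (\<lambda>_. M))"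
proof (intro measurable_restrict)
  fix i j assume i: "i \<in> I" and j: "j \<in> J"
  show "(\<lambda>y. y j i) \<in> PiM J (\<lambda>_. PiM I (\<lambda>_. M)) \<rightarrow>\<^sub>M M"
    by (rule measurable_compose[OF measurable_component_singleton[OF j] measurable_component_singleton[OF i]])
qed

lemma measurable_path_column:
  assumes d: "d \<in> {1..D}"
  shows "(\<lambda>x. \<lambda>t\<in>{1..T}. x t d) \<in> state_space T D \<rightarrow>\<^sub>M path_space T"
  unfolding state_space_def path_space_def
proof (intro measurable_restrict)
  fix t assume t: "t \<in> {1..T}"
  show "(\<lambda>x. x t d) \<in> PiM {1..T} (\<lambda>_. PiM {1..D} (\<lambda>_. lborel)) \<rightarrow>\<^sub>M lborel"
    by (rule measurable_compose[OF measurable_component_singleton[OF t] measurable_component_singleton[OF d]])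
qed

text \<open>States are arrays grouped by time, while the target density factorises over coordinates.
  Flattening to \<open>I \<times> J\<close>, swapping the pairs and regrouping passes from one view
  to the other.\<close>

lemma nn_integral_PiM_transpose:
  assumes M: "sigma_finite_measure M" and I: "finite I" and J: "finite J"
    and f: "f \<in> borel_measurable (PiM I (\<lambda>_. PiM J (\<lambda>_. M)))"
  shows "(\<integral>\<^sup>+ x. f x \<partial>PiM I (\<lambda>_. PiM J (\<lambda>_. M)))
    = (\<integral>\<^sup>+ y. f (\<lambda>i\<in>I. \<lambda>j\<in>J. y j i) \<partial>PiM J (\<lambda>_. PiM I (\<lambda>_. M)))"
proof -
  let ?tr = "\<lambda>y. \<lambda>i\<in>I. \<lambda>j\<in>J. y j i"
  have bij: "bij_betw prod.swap (J \<times> I) (I \<times> J)" by (auto simp: bij_betw_def inj_on_def)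
  have ftr: "(\<lambda>y. f (?tr y)) \<in> borel_measurable (PiM J (\<lambda>_. PiM I (\<lambda>_. M)))"
    by (rule measurable_compose[OF measurable_transpose f])
  have fc: "(\<lambda>x. f (?tr (\<lambda>j\<in>J. \<lambda>i\<in>I. x (j, i)))) \<in> borel_measurable (PiM (J \<times> I) (\<lambda>_. M))"
    by (rule measurable_compose[OF measurable_curry ftr])
  have "(\<integral>\<^sup>+ y. f (?tr y) \<partial>PiM J (\<lambda>_. PiM I (\<lambda>_. M)))
    = (\<integral>\<^sup>+ x. f (?tr (\<lambda>j\<in>J. \<lambda>i\<in>I. x (j, i))) \<partial>PiM (J \<times> I) (\<lambda>_. M))"
    by (rule nn_integral_PiM_curry[OF M J I ftr, symmetric])
  also have "\<dots> = (\<integral>\<^sup>+ x. f (?tr (\<lambda>j\<in>J. \<lambda>i\<in>I. x (j, i)))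
      \<partial>distr (PiM (I \<times> J) (\<lambda>_. M)) (PiM (J \<times> I) (\<lambda>_. M)) (\<lambda>y. \<lambda>p\<in>J \<times> I. y (prod.swap p)))"
    using I J by (simp only: distr_PiM_reindex_const[OF M _ bij] finite_cartesian_product)
  also have "\<dots> = (\<integral>\<^sup>+ y. f (?tr (\<lambda>j\<in>J. \<lambda>i\<in>I. (\<lambda>p\<in>J \<times> I. y (prod.swap p)) (j, i))) \<partial>PiM (I \<times> J) (\<lambda>_. M))"
    using fc by (intro nn_integral_distr measurable_restrict measurable_component_singleton) auto
  also have "\<dots> = (\<integral>\<^sup>+ y. f (\<lambda>i\<in>I. \<lambda>j\<in>J. y (i, j)) \<partial>PiM (I \<times> J) (\<lambda>_. M))"
    by (intro nn_integral_cong arg_cong[of _ _ f]) (auto simp: fun_eq_iff)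
  also have "\<dots> = (\<integral>\<^sup>+ x. f x \<partial>PiM I (\<lambda>_. PiM J (\<lambda>_. M)))"
    by (rule nn_integral_PiM_curry[OF M I J f])
  finally show ?thesis ..
qed

lemma PiM_density_const:
  assumes M: "sigma_finite_measure M" and I: "finite I" and p: "p \<in> borel_measurable M"
    and pM: "sigma_finite_measure (density M p)"
  shows "PiM I (\<lambda>_. density M p) = density (PiM I (\<lambda>_. M)) (\<lambda>x. \<Prod>i\<in>I. p (x i))"
proof -
  interpret M: product_sigma_finite "\<lambda>_. M" by (rule sigma_finite_product_const[OF M])
  interpret P: product_sigma_finite "\<lambda>_. density M p" by (rule sigma_finite_product_const[OF pM])
  have pp: "(\<lambda>x. \<Prod>i\<in>I. p (x i)) \<in> borel_measurable (PiM I (\<lambda>_. M))"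
    using p by measurable
  show ?thesis
  proof (rule P.PiM_eqI[OF I, symmetric])
    show "sets (density (PiM I (\<lambda>_. M)) (\<lambda>x. \<Prod>i\<in>I. p (x i))) = sets (PiM I (\<lambda>_. density M p))"
      by (simp cong: sets_PiM_cong)
    fix A assume "\<And>i. i \<in> I \<Longrightarrow> A i \<in> sets (density M p)"
    then have A: "\<And>i. i \<in> I \<Longrightarrow> A i \<in> sets M" by simp
    have "emeasure (density (PiM I (\<lambda>_. M)) (\<lambda>x. \<Prod>i\<in>I. p (x i))) (PiE I A)
      = (\<integral>\<^sup>+ x. (\<Prod>i\<in>I. p (x i)) * indicator (PiE I A) x \<partial>PiM I (\<lambda>_. M))"
      using pp A I by (intro emeasure_density) (auto intro!: sets_PiM_I_finite)
    also have "\<dots> = (\<integral>\<^sup>+ x. (\<Prod>i\<in>I. p (x i) * indicator (A i) (x i)) \<partial>PiM I (\<lambda>_. M))"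
    proof (rule nn_integral_cong)
      fix x assume "x \<in> space (PiM I (\<lambda>_. M))"
      then have "x \<in> PiE I A \<longleftrightarrow> (\<forall>i\<in>I. x i \<in> A i)" by (auto simp: space_PiM PiE_def)
      then show "(\<Prod>i\<in>I. p (x i)) * indicator (PiE I A) x = (\<Prod>i\<in>I. p (x i) * indicator (A i) (x i))"
        using I by (auto simp: prod.distrib indicator_def prod_zero_iff split: if_splits)
    qed
    also have "\<dots> = (\<Prod>i\<in>I. \<integral>\<^sup>+ v. p v * indicator (A i) v \<partial>M)"
      using p A I by (intro M.product_nn_integral_prod) auto
    also have "\<dots> = (\<Prod>i\<in>I. emeasure (density M p) (A i))"
      using p A by (intro prod.cong refl emeasure_density[symmetric]) auto
    finally show "emeasure (density (PiM I (\<lambda>_. M)) (\<lambda>x. \<Prod>i\<in>I. p (x i))) (PiE I A)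
      = (\<Prod>i\<in>I. emeasure (density M p) (A i))" .
  qed
qed

lemma sigma_finite_path_space: "sigma_finite_measure (path_space T)"
  unfolding path_space_def
  by (rule product_sigma_finite.sigma_finite[OF sigma_finite_product_const[OF lborel.sigma_finite_measure_axioms]]) simp

text \<open>The column \<open>\<lambda>t. x t d\<close> of an array agrees with a point of the path
  space on \<open>{1..T}\<close> but need not be \<open>undefined\<close> elsewhere. Functions with
  this property do not see the difference, so measurability can be checked on the restricted
  column.\<close>

definition path_local :: "nat \<Rightarrow> ((nat \<Rightarrow> real) \<Rightarrow> 'a) \<Rightarrow> bool" where
  "path_local T f \<longleftrightarrow> (\<forall>x y. (\<forall>t\<in>{1..T}. x t = y t) \<longrightarrow> f x = f y)"

lemma path_localD: "path_local T f \<Longrightarrow> (\<And>t. t \<in> {1..T} \<Longrightarrow> x t = y t) \<Longrightarrow> f x = f y"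
  by (auto simp: path_local_def)

lemma path_local_pi_dens: "path_local T (pi_dens FK T)"
  unfolding path_local_def
proof (intro allI impI)
  fix x y :: "nat \<Rightarrow> real" assume xy: "\<forall>t\<in>{1..T}. x t = y t"
  \<comment> \<open>At \<open>t = 1\<close> the value \<open>x 0\<close> appears, which lies outside
    \<open>{1..T}\<close>; \<open>tdens\<close> ignores it there.\<close>
  have "tdens FK t (x (t - 1)) (x t) = tdens FK t (y (t - 1)) (y t)" if "t \<in> {1..T}" for t
  proof (cases "t = 1")
    case False
    then have "t - 1 \<in> {1..T}" using that by auto
    then show ?thesis using xy that by simp
  qed (use xy that in \<open>simp add: tdens_def\<close>)
  then have "path_weight FK T x = path_weight FK T y"
    using xy by (auto simp: path_weight_def intro!: prod.cong)
  then show "pi_dens FK T x = pi_dens FK T y" by (simp add: pi_dens_def)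
qed

definition empirical_mean :: "((nat \<Rightarrow> real) \<Rightarrow> real) \<Rightarrow> nat \<Rightarrow> (nat \<Rightarrow> nat \<Rightarrow> real) \<Rightarrow> real" where
  "empirical_mean \<phi> D x = (\<Sum>d=1..D. \<phi> (\<lambda>t. x t d)) / D"

text \<open>A tolerance tending to zero slower than the standard deviation \<open>D\<^bsup>-1/2\<^esup>\<close> of
  an empirical mean.\<close>

definition typical_set :: "fk_model \<Rightarrow> nat \<Rightarrow> 'k set \<Rightarrow> ('k \<Rightarrow> (nat \<Rightarrow> real) \<Rightarrow> real) \<Rightarrow> nat \<Rightarrow> (nat \<Rightarrow> nat \<Rightarrow> real) set" where
  "typical_set FK T K \<phi> D = {x \<in> space (state_space T D). \<forall>k\<in>K.
     \<bar>empirical_mean (\<phi> k) D x - (\<integral>v. \<phi> k v \<partial>pi_law FK T)\<bar> \<le> sqrt (sqrt (1 / D))}"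

context
  fixes FK :: fk_model and T :: nat
  assumes valid: "fk_valid FK T"
begin

lemma path_weight_integrable: "integrable (path_space T) (path_weight FK T)"
  using valid unfolding fk_valid_def by (elim conjE)

lemma path_weight_integral_pos: "0 < integral\<^sup>L (path_space T) (path_weight FK T)"
  using valid unfolding fk_valid_def by (elim conjE)

lemma pi_dens_integrable: "integrable (path_space T) (pi_dens FK T)"
  unfolding pi_dens_def[abs_def] using path_weight_integrable by (rule integrable_divide)

lemma pi_dens_borel: "pi_dens FK T \<in> borel_measurable (path_space T)"
  using pi_dens_integrable by (rule borel_measurable_integrable)

lemma pi_dens_nonneg: "0 \<le> pi_dens FK T x"
proof -
  have "0 \<le> tdens FK t (x (t - 1)) (x t) * pot FK t (x t)" if "t \<in> {1..T}" for t
  proof (rule mult_nonneg_nonneg)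
    have "0 \<le> init_dens FK y" for y using valid unfolding fk_valid_def by (elim conjE) blast
    moreover have "0 \<le> trans_dens FK t y z" if "t \<noteq> 1" for y z
    proof -
      have "t \<in> {2..T}" using that \<open>t \<in> {1..T}\<close> by auto
      then show ?thesis using valid unfolding fk_valid_def by (elim conjE) blast
    qed
    ultimately show "0 \<le> tdens FK t (x (t - 1)) (x t)" by (simp add: tdens_def)
    have "0 < pot FK t (x t)" using valid that unfolding fk_valid_def by (elim conjE) blast
    then show "0 \<le> pot FK t (x t)" by simp
  qed
  then have "0 \<le> path_weight FK T x" unfolding path_weight_def by (rule prod_nonneg)
  then show ?thesis using path_weight_integral_pos by (simp add: pi_dens_def)
qed

lemma prob_space_pi_law: "prob_space (pi_law FK T)"
proof
  have "emeasure (pi_law FK T) (space (pi_law FK T)) = (\<integral>\<^sup>+ x. ennreal (pi_dens FK T x) \<partial>path_space T)"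
  proof -
    have "emeasure (pi_law FK T) (space (path_space T))
        = (\<integral>\<^sup>+ x. ennreal (pi_dens FK T x) * indicator (space (path_space T)) x \<partial>path_space T)"
      unfolding pi_law_def
      by (rule emeasure_density[OF measurable_compose[OF pi_dens_borel measurable_ennreal] sets.top])
    also have "\<dots> = (\<integral>\<^sup>+ x. ennreal (pi_dens FK T x) \<partial>path_space T)"
      by (rule nn_integral_cong) simp
    finally show ?thesis by (simp add: pi_law_def)
  qed
  also have "\<dots> = ennreal (\<integral>x. pi_dens FK T x \<partial>path_space T)"
    using pi_dens_integrable pi_dens_nonneg by (intro nn_integral_eq_integral) auto
  also have "(\<integral>x. pi_dens FK T x \<partial>path_space T)
      = integral\<^sup>L (path_space T) (path_weight FK T) / integral\<^sup>L (path_space T) (path_weight FK T)"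
    unfolding pi_dens_def by (rule integral_divide_zero)
  also have "\<dots> = 1" using path_weight_integral_pos by simp
  finally show "emeasure (pi_law FK T) (space (pi_law FK T)) = 1" by simp
qed

lemma sets_pi_law: "sets (pi_law FK T) = sets (path_space T)"
  by (simp add: pi_law_def)

text \<open>After transposition the target density is a product of \<open>pi_dens\<close> over the
  columns. The \<open>D\<close> columns are thus independent with law \<open>pi_law\<close>, which
  is what the second-moment argument needs.\<close>

lemma target_law_transpose:
  assumes A: "A \<in> sets (state_space T D)"
  shows "measure (target_law FK T D) A = measure (PiM {1..D} (\<lambda>_. pi_law FK T))
    {y \<in> space (PiM {1..D} (\<lambda>_. pi_law FK T)). (\<lambda>t\<in>{1..T}. \<lambda>d\<in>{1..D}. y d t) \<in> A}"
proof -
  let ?tr = "\<lambda>y. \<lambda>t\<in>{1..T}. \<lambda>d\<in>{1..D}. y d t :: real"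
  let ?p = "\<lambda>x. ennreal (pi_dens FK T x)"
  note p[measurable] = pi_dens_borel
  have loc: "pi_dens FK T (\<lambda>t. x t d) = pi_dens FK T (\<lambda>t\<in>{1..T}. x t d)" for x :: "nat \<Rightarrow> nat \<Rightarrow> real" and d
    by (rule path_localD[OF path_local_pi_dens]) simp
  have dm: "(\<lambda>x. ennreal (\<Prod>d=1..D. pi_dens FK T (\<lambda>t. x t d))) \<in> borel_measurable (state_space T D)"
  proof -
    have eq: "(\<lambda>x. ennreal (\<Prod>d=1..D. pi_dens FK T (\<lambda>t. x t d)))
        = (\<lambda>x. ennreal (\<Prod>d=1..D. pi_dens FK T (\<lambda>t\<in>{1..T}. x t d)))"
      by (intro ext arg_cong[of _ _ ennreal] prod.cong refl loc)
    show ?thesis unfolding eq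
      by (intro measurable_compose[OF _ measurable_ennreal] borel_measurable_prod
          measurable_compose[OF measurable_path_column p])
  qed
  have fm: "(\<lambda>x. ennreal (\<Prod>d=1..D. pi_dens FK T (\<lambda>t. x t d)) * indicator A x) \<in> borel_measurable (state_space T D)"
    using dm A by (intro borel_measurable_times_ennreal borel_measurable_indicator)
  have trm: "?tr \<in> PiM {1..D} (\<lambda>_. path_space T) \<rightarrow>\<^sub>M state_space T D"
    unfolding path_space_def state_space_def by (rule measurable_transpose)
  have "emeasure (target_law FK T D) A
    = (\<integral>\<^sup>+ x. ennreal (\<Prod>d=1..D. pi_dens FK T (\<lambda>t. x t d)) * indicator A x \<partial>state_space T D)"
    unfolding target_law_def using dm A by (rule emeasure_density)
  also have "\<dots> = (\<integral>\<^sup>+ y. ennreal (\<Prod>d=1..D. pi_dens FK T (\<lambda>t. ?tr y t d)) * indicator A (?tr y)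
      \<partial>PiM {1..D} (\<lambda>_. path_space T))"
    using fm unfolding state_space_def path_space_def
    by (intro nn_integral_PiM_transpose lborel.sigma_finite_measure_axioms finite_atLeastAtMost)
  also have "\<dots> = (\<integral>\<^sup>+ y. (\<Prod>d=1..D. ?p (y d)) * indicator {y \<in> space (PiM {1..D} (\<lambda>_. path_space T)). ?tr y \<in> A} y
      \<partial>PiM {1..D} (\<lambda>_. path_space T))"
  proof (rule nn_integral_cong)
    fix y assume y: "y \<in> space (PiM {1..D} (\<lambda>_. path_space T))"
    have "pi_dens FK T (\<lambda>t. ?tr y t d) = pi_dens FK T (y d)" if "d \<in> {1..D}" for d
      using that by (intro path_localD[OF path_local_pi_dens]) simp
    then have "ennreal (\<Prod>d=1..D. pi_dens FK T (\<lambda>t. ?tr y t d)) = (\<Prod>d=1..D. ?p (y d))"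
      using pi_dens_nonneg by (simp add: prod_ennreal)
    then show "ennreal (\<Prod>d=1..D. pi_dens FK T (\<lambda>t. ?tr y t d)) * indicator A (?tr y)
      = (\<Prod>d=1..D. ?p (y d)) * indicator {y \<in> space (PiM {1..D} (\<lambda>_. path_space T)). ?tr y \<in> A} y"
      using y by (simp add: indicator_def)
  qed
  also have "\<dots> = emeasure (density (PiM {1..D} (\<lambda>_. path_space T)) (\<lambda>y. \<Prod>d=1..D. ?p (y d)))
      {y \<in> space (PiM {1..D} (\<lambda>_. path_space T)). ?tr y \<in> A}"
  proof (rule emeasure_density[symmetric])
    show "(\<lambda>y. \<Prod>d=1..D. ?p (y d)) \<in> borel_measurable (PiM {1..D} (\<lambda>_. path_space T))"
    proof (rule borel_measurable_prod_ennreal)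
      fix d assume d: "d \<in> {1..D}"
      show "(\<lambda>y. ?p (y d)) \<in> borel_measurable (PiM {1..D} (\<lambda>_. path_space T))"
        by (rule measurable_compose[OF measurable_component_singleton[OF d] measurable_compose[OF p measurable_ennreal]])
    qed
    have "{y \<in> space (PiM {1..D} (\<lambda>_. path_space T)). ?tr y \<in> A} = ?tr -` A \<inter> space (PiM {1..D} (\<lambda>_. path_space T))"
      by blast
    then show "{y \<in> space (PiM {1..D} (\<lambda>_. path_space T)). ?tr y \<in> A} \<in> sets (PiM {1..D} (\<lambda>_. path_space T))"
      using measurable_sets[OF trm A] by (simp only:)
  qed
  also have "density (PiM {1..D} (\<lambda>_. path_space T)) (\<lambda>y. \<Prod>d=1..D. ?p (y d)) = PiM {1..D} (\<lambda>_. pi_law FK T)"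
    unfolding pi_law_def
    by (rule PiM_density_const[symmetric, OF sigma_finite_path_space finite_atLeastAtMost
        measurable_compose[OF pi_dens_borel measurable_ennreal]
        prob_space_imp_sigma_finite[OF prob_space_pi_law, unfolded pi_law_def]])
  also have "space (PiM {1..D} (\<lambda>_. path_space T)) = space (PiM {1..D} (\<lambda>_. pi_law FK T))"
    by (simp add: space_PiM pi_law_def)
  finally show ?thesis unfolding measure_def by (rule arg_cong[of _ _ enn2real])
qed

section \<open>Probability of the typical set for finitely many square-integrable functions\<close>

context
  fixes K :: "'k set" and \<phi> :: "'k \<Rightarrow> (nat \<Rightarrow> real) \<Rightarrow> real"
  assumes K: "finite K" and phi_m: "\<And>k. k \<in> K \<Longrightarrow> \<phi> k \<in> borel_measurable (path_space T)"
    and phi_l: "\<And>k. k \<in> K \<Longrightarrow> path_local T (\<phi> k)"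
    and phi_sq: "\<And>k. k \<in> K \<Longrightarrow> integrable (pi_law FK T) (\<lambda>x. (\<phi> k x)\<^sup>2)"
begin

lemma empirical_mean_borel:
  assumes k: "k \<in> K"
  shows "empirical_mean (\<phi> k) D \<in> borel_measurable (state_space T D)"
proof -
  have loc: "\<phi> k (\<lambda>t. x t d) = \<phi> k (\<lambda>t\<in>{1..T}. x t d)" for x :: "nat \<Rightarrow> nat \<Rightarrow> real" and d
    by (rule path_localD[OF phi_l[OF k]]) simp
  have eq: "empirical_mean (\<phi> k) D = (\<lambda>x. (\<Sum>d=1..D. \<phi> k (\<lambda>t\<in>{1..T}. x t d)) / D)"
    unfolding empirical_mean_def by (intro ext arg_cong2[of _ _ _ _ "(/)"] sum.cong refl loc)
  show ?thesis unfolding eq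
    by (intro borel_measurable_divide borel_measurable_sum borel_measurable_const
        measurable_compose[OF measurable_path_column phi_m[OF k]])
qed

lemma typical_set_sets: "typical_set FK T K \<phi> D \<in> sets (state_space T D)"
proof -
  have [measurable]: "empirical_mean (\<phi> k) D \<in> borel_measurable (state_space T D)" if "k \<in> K" for k
    using that by (rule empirical_mean_borel)
  show ?thesis unfolding typical_set_def using K by measurable
qed

text \<open>Each centred empirical mean has mean absolute value at most
  \<open>sqrt (C k / D)\<close>. Markov's inequality at level \<open>e D\<close> and a union bound
  over the finite set \<open>K\<close> finish the estimate; the case \<open>D = 0\<close> is
  excluded and irrelevant in the limit.\<close>

lemma measure_typical_set: "(\<lambda>D. measure (target_law FK T D) (typical_set FK T K \<phi> D)) \<longlonglongrightarrow> 1"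
proof -
  interpret pi: prob_space "pi_law FK T" by (rule prob_space_pi_law)
  define m where "m k = (\<integral>v. \<phi> k v \<partial>pi_law FK T)" for k
  define C where "C k = (\<integral>v. (\<phi> k v - m k)\<^sup>2 \<partial>pi_law FK T)" for k
  define e where "e D = sqrt (sqrt (1 / real D))" for D
  have phim: "\<phi> k \<in> borel_measurable (pi_law FK T)" if "k \<in> K" for k
    unfolding measurable_cong_sets[OF sets_pi_law refl] by (rule phi_m[OF that])
  have phi1: "integrable (pi_law FK T) (\<phi> k)" if "k \<in> K" for k
    using phim[OF that] phi_sq[OF that] by (rule pi.square_integrable_imp_integrable)
  have cen: "integrable (pi_law FK T) (\<lambda>v. \<phi> k v - m k)" "(\<integral>v. \<phi> k v - m k \<partial>pi_law FK T) = 0"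
    "integrable (pi_law FK T) (\<lambda>v. (\<phi> k v - m k)\<^sup>2)" if "k \<in> K" for k
    using phi1[OF that] phi_sq[OF that]
    by (auto simp: m_def pi.prob_space power2_diff)
  have C0: "0 \<le> C k" for k unfolding C_def by (rule integral_nonneg_AE) simp
  have main: "1 - (\<Sum>k\<in>K. sqrt (C k)) * e D \<le> measure (target_law FK T D) (typical_set FK T K \<phi> D)
      \<and> measure (target_law FK T D) (typical_set FK T K \<phi> D) \<le> 1" if D: "1 \<le> D" for D
  proof -
    let ?Q = "PiM {1..D} (\<lambda>_. pi_law FK T)"
    interpret Q: prob_space ?Q by (intro prob_space_PiM prob_space_pi_law)
    have e0: "0 < e D" using D by (simp add: e_def)
    define S where "S k y = (\<Sum>d=1..D. 1 * (\<phi> k (y d) - m k)) / D" for k and y :: "nat \<Rightarrow> nat \<Rightarrow> real"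
    have cm: "(\<lambda>w. \<phi> k (w d) - m k) \<in> borel_measurable ?Q" if k: "k \<in> K" and d: "d \<in> {1..D}" for k d
      by (intro borel_measurable_diff borel_measurable_const
          measurable_compose[OF measurable_component_singleton[OF d] phim[OF k]])
    have cs: "integrable ?Q (\<lambda>w. (\<phi> k (w d) - m k)\<^sup>2)"
      "Q.expectation (\<lambda>w. (\<phi> k (w d) - m k)\<^sup>2) \<le> C k" if k: "k \<in> K" and d: "d \<in> {1..D}" for k d
      using PiM_integrable_component[OF prob_space_pi_law _ d cen(3)[OF k]]
        PiM_integral_component[OF prob_space_pi_law _ d cen(3)[OF k]] by (simp_all add: C_def)
    have co: "Q.expectation (\<lambda>w. (\<phi> k (w d) - m k) * (\<phi> k (w e) - m k)) = 0"
      if k: "k \<in> K" and de: "d \<in> {1..D}" "e \<in> {1..D}" "d \<noteq> e" for k d e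
      using PiM_integral_two_components[OF prob_space_pi_law finite_atLeastAtMost de cen(1)[OF k] cen(1)[OF k]] cen(2)[OF k]
      by simp
    have c1: "\<bar>1 :: real\<bar> \<le> 1" by simp
    have S: "integrable ?Q (S k)" "Q.expectation (\<lambda>y. \<bar>S k y\<bar>) \<le> 1 * sqrt (C k / D)" if k: "k \<in> K" for k
      unfolding S_def
      using Q.orthogonal_average_bound[where X = "\<lambda>d w. \<phi> k (w d) - m k" and c = "\<lambda>_. 1" and B = 1,
          OF cm[OF k] cs[OF k] co[OF k] c1 C0 D] by blast+
    let ?G = "{y \<in> space ?Q. (\<lambda>t\<in>{1..T}. \<lambda>d\<in>{1..D}. y d t) \<in> typical_set FK T K \<phi> D}"
    have G: "?G = {y \<in> space ?Q. \<forall>k\<in>K. \<bar>S k y\<bar> \<le> e D}"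
    proof -
      have "(\<lambda>t\<in>{1..T}. \<lambda>d\<in>{1..D}. y d t) \<in> typical_set FK T K \<phi> D \<longleftrightarrow> (\<forall>k\<in>K. \<bar>S k y\<bar> \<le> e D)"
        if y: "y \<in> space ?Q" for y
      proof -
        let ?x = "\<lambda>t\<in>{1..T}. \<lambda>d\<in>{1..D}. y d t"
        have "y \<in> space (PiM {1..D} (\<lambda>_. PiM {1..T} (\<lambda>_. lborel)))"
          using y by (simp add: space_PiM pi_law_def path_space_def)
        then have "?x \<in> space (state_space T D)"
          unfolding state_space_def by (rule measurable_space[OF measurable_transpose])
        moreover have "empirical_mean (\<phi> k) D ?x - m k = S k y" if k: "k \<in> K" for k
        proof -
          have "\<phi> k (\<lambda>t. ?x t d) = \<phi> k (y d)" if "d \<in> {1..D}" for d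
            using that by (intro path_localD[OF phi_l[OF k]]) simp
          then have "empirical_mean (\<phi> k) D ?x = (\<Sum>d=1..D. \<phi> k (y d)) / D"
            by (simp add: empirical_mean_def)
          then show ?thesis using D by (simp add: S_def sum_subtractf field_simps)
        qed
        ultimately show ?thesis by (simp add: typical_set_def m_def e_def)
      qed
      then show ?thesis by blast
    qed
    have Sm[measurable]: "S k \<in> borel_measurable ?Q" if "k \<in> K" for k
      using S(1)[OF that] by (rule borel_measurable_integrable)
    have bad: "Q.prob {y \<in> space ?Q. e D \<le> \<bar>S k y\<bar>} \<le> sqrt (C k) * e D" if k: "k \<in> K" for k
    proof -
      have "Q.prob {y \<in> space ?Q. e D \<le> \<bar>S k y\<bar>} \<le> Q.expectation (\<lambda>y. \<bar>S k y\<bar>) / e D"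
        using S(1)[OF k] e0 by (intro integral_Markov_inequality_measure[of _ _ "space ?Q", simplified]) auto
      also have "\<dots> \<le> sqrt (C k / D) / e D"
        using S(2)[OF k] e0 by (intro divide_right_mono) auto
      \<comment> \<open>\<open>e D\<close> is D^(-1/4), so dividing the standard deviation by it
        leaves one factor \<open>e D\<close>.\<close>
      also have "sqrt (C k / D) = sqrt (C k) * (e D * e D)"
        unfolding e_def by (simp add: real_sqrt_divide)
      finally show ?thesis using e0 by simp
    qed
    have "Q.prob (space ?Q - ?G) \<le> Q.prob (\<Union>k\<in>K. {y \<in> space ?Q. e D \<le> \<bar>S k y\<bar>})"
    proof (rule Q.finite_measure_mono)
      show "(\<Union>k\<in>K. {y \<in> space ?Q. e D \<le> \<bar>S k y\<bar>}) \<in> sets ?Q"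
        using K Sm by (intro sets.finite_UN) auto
      show "space ?Q - ?G \<subseteq> (\<Union>k\<in>K. {y \<in> space ?Q. e D \<le> \<bar>S k y\<bar>})"
        unfolding G by (auto simp: not_le intro: less_imp_le)
    qed
    also have "\<dots> \<le> (\<Sum>k\<in>K. Q.prob {y \<in> space ?Q. e D \<le> \<bar>S k y\<bar>})"
      using K Sm by (intro Q.finite_measure_subadditive_finite) auto
    also have "\<dots> \<le> (\<Sum>k\<in>K. sqrt (C k) * e D)" by (intro sum_mono bad)
    finally have bnd: "Q.prob (space ?Q - ?G) \<le> (\<Sum>k\<in>K. sqrt (C k)) * e D"
      by (simp add: sum_distrib_right)
    have "?G \<in> sets ?Q" unfolding G using K Sm by measurable
    then have "Q.prob (space ?Q - ?G) = 1 - Q.prob ?G" by (rule Q.prob_compl)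
    moreover have "measure (target_law FK T D) (typical_set FK T K \<phi> D) = Q.prob ?G"
      by (rule target_law_transpose[OF typical_set_sets])
    ultimately show ?thesis using bnd Q.prob_le_1[of ?G] by simp
  qed
  have "(\<lambda>D. 1 - (\<Sum>k\<in>K. sqrt (C k)) * e D) \<longlonglongrightarrow> 1 - (\<Sum>k\<in>K. sqrt (C k)) * sqrt (sqrt 0)"
    unfolding e_def by (intro tendsto_intros lim_1_over_n)
  then have lower: "(\<lambda>D. 1 - (\<Sum>k\<in>K. sqrt (C k)) * e D) \<longlonglongrightarrow> 1" by simp
  show ?thesis
  proof (rule tendsto_sandwich[OF _ _ lower tendsto_const])
    show "\<forall>\<^sub>F D in sequentially. 1 - (\<Sum>k\<in>K. sqrt (C k)) * e D \<le> measure (target_law FK T D) (typical_set FK T K \<phi> D)"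
      using eventually_ge_at_top[of 1] by eventually_elim (use main in blast)
    show "\<forall>\<^sub>F D in sequentially. measure (target_law FK T D) (typical_set FK T K \<phi> D) \<le> 1"
      using eventually_ge_at_top[of 1] by eventually_elim (use main in blast)
  qed
qed

end

end

section \<open>Second-order expansion of the log-weights\<close>

lemma has_derivative_sections:
  fixes F :: "real \<times> real \<Rightarrow> 'b::real_normed_vector"
  assumes "\<And>z. (F has_derivative F' z) (at z)"
  shows "((\<lambda>x. F (x, y)) has_derivative (\<lambda>h. F' (x, y) (h, 0))) (at x)"
    and "((\<lambda>y. F (x, y)) has_derivative (\<lambda>h. F' (x, y) (0, h))) (at y)"
proof -
  have "((\<lambda>x. (x, y)) has_derivative (\<lambda>h. (h, 0))) (at x)"
    by (rule has_derivative_Pair) (auto intro!: derivative_eq_intros)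
  from has_derivative_compose[OF this, of F "F' (x, y)"] assms
  show "((\<lambda>x. F (x, y)) has_derivative (\<lambda>h. F' (x, y) (h, 0))) (at x)" by simp
  have "((\<lambda>y. (x, y)) has_derivative (\<lambda>h. (0, h))) (at y)"
    by (rule has_derivative_Pair) (auto intro!: derivative_eq_intros)
  from has_derivative_compose[OF this, of F "F' (x, y)"] assms
  show "((\<lambda>y. F (x, y)) has_derivative (\<lambda>h. F' (x, y) (0, h))) (at y)" by simp
qed

lemma pd_real_derivative:
  fixes F :: "real \<times> real \<Rightarrow> real"
  assumes F: "\<And>z. (F has_derivative F' z) (at z)"
  shows "((\<lambda>x. F (x, y)) has_real_derivative pd1 F (x, y)) (at x)" "pd1 F (x, y) = F' (x, y) (1, 0)"
    "((\<lambda>y. F (x, y)) has_real_derivative pd2 F (x, y)) (at y)" "pd2 F (x, y) = F' (x, y) (0, 1)"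
proof -
  have lin: "linear (F' z)" for z using F has_derivative_linear by blast
  have e: "(\<lambda>h. F' (x, y) (h, 0)) = (*) (F' (x, y) (1, 0))"
  proof
    fix h
    show "F' (x, y) (h, 0) = F' (x, y) (1, 0) * h"
      using linear_scale[OF lin, of "(x, y)" h "(1, 0)"] by (simp add: scaleR_prod_def mult.commute)
  qed
  have 1: "((\<lambda>x. F (x, y)) has_real_derivative F' (x, y) (1, 0)) (at x)"
    unfolding has_field_derivative_def e[symmetric] by (rule has_derivative_sections(1)[OF F])
  have e: "(\<lambda>h. F' (x, y) (0, h)) = (*) (F' (x, y) (0, 1))"
  proof
    fix h
    show "F' (x, y) (0, h) = F' (x, y) (0, 1) * h"
      using linear_scale[OF lin, of "(x, y)" h "(0, 1)"] by (simp add: scaleR_prod_def mult.commute)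
  qed
  have 2: "((\<lambda>y. F (x, y)) has_real_derivative F' (x, y) (0, 1)) (at y)"
    unfolding has_field_derivative_def e[symmetric] by (rule has_derivative_sections(2)[OF F])
  show e1: "pd1 F (x, y) = F' (x, y) (1, 0)" using DERIV_imp_deriv[OF 1] by (simp add: pd1_def)
  show e2: "pd2 F (x, y) = F' (x, y) (0, 1)" using DERIV_imp_deriv[OF 2] by (simp add: pd2_def)
  show "((\<lambda>x. F (x, y)) has_real_derivative pd1 F (x, y)) (at x)" using 1 e1 by simp
  show "((\<lambda>y. F (x, y)) has_real_derivative pd2 F (x, y)) (at y)" using 2 e2 by simp
qed

text \<open>\<open>pd1\<close> and \<open>pd2\<close> are built from \<open>deriv\<close>, which
  means something only where a derivative exists. Here they are identified with the Frechet
  derivative evaluated at the two unit vectors; such an evaluation is again differentiable, which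
  yields the second-order statements.\<close>

lemma twice_cont_diffD:
  fixes f :: "real \<times> real \<Rightarrow> real"
  assumes "twice_cont_diff f"
  shows "((\<lambda>x. f (x, y)) has_real_derivative pd1 f (x, y)) (at x)"
    and "((\<lambda>y. f (x, y)) has_real_derivative pd2 f (x, y)) (at y)"
    and "((\<lambda>x. pd1 f (x, y)) has_real_derivative pd1 (pd1 f) (x, y)) (at x)"
    and "((\<lambda>y. pd2 f (x, y)) has_real_derivative pd2 (pd2 f) (x, y)) (at y)"
    and "((\<lambda>x. pd2 f (x, y)) has_real_derivative pd1 (pd2 f) (x, y)) (at x)"
    and "continuous_on UNIV (pd1 f)" and "continuous_on UNIV (pd2 f)"
proof -
  obtain f' :: "real \<times> real \<Rightarrow> (real \<times> real) \<Rightarrow>\<^sub>L real" and f'' where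
    1: "\<And>z. (f has_derivative blinfun_apply (f' z)) (at z)" and
    2: "\<And>z. (f' has_derivative blinfun_apply (f'' z)) (at z)"
    using assms unfolding twice_cont_diff_def by blast
  have p1: "pd1 f = (\<lambda>z. blinfun_apply (f' z) (1, 0))" using pd_real_derivative(2)[OF 1] by auto
  have p2: "pd2 f = (\<lambda>z. blinfun_apply (f' z) (0, 1))" using pd_real_derivative(4)[OF 1] by auto
  have d: "((\<lambda>z. blinfun_apply (f' z) v) has_derivative (\<lambda>h. blinfun_apply (blinfun_apply (f'' z) h) v)) (at z)" for v z
    using bounded_linear.has_derivative[OF bounded_linear_apply_blinfun 2] .
  have c: "continuous_on UNIV (\<lambda>z. blinfun_apply (f' z) v)" for v
    using d by (intro has_derivative_continuous_on[of UNIV _ "\<lambda>z h. blinfun_apply (blinfun_apply (f'' z) h) v"]) (auto intro: has_derivative_at_withinI)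
  show "((\<lambda>x. f (x, y)) has_real_derivative pd1 f (x, y)) (at x)"
    "((\<lambda>y. f (x, y)) has_real_derivative pd2 f (x, y)) (at y)"
    using pd_real_derivative(1,3)[OF 1] by blast+
  show "((\<lambda>x. pd1 f (x, y)) has_real_derivative pd1 (pd1 f) (x, y)) (at x)"
    unfolding p1 by (rule pd_real_derivative(1)[OF d])
  show "((\<lambda>y. pd2 f (x, y)) has_real_derivative pd2 (pd2 f) (x, y)) (at y)"
    "((\<lambda>x. pd2 f (x, y)) has_real_derivative pd1 (pd2 f) (x, y)) (at x)"
    unfolding p2 by (rule pd_real_derivative(3)[OF d], rule pd_real_derivative(1)[OF d])
  show "continuous_on UNIV (pd1 f)" "continuous_on UNIV (pd2 f)"
    unfolding p1 p2 by (rule c)+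
qed

lemma Taylor_order_two:
  fixes g g' g'' :: "real \<Rightarrow> real"
  assumes "\<And>t. (g has_real_derivative g' t) (at t)" "\<And>t. (g' has_real_derivative g'' t) (at t)"
  obtains t where "\<bar>t\<bar> \<le> \<bar>h\<bar>" "g (x + h) = g x + g' x * h + g'' (x + t) / 2 * h\<^sup>2"
proof -
  define diff where "diff m s = (if m = 0 then g (x + s) else if m = 1 then g' (x + s) else g'' (x + s))" for m :: nat and s
  have sh: "((\<lambda>s. k (x + s)) has_real_derivative k' (x + t)) (at t)"
    if "\<And>t. (k has_real_derivative k' t) (at t)" for k k' t
    using DERIV_shift[of k "k' (x + t)" t x] that[of "x + t"] by (simp add: add.commute)
  have "\<forall>m t. m < 2 \<and> \<bar>t\<bar> \<le> \<bar>h\<bar> \<longrightarrow> (diff m has_real_derivative diff (Suc m) t) (at t)"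
    using sh[OF assms(1)] sh[OF assms(2)] by (auto simp: diff_def[abs_def] less_2_cases_iff)
  from Maclaurin_bi_le[OF refl this] obtain t where
    "\<bar>t\<bar> \<le> \<bar>h\<bar>" "diff 0 h = (\<Sum>m<2. diff m 0 / fact m * h ^ m) + diff 2 t / fact 2 * h ^ 2"
    by blast
  then show ?thesis by (intro that[of t]) (simp_all add: diff_def lessThan_Suc numeral_2_eq_2)
qed

lemma Taylor_order_one:
  fixes g g' :: "real \<Rightarrow> real"
  assumes "\<And>t. (g has_real_derivative g' t) (at t)"
  obtains t where "\<bar>t\<bar> \<le> \<bar>h\<bar>" "g (x + h) = g x + g' (x + t) * h"
proof -
  define diff where "diff m s = (if m = 0 then g (x + s) else g' (x + s))" for m :: nat and s
  have sh: "((\<lambda>s. g (x + s)) has_real_derivative g' (x + t)) (at t)" for t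
    using DERIV_shift[of g "g' (x + t)" t x] assms[of "x + t"] by (simp add: add.commute)
  have "\<forall>m t. m < 1 \<and> \<bar>t\<bar> \<le> \<bar>h\<bar> \<longrightarrow> (diff m has_real_derivative diff (Suc m) t) (at t)"
    using sh by (auto simp: diff_def[abs_def])
  from Maclaurin_bi_le[OF refl this] obtain t where
    "\<bar>t\<bar> \<le> \<bar>h\<bar>" "diff 0 h = (\<Sum>m<1. diff m 0 / fact m * h ^ m) + diff 1 t / fact 1 * h ^ 1"
    by blast
  then show ?thesis by (intro that[of t]) (simp_all add: diff_def)
qed

lemma lipschitz_bound_plane:
  fixes g :: "real \<times> real \<Rightarrow> real"
  assumes "L-lipschitz_on UNIV g" "\<bar>s\<bar> \<le> a" "\<bar>t\<bar> \<le> b"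
  shows "\<bar>g (x + s, y + t) - g (x, y)\<bar> \<le> L * (a + b)"
proof -
  have "dist (g (x + s, y + t)) (g (x, y)) \<le> L * dist (x + s, y + t) (x, y)"
    by (rule lipschitz_onD[OF assms(1)]) auto
  also have "\<dots> \<le> L * (a + b)"
  proof (rule mult_left_mono)
    have "dist (x + s, y + t) (x, y) = sqrt (\<bar>s\<bar>\<^sup>2 + \<bar>t\<bar>\<^sup>2)" by (simp add: dist_prod_def dist_real_def)
    also have "\<dots> \<le> \<bar>s\<bar> + \<bar>t\<bar>" by (rule sqrt_sum_squares_le_sum) auto
    finally show "dist (x + s, y + t) (x, y) \<le> a + b" using assms(2,3) by linarith
  qed (rule lipschitz_on_nonneg[OF assms(1)])
  finally show ?thesis by (simp add: dist_real_def)
qed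

text \<open>The increment is expanded first in the second and then in the first argument, so that no
  symmetry of the second derivative is needed.\<close>

lemma Taylor_plane:
  fixes f :: "real \<times> real \<Rightarrow> real"
  assumes f: "twice_cont_diff f"
    and L: "L-lipschitz_on UNIV (pd1 (pd1 f))" "L-lipschitz_on UNIV (pd2 (pd2 f))"
      "L-lipschitz_on UNIV (pd1 (pd2 f))"
  shows "\<bar>f (x + a, y + b) - f (x, y) - pd1 f (x, y) * a - pd2 f (x, y) * b
     - pd1 (pd1 f) (x, y) / 2 * a\<^sup>2 - pd2 (pd2 f) (x, y) / 2 * b\<^sup>2 - pd1 (pd2 f) (x, y) * a * b\<bar>
    \<le> L * (\<bar>a\<bar> + \<bar>b\<bar>) ^ 3"
proof -
  obtain s where s: "\<bar>s\<bar> \<le> \<bar>b\<bar>"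
    "f (x + a, y + b) = f (x + a, y) + pd2 f (x + a, y) * b + pd2 (pd2 f) (x + a, y + s) / 2 * b\<^sup>2"
    using Taylor_order_two[of "\<lambda>y. f (x + a, y)" "\<lambda>y. pd2 f (x + a, y)" "\<lambda>y. pd2 (pd2 f) (x + a, y)" b y]
      twice_cont_diffD(2,4)[OF f] by blast
  obtain r where r: "\<bar>r\<bar> \<le> \<bar>a\<bar>" "pd2 f (x + a, y) = pd2 f (x, y) + pd1 (pd2 f) (x + r, y) * a"
    using Taylor_order_one[of "\<lambda>x. pd2 f (x, y)" "\<lambda>x. pd1 (pd2 f) (x, y)" a x]
      twice_cont_diffD(5)[OF f] by blast
  obtain q where q: "\<bar>q\<bar> \<le> \<bar>a\<bar>"
    "f (x + a, y) = f (x, y) + pd1 f (x, y) * a + pd1 (pd1 f) (x + q, y) / 2 * a\<^sup>2"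
    using Taylor_order_two[of "\<lambda>x. f (x, y)" "\<lambda>x. pd1 f (x, y)" "\<lambda>x. pd1 (pd1 f) (x, y)" a x]
      twice_cont_diffD(1,3)[OF f] by blast
  define S where "S = \<bar>a\<bar> + \<bar>b\<bar>"
  have S0: "0 \<le> S" by (simp add: S_def)
  \<comment> \<open>The three second derivatives are taken at intermediate points whose offsets are
    at most \<open>\<bar>a\<bar>\<close> and \<open>\<bar>b\<bar>\<close>. Lipschitz continuity
    moves each to the base point at cost \<open>L * S\<close>.\<close>
  define e2 where "e2 = pd2 (pd2 f) (x + a, y + s) - pd2 (pd2 f) (x, y)"
  define e12 where "e12 = pd1 (pd2 f) (x + r, y) - pd1 (pd2 f) (x, y)"
  define e1 where "e1 = pd1 (pd1 f) (x + q, y) - pd1 (pd1 f) (x, y)"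
  have e2: "\<bar>e2\<bar> \<le> L * S" unfolding e2_def S_def by (rule lipschitz_bound_plane[OF L(2)]) (use s in auto)
  have e12: "\<bar>e12\<bar> \<le> L * S" unfolding e12_def S_def
    using lipschitz_bound_plane[OF L(3), of r "\<bar>a\<bar>" 0 "\<bar>b\<bar>" x y] r by simp
  have e1: "\<bar>e1\<bar> \<le> L * S" unfolding e1_def S_def
    using lipschitz_bound_plane[OF L(1), of q "\<bar>a\<bar>" 0 "\<bar>b\<bar>" x y] q by simp
  have "f (x + a, y + b) - f (x, y) - pd1 f (x, y) * a - pd2 f (x, y) * b
     - pd1 (pd1 f) (x, y) / 2 * a\<^sup>2 - pd2 (pd2 f) (x, y) / 2 * b\<^sup>2 - pd1 (pd2 f) (x, y) * a * b
    = e2 / 2 * b\<^sup>2 + e12 * a * b + e1 / 2 * a\<^sup>2"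
    unfolding s(2) r(2) q(2) e2_def e12_def e1_def by (simp add: field_simps)
  also have "\<bar>\<dots>\<bar> \<le> \<bar>e2\<bar> / 2 * b\<^sup>2 + \<bar>e12\<bar> * (\<bar>a\<bar> * \<bar>b\<bar>) + \<bar>e1\<bar> / 2 * a\<^sup>2"
  proof -
    have "\<bar>e2 / 2 * b\<^sup>2\<bar> = \<bar>e2\<bar> / 2 * b\<^sup>2" "\<bar>e1 / 2 * a\<^sup>2\<bar> = \<bar>e1\<bar> / 2 * a\<^sup>2"
      "\<bar>e12 * a * b\<bar> = \<bar>e12\<bar> * (\<bar>a\<bar> * \<bar>b\<bar>)" by (simp_all add: abs_mult)
    then show ?thesis
      using abs_triangle_ineq[of "e2 / 2 * b\<^sup>2 + e12 * a * b" "e1 / 2 * a\<^sup>2"]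
        abs_triangle_ineq[of "e2 / 2 * b\<^sup>2" "e12 * a * b"] by linarith
  qed
  also have "\<dots> \<le> L * S / 2 * b\<^sup>2 + L * S * (\<bar>a\<bar> * \<bar>b\<bar>) + L * S / 2 * a\<^sup>2"
    using e1 e2 e12 by (intro add_mono mult_right_mono divide_right_mono) auto
  \<comment> \<open>The three terms complete the square of
    \<open>\<bar>a\<bar> + \<bar>b\<bar>\<close>, up to the factor 1/2.\<close>
  also have "\<dots> = L * S * (S\<^sup>2 / 2)"
    by (simp add: S_def power2_eq_square algebra_simps) (simp add: field_simps flip: abs_mult)
  also have "\<dots> \<le> L * S * S\<^sup>2"
    using lipschitz_on_nonneg[OF L(1)] S0 by (intro mult_left_mono mult_nonneg_nonneg) auto
  finally show ?thesis by (simp add: S_def power3_eq_cube power2_eq_square mult_ac)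
qed

lemma continuous_real_pair_borel:
  fixes g :: "real \<times> real \<Rightarrow> real"
  assumes g: "continuous_on UNIV g" and X: "X \<in> borel_measurable M" and Y: "Y \<in> borel_measurable M"
  shows "(\<lambda>w. g (X w, Y w)) \<in> borel_measurable M"
  using borel_measurable_continuous_onI[OF g] borel_measurable_Pair[OF X Y] by (rule measurable_compose_rev)

text \<open>Functions at time 1 take a dummy state \<open>x 0\<close> that is no coordinate of the
  path space. This property allows it to be replaced by any value, and makes all derivatives in that
  direction vanish.\<close>

definition first_free :: "(real \<times> real \<Rightarrow> real) \<Rightarrow> bool" where
  "first_free g \<longleftrightarrow> (\<forall>x x' y. g (x, y) = g (x', y))"

lemma first_freeD: "first_free g \<Longrightarrow> g (x, y) = g (x', y)"
  by (simp add: first_free_def)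

lemma first_free_pd1: "first_free g \<Longrightarrow> pd1 g = (\<lambda>_. 0)"
proof
  fix z :: "real \<times> real" assume g: "first_free g"
  obtain x y :: real where z: "z = (x, y)" by (cases z) blast
  have "(\<lambda>x. g (x, y)) = (\<lambda>_. g (0, y))" using first_freeD[OF g] by blast
  then show "pd1 g z = 0" by (simp add: z pd1_def)
qed

lemma first_free_pd2:
  assumes "first_free g"
  shows "first_free (pd2 g)"
  unfolding first_free_def pd2_def prod.case
proof (intro allI)
  fix x x' y
  have "(\<lambda>y. g (x, y)) = (\<lambda>y. g (x', y))" by (rule ext) (rule first_freeD[OF assms])
  then show "deriv (\<lambda>y. g (x, y)) y = deriv (\<lambda>y. g (x', y)) y" by simp
qed

lemma on_path_local:
  assumes s: "s \<in> {1..T}" and g: "s = 1 \<longrightarrow> first_free g"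
  shows "path_local T (on_path s g)"
  unfolding path_local_def
proof (intro allI impI)
  fix x y :: "nat \<Rightarrow> real" assume xy: "\<forall>t\<in>{1..T}. x t = y t"
  show "on_path s g x = on_path s g y"
  proof (cases "s = 1")
    case True
    then show ?thesis using g xy s first_freeD[of g "x 0" "y 1" "y 0"] by (simp add: on_path_def)
  next
    case False
    then have "s - 1 \<in> {1..T}" using s by auto
    then show ?thesis using xy s by (simp add: on_path_def)
  qed
qed

lemma on_path_borel:
  assumes s: "s \<in> {1..T}" and g: "s = 1 \<longrightarrow> first_free g" and c: "continuous_on UNIV g"
  shows "on_path s g \<in> borel_measurable (path_space T)"
proof -
  have comp: "(\<lambda>x. x t) \<in> borel_measurable (path_space T)" if "t \<in> {1..T}" for t
  proof -
    have "(\<lambda>x. x t) \<in> path_space T \<rightarrow>\<^sub>M lborel"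
      unfolding path_space_def by (rule measurable_component_singleton[OF that])
    then show ?thesis by (simp only: measurable_lborel1)
  qed
  show ?thesis
  proof (cases "s = 1")
    case True
    have ff: "first_free g" using g True by (rule mp)
    have eq: "on_path s g = (\<lambda>x. g (0, x s))"
      unfolding on_path_def by (rule ext) (rule first_freeD[OF ff])
    show ?thesis unfolding eq by (rule continuous_real_pair_borel[OF c borel_measurable_const comp[OF s]])
  next
    case False
    then have "s - 1 \<in> {1..T}" using s by auto
    then show ?thesis unfolding on_path_def by (intro continuous_real_pair_borel[OF c] comp s)
  qed
qed

lemma lipschitz_bounded_const: "lipschitz_bounded (\<lambda>_. c)"
  unfolding lipschitz_bounded_def by (auto intro!: exI[of _ 0] lipschitz_onI)

lemma lipschitz_boundedE:
  assumes "lipschitz_bounded g"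
  obtains L B where "L-lipschitz_on UNIV g" "\<And>z. \<bar>g z\<bar> \<le> B"
  using assms unfolding lipschitz_bounded_def bounded_iff by auto

lemma lipschitz_bounded_continuous: "lipschitz_bounded g \<Longrightarrow> continuous_on UNIV g"
  by (elim lipschitz_boundedE) (rule lipschitz_on_continuous_on)

section \<open>The model under the standing assumptions\<close>

locale csmc_setting =
  fixes FK :: fk_model and T N :: nat and ell :: "nat \<Rightarrow> real"
  assumes T: "1 \<le> T" and N: "1 \<le> N"
    and ell: "\<And>s. s \<in> {1..T} \<Longrightarrow> 0 < ell s"
    and model: "fk_valid FK T"
    and dens_pos: "\<And>s x y. s \<in> {1..T} \<Longrightarrow> 0 < tdens FK s x y"
    and smooth: "\<And>s. s \<in> {1..T} \<Longrightarrow> twice_cont_diff (wbar FK T s)"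
    and second: "\<And>s. s \<in> {1..T} \<Longrightarrow>
          lipschitz_bounded (pd2 (pd2 (wbar FK T s))) \<and>
          lipschitz_bounded (pd1 (pd1 (wbar FK T (s + 1)))) \<and>
          lipschitz_bounded (pd1 (pd2 (wbar FK T (s + 1))))"
    and moments: "\<And>s. s \<in> {1..T} \<Longrightarrow>
          integrable (pi_law FK T) (\<lambda>x. \<bar>on_path s (pd2 (wbar FK T s)) x\<bar> ^ 4) \<and>
          integrable (pi_law FK T) (\<lambda>x. \<bar>on_path (s + 1) (pd1 (wbar FK T (s + 1))) x\<bar> ^ 4)"
begin

abbreviation "w \<equiv> wbar FK T"

lemma wbar_first_free: "first_free (w 1)"
  by (simp add: first_free_def wbar_def tdens_def)

lemma wbar_last: "w (T + 1) = (\<lambda>_. 0)"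
  by (auto simp: wbar_def fun_eq_iff)

text \<open>The assumptions bound the derivatives involving the earlier state for the times
  \<open>s + 1\<close>, that is, from 2 onwards. At time 1 the earlier state is a dummy and these
  derivatives are zero.\<close>

lemma second_order:
  assumes "s \<in> {1..T}"
  shows "lipschitz_bounded (pd1 (pd1 (w s)))" "lipschitz_bounded (pd2 (pd2 (w s)))"
    "lipschitz_bounded (pd1 (pd2 (w s)))"
proof -
  have pd0: "pd1 (\<lambda>_. 0) = (\<lambda>_. 0)" by (rule first_free_pd1) (simp add: first_free_def)
  have "lipschitz_bounded (pd1 (pd1 (w s))) \<and> lipschitz_bounded (pd1 (pd2 (w s)))"
  proof (cases "s = 1")
    case True
    have "pd1 (pd1 (w 1)) = (\<lambda>_. 0)" "pd1 (pd2 (w 1)) = (\<lambda>_. 0)"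
      using first_free_pd1[OF wbar_first_free] first_free_pd1[OF first_free_pd2[OF wbar_first_free]] pd0
      by simp_all
    then show ?thesis unfolding True by (simp only: lipschitz_bounded_const)
  next
    case False
    then have "s - 1 \<in> {1..T}" "s - 1 + 1 = s" using assms by auto
    then show ?thesis using second[of "s - 1"] by metis
  qed
  then show "lipschitz_bounded (pd1 (pd1 (w s)))" "lipschitz_bounded (pd1 (pd2 (w s)))" by blast+
  show "lipschitz_bounded (pd2 (pd2 (w s)))" using second[OF assms] by blast
qed

lemma Taylor_wbar:
  assumes s: "s \<in> {1..T}"
  obtains L where "0 \<le> L" "\<And>x y a b. \<bar>w s (x + a, y + b) - w s (x, y) - pd1 (w s) (x, y) * a - pd2 (w s) (x, y) * b
     - pd1 (pd1 (w s)) (x, y) / 2 * a\<^sup>2 - pd2 (pd2 (w s)) (x, y) / 2 * b\<^sup>2 - pd1 (pd2 (w s)) (x, y) * a * b\<bar>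
    \<le> L * (\<bar>a\<bar> + \<bar>b\<bar>) ^ 3"
proof -
  obtain L1 L2 L3 where L: "L1-lipschitz_on UNIV (pd1 (pd1 (w s)))" "L2-lipschitz_on UNIV (pd2 (pd2 (w s)))"
      "L3-lipschitz_on UNIV (pd1 (pd2 (w s)))"
    using second_order[OF s] unfolding lipschitz_bounded_def by blast
  define L where "L = max L1 (max L2 L3)"
  have "L-lipschitz_on UNIV (pd1 (pd1 (w s)))" "L-lipschitz_on UNIV (pd2 (pd2 (w s)))"
      "L-lipschitz_on UNIV (pd1 (pd2 (w s)))"
    by (rule lipschitz_on_mono[OF L(1) order_refl] lipschitz_on_mono[OF L(2) order_refl]
        lipschitz_on_mono[OF L(3) order_refl]; simp add: L_def)+
  then show ?thesis using Taylor_plane[OF smooth[OF s]] lipschitz_on_nonneg that by blast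
qed

text \<open>Three cases: the block of \<open>V\<close>, the block of \<open>W\<close> before the
  final time, and the block of \<open>W\<close> at the final time, where \<open>w (T + 1)\<close>
  and its derivatives are zero.\<close>

lemma dwbar_facts:
  assumes t: "t \<in> {1..T}" and i: "i \<in> {0, 1}"
  shows "on_path (t + i) (dwbar FK T t i) \<in> borel_measurable (path_space T)"
    and "path_local T (on_path (t + i) (dwbar FK T t i))"
    and "integrable (pi_law FK T) (\<lambda>x. on_path (t + i) (dwbar FK T t i) x ^ 4)"
    and "on_path (t + i) (ddwbar FK T t i) \<in> borel_measurable (path_space T)"
    and "path_local T (on_path (t + i) (ddwbar FK T t i))"
    and "lipschitz_bounded (ddwbar FK T t i)"
proof -
  have pd0: "pd1 (\<lambda>_. 0) = (\<lambda>_. 0)" by (rule first_free_pd1) (simp add: first_free_def)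
  have "i = 0 \<or> (i = 1 \<and> t + 1 \<in> {1..T}) \<or> (i = 1 \<and> t = T)" using t i by auto
  then have "on_path (t + i) (dwbar FK T t i) \<in> borel_measurable (path_space T)
    \<and> path_local T (on_path (t + i) (dwbar FK T t i))
    \<and> on_path (t + i) (ddwbar FK T t i) \<in> borel_measurable (path_space T)
    \<and> path_local T (on_path (t + i) (ddwbar FK T t i)) \<and> lipschitz_bounded (ddwbar FK T t i)"
  proof (elim disjE conjE)
    assume i: "i = 0"
    have ff: "t = 1 \<longrightarrow> first_free (pd2 (w t))" "t = 1 \<longrightarrow> first_free (pd2 (pd2 (w t)))"
      using wbar_first_free first_free_pd2 by blast+
    have e: "t + 0 = t" "dwbar FK T t 0 = pd2 (w t)" "ddwbar FK T t 0 = pd2 (pd2 (w t))"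
      by (simp_all add: dwbar_def ddwbar_def)
    show ?thesis unfolding i e
      by (intro conjI on_path_borel[OF t ff(1)] twice_cont_diffD(7)[OF smooth[OF t]] on_path_local[OF t ff(1)]
        on_path_borel[OF t ff(2)] lipschitz_bounded_continuous[OF second_order(2)[OF t]]
        on_path_local[OF t ff(2)] second_order(2)[OF t])
  next
    assume i: "i = 1" and t1: "t + 1 \<in> {1..T}"
    have ff: "t + 1 = 1 \<longrightarrow> first_free g" for g using t by auto
    have e: "dwbar FK T t 1 = pd1 (w (t + 1))" "ddwbar FK T t 1 = pd1 (pd1 (w (t + 1)))"
      by (simp_all add: dwbar_def ddwbar_def)
    show ?thesis unfolding i e
      by (intro conjI on_path_borel[OF t1 ff] twice_cont_diffD(6)[OF smooth[OF t1]] on_path_local[OF t1 ff]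
        lipschitz_bounded_continuous[OF second_order(1)[OF t1]] second_order(1)[OF t1])
  next
    assume i: "i = 1" and tT: "t = T"
    have "dwbar FK T t i = (\<lambda>_. 0)" "ddwbar FK T t i = (\<lambda>_. 0)"
      using pd0 wbar_last by (simp_all add: dwbar_def ddwbar_def i tT)
    then show ?thesis
      using lipschitz_bounded_const by (simp add: on_path_def[abs_def] path_local_def)
  qed
  then show "on_path (t + i) (dwbar FK T t i) \<in> borel_measurable (path_space T)"
    "path_local T (on_path (t + i) (dwbar FK T t i))"
    "on_path (t + i) (ddwbar FK T t i) \<in> borel_measurable (path_space T)"
    "path_local T (on_path (t + i) (ddwbar FK T t i))" "lipschitz_bounded (ddwbar FK T t i)" by blast+
  show "integrable (pi_law FK T) (\<lambda>x. on_path (t + i) (dwbar FK T t i) x ^ 4)"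
    using moments[OF t] i by (auto simp: dwbar_def power_even_abs)
qed

text \<open>The averages that determine the limiting Gaussian laws: \<open>j = 2\<close> encodes a
  second derivative, whose mean is the drift up to the factor \<open>ell t / 2\<close>;
  \<open>j = 0\<close> and \<open>j = 1\<close> encode a product of first derivatives, whose mean is
  an entry of the 2 by 2 covariance block up to the factor \<open>ell t\<close>.\<close>

definition test_fun :: "nat \<times> nat \<times> nat \<Rightarrow> (nat \<Rightarrow> real) \<Rightarrow> real" where
  "test_fun = (\<lambda>(t, i, j) x. if j = 2 then on_path (t + i) (ddwbar FK T t i) x
     else on_path (t + i) (dwbar FK T t i) x * on_path (t + j) (dwbar FK T t j) x)"

definition test_indices :: "(nat \<times> nat \<times> nat) set" where
  "test_indices = {1..T} \<times> {0, 1} \<times> {0, 1, 2}"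

lemma pi_law_borel_iff: "f \<in> borel_measurable (pi_law FK T) \<longleftrightarrow> f \<in> borel_measurable (path_space T)"
  by (rule measurable_cong_sets[OF sets_pi_law[OF model] refl, THEN eqset_imp_iff])

lemma dwbar_square_integrable:
  assumes t: "t \<in> {1..T}" and i: "i \<in> {0, 1}"
  shows "integrable (pi_law FK T) (\<lambda>x. (on_path (t + i) (dwbar FK T t i) x)\<^sup>2)"
  using finite_measure.integrable_lower_power(2)[OF prob_space.finite_measure[OF prob_space_pi_law[OF model]]
      dwbar_facts(1)[OF t i, folded pi_law_borel_iff] dwbar_facts(3)[OF t i], of 2] by simp

text \<open>Square integrability is what the typical set asks for. Second derivatives are bounded;
  for a product of first derivatives it follows from the fourth moments of the two factors.\<close>

lemma test_fun_facts:
  assumes k: "k \<in> test_indices"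
  shows "test_fun k \<in> borel_measurable (path_space T)" "path_local T (test_fun k)"
    "integrable (pi_law FK T) (\<lambda>x. (test_fun k x)\<^sup>2)"
proof -
  interpret pi: prob_space "pi_law FK T" by (rule prob_space_pi_law[OF model])
  obtain t i j where k: "k = (t, i, j)" and t: "t \<in> {1..T}" and i: "i \<in> {0, 1}" and j: "j = 2 \<or> j \<in> {0, 1}"
    using k by (auto simp: test_indices_def)
  let ?f = "\<lambda>i. on_path (t + i) (dwbar FK T t i)"
  have "test_fun k \<in> borel_measurable (path_space T) \<and> path_local T (test_fun k) \<and>
    integrable (pi_law FK T) (\<lambda>x. (test_fun k x)\<^sup>2)"
  proof (cases "j = 2")
    case True
    then have eq: "test_fun k = on_path (t + i) (ddwbar FK T t i)" by (simp add: k test_fun_def fun_eq_iff)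
    obtain B where B: "\<And>z. \<bar>ddwbar FK T t i z\<bar> \<le> B"
      using lipschitz_boundedE[OF dwbar_facts(6)[OF t i]] by metis
    have "\<bar>on_path (t + i) (ddwbar FK T t i) x\<bar> \<le> B" for x by (simp add: on_path_def B)
    then have sqB: "(on_path (t + i) (ddwbar FK T t i) x)\<^sup>2 \<le> B\<^sup>2" for x
      using power_mono[of "\<bar>on_path (t + i) (ddwbar FK T t i) x\<bar>" B 2] by simp
    have "integrable (pi_law FK T) (\<lambda>x. (on_path (t + i) (ddwbar FK T t i) x)\<^sup>2)"
    proof (rule pi.integrable_const_bound)
      show "AE x in pi_law FK T. norm ((on_path (t + i) (ddwbar FK T t i) x)\<^sup>2) \<le> B\<^sup>2"
        using sqB by simp
    qed (rule borel_measurable_power[OF dwbar_facts(4)[OF t i, folded pi_law_borel_iff]])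
    then show ?thesis unfolding eq using dwbar_facts(4,5)[OF t i] by blast
  next
    case False
    then have j: "j \<in> {0, 1}" using j by blast
    have eq: "test_fun k = (\<lambda>x. ?f i x * ?f j x)" using False by (simp add: k test_fun_def fun_eq_iff)
    have m: "?f i \<in> borel_measurable (pi_law FK T)" "?f j \<in> borel_measurable (pi_law FK T)"
      by (rule dwbar_facts(1)[OF t i, folded pi_law_borel_iff] dwbar_facts(1)[OF t j, folded pi_law_borel_iff])+
    have sq: "((?f i x)\<^sup>2)\<^sup>2 = ?f i x ^ 4" for i x by (simp add: power_mult[symmetric])
    have "integrable (pi_law FK T) (\<lambda>x. (?f i x)\<^sup>2 * (?f j x)\<^sup>2)"
      by (intro integrable_product_of_squares borel_measurable_power m; unfold sq;
          rule dwbar_facts(3)[OF t i] dwbar_facts(3)[OF t j])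
    moreover have "path_local T (\<lambda>x. ?f i x * ?f j x)"
      unfolding path_local_def
      by (intro allI impI arg_cong2[of _ _ _ _ "(*)"] path_localD[OF dwbar_facts(2)[OF t i]]
          path_localD[OF dwbar_facts(2)[OF t j]]) (rule bspec, assumption+)+
    ultimately show ?thesis unfolding eq power_mult_distrib
      by (intro conjI borel_measurable_times dwbar_facts(1)[OF t i] dwbar_facts(1)[OF t j])
  qed
  then show "test_fun k \<in> borel_measurable (path_space T)" "path_local T (test_fun k)"
    "integrable (pi_law FK T) (\<lambda>x. (test_fun k x)\<^sup>2)" by blast+
qed

definition F :: "nat \<Rightarrow> (nat \<Rightarrow> nat \<Rightarrow> real) set" where
  "F = typical_set FK T test_indices test_fun"

lemma F_sets: "F D \<in> sets (state_space T D)"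
  and F_measure: "(\<lambda>D. measure (target_law FK T D) (F D)) \<longlonglongrightarrow> 1"
proof -
  have fin: "finite test_indices" by (simp add: test_indices_def)
  show "F D \<in> sets (state_space T D)"
    unfolding F_def by (rule typical_set_sets[OF model fin]) (use test_fun_facts in blast)+
  show "(\<lambda>D. measure (target_law FK T D) (F D)) \<longlonglongrightarrow> 1"
    unfolding F_def by (rule measure_typical_set[OF model fin]) (use test_fun_facts in blast)+
qed

lemma F_empirical_mean:
  assumes "x \<in> F D" "k \<in> test_indices"
  shows "\<bar>empirical_mean (test_fun k) D x - (\<integral>v. test_fun k v \<partial>pi_law FK T)\<bar> \<le> sqrt (sqrt (1 / D))"
  using assms by (simp add: F_def typical_set_def)

end

section \<open>The remainder vanishes in mean\<close>

lemma twice_cont_diff_continuous: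
  assumes "twice_cont_diff f"
  shows "continuous_on UNIV f"
proof -
  obtain f' where f': "\<forall>z. (f has_derivative blinfun_apply (f' z)) (at z)"
    using assms unfolding twice_cont_diff_def by blast
  show ?thesis by (rule has_derivative_continuous_on[of UNIV f "\<lambda>z. blinfun_apply (f' z)"]) (use f' in simp)
qed

lemma power3_add_le: "0 \<le> a \<Longrightarrow> 0 \<le> b \<Longrightarrow> (a + b) ^ 3 \<le> 4 * (a ^ 3 + b ^ 3)" for a b :: real
proof -
  assume ab: "0 \<le> a" "0 \<le> b"
  have "4 * (a ^ 3 + b ^ 3) - (a + b) ^ 3 = 3 * (a + b) * (a - b)\<^sup>2"
    by (simp add: power3_eq_cube power2_eq_square algebra_simps)
  also have "0 \<le> \<dots>" using ab by simp
  finally show ?thesis by simp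
qed

context csmc_setting
begin

section \<open>The standardised Gaussian increments\<close>

definition nu :: "(nat \<Rightarrow> real) measure" where
  "nu = mvnormal {1..N} (\<lambda>_. 0) Sigma_mat"

definition noise :: "nat \<Rightarrow> (nat \<times> nat \<Rightarrow> nat \<Rightarrow> real) measure" where
  "noise D = PiM ({1..T} \<times> {1..D}) (\<lambda>_. nu)"

lemma Sigma_has_factor: "has_cov_factor {1..N} Sigma_mat"
  using Sigma_mat_factor[OF N] unfolding has_cov_factor_def by metis

lemma prob_space_nu: "prob_space nu"
  unfolding nu_def by (rule prob_space_mvnormal) simp

lemma prob_space_noise: "prob_space (noise D)"
  unfolding noise_def by (intro prob_space_PiM prob_space_nu)

lemma nu_facts:
  assumes n: "n \<in> {1..N}"
  shows "(\<lambda>v. v n) \<in> borel_measurable nu" "integrable nu (\<lambda>v. v n ^ 4)"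
    "k \<le> 4 \<Longrightarrow> integrable nu (\<lambda>v. \<bar>v n\<bar> ^ k)" "k \<le> 4 \<Longrightarrow> integrable nu (\<lambda>v. v n ^ k)"
    "integrable nu (\<lambda>v. v n)" "(\<integral>v. v n \<partial>nu) = 0" "(\<integral>v. (v n)\<^sup>2 \<partial>nu) = 1"
proof -
  interpret nu: prob_space nu by (rule prob_space_nu)
  show m: "(\<lambda>v. v n) \<in> borel_measurable nu"
    unfolding nu_def by (rule measurable_mvnormal_component[OF n])
  show i: "integrable nu (\<lambda>v. v n ^ 4)"
    unfolding nu_def by (rule mvnormal_power4[OF finite_atLeastAtMost Sigma_has_factor n])
  show "k \<le> 4 \<Longrightarrow> integrable nu (\<lambda>v. \<bar>v n\<bar> ^ k)" "k \<le> 4 \<Longrightarrow> integrable nu (\<lambda>v. v n ^ k)"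
    using nu.integrable_lower_power[OF m i] by blast+
  show "integrable nu (\<lambda>v. v n)" using nu.integrable_lower_power(2)[OF m i, of 1] by simp
  show "(\<integral>v. v n \<partial>nu) = 0" "(\<integral>v. (v n)\<^sup>2 \<partial>nu) = 1"
    using mvnormal_centred_moments[OF finite_atLeastAtMost Sigma_has_factor n]
    by (simp_all add: nu_def Sigma_mat_def)
qed

lemma noise_component:
  fixes f :: "(nat \<Rightarrow> real) \<Rightarrow> real"
  assumes j: "j \<in> {1..T} \<times> {1..D}" and f: "integrable nu f"
  shows "integrable (noise D) (\<lambda>u. f (u j))" "(\<integral>u. f (u j) \<partial>noise D) = (\<integral>v. f v \<partial>nu)"
  unfolding noise_def
  using PiM_integrable_component[where M = "\<lambda>_. nu", OF prob_space_nu _ j f]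
    PiM_integral_component[where M = "\<lambda>_. nu", OF prob_space_nu _ j f] by simp_all

lemma noise_two_components:
  fixes f g :: "_ \<Rightarrow> real"
  assumes "j \<in> {1..T} \<times> {1..D}" "k \<in> {1..T} \<times> {1..D}" "j \<noteq> k" and "integrable nu f" "integrable nu g"
  shows "(\<integral>u. f (u j) * g (u k) \<partial>noise D) = (\<integral>v. f v \<partial>nu) * (\<integral>v. g v \<partial>nu)"
    "integrable (noise D) (\<lambda>u. f (u j) * g (u k))"
proof -
  have fin: "finite ({1..T} \<times> {1..D})" by simp
  show "(\<integral>u. f (u j) * g (u k) \<partial>noise D) = (\<integral>v. f v \<partial>nu) * (\<integral>v. g v \<partial>nu)"
    unfolding noise_def by (rule PiM_integral_two_components[OF prob_space_nu fin assms])
  have "integrable nu (if i = j then f else g)" for i using assms by simp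
  then show "integrable (noise D) (\<lambda>u. f (u j) * g (u k))"
    unfolding noise_def
    using PiM_integrable_prod[OF prob_space_nu fin, where S = "{j, k}" and f = "\<lambda>i. if i = j then f else g"] assms
    by simp
qed

lemma noise_borel:
  assumes j: "j \<in> {1..T} \<times> {1..D}" and n: "n \<in> {1..N}"
  shows "(\<lambda>u. u j n) \<in> borel_measurable (noise D)"
  unfolding noise_def by (rule measurable_compose[OF measurable_component_singleton[OF j] nu_facts(1)[OF n]])

text \<open>Increments extended by zero to the reference particle \<open>n = 0\<close>, which does
  not move, and to the dummy time 0. The expansion of the log-weights then has one form for all
  indices.\<close>

definition U :: "(nat \<times> nat \<Rightarrow> nat \<Rightarrow> real) \<Rightarrow> nat \<Rightarrow> nat \<Rightarrow> nat \<Rightarrow> real" where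
  "U u t d n = (if t = 0 \<or> n = 0 then 0 else u (t, d) n)"

lemma U_borel:
  assumes "t \<le> T" "d \<in> {1..D}" "n \<le> N"
  shows "(\<lambda>u. U u t d n) \<in> borel_measurable (noise D)"
proof (cases "t = 0 \<or> n = 0")
  case False
  then have eq: "(\<lambda>u. U u t d n) = (\<lambda>u. u (t, d) n)" by (simp add: U_def)
  have "(t, d) \<in> {1..T} \<times> {1..D}" "n \<in> {1..N}" using assms False by auto
  then show ?thesis unfolding eq by (rule noise_borel)
qed (auto simp: U_def)

text \<open>D^(-1/2) bounds orthogonal averages and the cubic remainder; D^(-1/4) is the tolerance
  of the typical set.\<close>

definition rate :: "nat \<Rightarrow> real" where
  "rate D = sqrt (1 / D) + sqrt (sqrt (1 / D))"

lemma rate_nonneg: "0 \<le> rate D"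
  by (simp add: rate_def)

lemma rate_tendsto: "rate \<longlonglongrightarrow> 0"
proof -
  have "(\<lambda>D. sqrt (1 / real D) + sqrt (sqrt (1 / real D))) \<longlonglongrightarrow> sqrt 0 + sqrt (sqrt 0)"
    by (intro tendsto_intros lim_1_over_n)
  then show ?thesis by (simp add: rate_def[abs_def])
qed

text \<open>A big-O in mean absolute value whose constant is uniform over \<open>D \<ge> 1\<close>
  and over all typical paths. This uniformity lets the estimates be used along any sequence of
  typical paths.\<close>

definition mean_order ::
  "(nat \<Rightarrow> real) \<Rightarrow> (nat \<Rightarrow> (nat \<Rightarrow> nat \<Rightarrow> real) \<Rightarrow> (nat \<times> nat \<Rightarrow> nat \<Rightarrow> real) \<Rightarrow> real) \<Rightarrow> bool" where
  "mean_order r X \<longleftrightarrow> (\<exists>c. \<forall>D x. 1 \<le> D \<longrightarrow> x \<in> F D \<longrightarrow>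
     integrable (noise D) (X D x) \<and> (\<integral>u. \<bar>X D x u\<bar> \<partial>noise D) \<le> c * r D)"

lemma mean_orderI:
  assumes "\<And>D x. 1 \<le> D \<Longrightarrow> x \<in> F D \<Longrightarrow> integrable (noise D) (X D x)"
    "\<And>D x. 1 \<le> D \<Longrightarrow> x \<in> F D \<Longrightarrow> (\<integral>u. \<bar>X D x u\<bar> \<partial>noise D) \<le> c * r D"
  shows "mean_order r X"
  using assms unfolding mean_order_def by blast

lemma mean_orderE:
  assumes "mean_order r X"
  obtains c where "\<And>D x. 1 \<le> D \<Longrightarrow> x \<in> F D \<Longrightarrow> integrable (noise D) (X D x)"
    "\<And>D x. 1 \<le> D \<Longrightarrow> x \<in> F D \<Longrightarrow> (\<integral>u. \<bar>X D x u\<bar> \<partial>noise D) \<le> c * r D"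
  using assms unfolding mean_order_def by blast

lemma mean_order_zero: "mean_order r (\<lambda>D x u. 0)"
  by (rule mean_orderI[where c = 0]) simp_all

lemma mean_order_dominated:
  assumes Y: "mean_order r Y"
    and m: "\<And>D x. 1 \<le> D \<Longrightarrow> X D x \<in> borel_measurable (noise D)"
    and le: "\<And>D x u. 1 \<le> D \<Longrightarrow> \<bar>X D x u\<bar> \<le> Y D x u"
  shows "mean_order r X"
proof -
  obtain c where c: "\<And>D x. 1 \<le> D \<Longrightarrow> x \<in> F D \<Longrightarrow> integrable (noise D) (Y D x)"
    "\<And>D x. 1 \<le> D \<Longrightarrow> x \<in> F D \<Longrightarrow> (\<integral>u. \<bar>Y D x u\<bar> \<partial>noise D) \<le> c * r D"
    using Y by (rule mean_orderE) blast
  show ?thesis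
  proof (rule mean_orderI[where c = c])
    fix D x assume D: "1 \<le> D" and x: "x \<in> F D"
    have le': "\<bar>X D x u\<bar> \<le> \<bar>Y D x u\<bar>" for u using le[OF D] abs_ge_self by (rule order_trans)
    show i: "integrable (noise D) (X D x)"
      by (rule Bochner_Integration.integrable_bound[OF c(1)[OF D x] m[OF D]]) (simp add: le')
    have "(\<integral>u. \<bar>X D x u\<bar> \<partial>noise D) \<le> (\<integral>u. \<bar>Y D x u\<bar> \<partial>noise D)"
      by (intro integral_mono integrable_abs i c(1) D x le')
    then show "(\<integral>u. \<bar>X D x u\<bar> \<partial>noise D) \<le> c * r D" using c(2)[OF D x] by linarith
  qed
qed

lemma mean_order_add:
  assumes X: "mean_order r X" and Y: "mean_order r Y"
  shows "mean_order r (\<lambda>D x u. X D x u + Y D x u)"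
proof -
  obtain b where b: "\<And>D x. 1 \<le> D \<Longrightarrow> x \<in> F D \<Longrightarrow> integrable (noise D) (X D x)"
    "\<And>D x. 1 \<le> D \<Longrightarrow> x \<in> F D \<Longrightarrow> (\<integral>u. \<bar>X D x u\<bar> \<partial>noise D) \<le> b * r D"
    using X by (rule mean_orderE) blast
  obtain c where c: "\<And>D x. 1 \<le> D \<Longrightarrow> x \<in> F D \<Longrightarrow> integrable (noise D) (Y D x)"
    "\<And>D x. 1 \<le> D \<Longrightarrow> x \<in> F D \<Longrightarrow> (\<integral>u. \<bar>Y D x u\<bar> \<partial>noise D) \<le> c * r D"
    using Y by (rule mean_orderE) blast
  show ?thesis
  proof (rule mean_orderI[where c = "b + c"])
    fix D x assume D: "1 \<le> D" and x: "x \<in> F D"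
    note i = b(1)[OF D x] c(1)[OF D x]
    show "integrable (noise D) (\<lambda>u. X D x u + Y D x u)" using i by (rule Bochner_Integration.integrable_add)
    have "(\<integral>u. \<bar>X D x u + Y D x u\<bar> \<partial>noise D) \<le> (\<integral>u. \<bar>X D x u\<bar> + \<bar>Y D x u\<bar> \<partial>noise D)"
      by (intro integral_mono integrable_abs Bochner_Integration.integrable_add i abs_triangle_ineq)
    also have "\<dots> = (\<integral>u. \<bar>X D x u\<bar> \<partial>noise D) + (\<integral>u. \<bar>Y D x u\<bar> \<partial>noise D)"
      by (intro Bochner_Integration.integral_add integrable_abs i)
    finally show "(\<integral>u. \<bar>X D x u + Y D x u\<bar> \<partial>noise D) \<le> (b + c) * r D"
      using b(2)[OF D x] c(2)[OF D x] unfolding distrib_right by linarith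
  qed
qed

lemma mean_order_cmult:
  assumes "mean_order r X"
  shows "mean_order r (\<lambda>D x u. s * X D x u)"
proof -
  obtain c where c: "\<And>D x. 1 \<le> D \<Longrightarrow> x \<in> F D \<Longrightarrow> integrable (noise D) (X D x)"
    "\<And>D x. 1 \<le> D \<Longrightarrow> x \<in> F D \<Longrightarrow> (\<integral>u. \<bar>X D x u\<bar> \<partial>noise D) \<le> c * r D"
    using assms by (rule mean_orderE) blast
  have "\<bar>s\<bar> * (\<integral>u. \<bar>X D x u\<bar> \<partial>noise D) \<le> \<bar>s\<bar> * (c * r D)" if "1 \<le> D" "x \<in> F D" for D x
    using c(2)[OF that] by (rule mult_left_mono) simp
  then show ?thesis using c(1)
    by (intro mean_orderI[where c = "\<bar>s\<bar> * c"]) (simp_all add: abs_mult mult.assoc)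
qed

lemma mean_order_abs: "mean_order r X \<Longrightarrow> mean_order r (\<lambda>D x u. \<bar>X D x u\<bar>)"
  unfolding mean_order_def abs_abs by (blast intro: integrable_abs)

lemma rate_le_2: "1 \<le> D \<Longrightarrow> rate D \<le> 2"
proof -
  assume "1 \<le> D"
  then have 1: "sqrt (1 / D) \<le> 1" by simp
  then have "sqrt (sqrt (1 / D)) \<le> 1" by (simp only: real_sqrt_le_1_iff)
  then show ?thesis using 1 unfolding rate_def by linarith
qed

lemma mean_order_rate_imp_bounded:
  assumes "mean_order rate X"
  shows "mean_order (\<lambda>_. 1) X"
proof -
  obtain c where c: "\<And>D x. 1 \<le> D \<Longrightarrow> x \<in> F D \<Longrightarrow> integrable (noise D) (X D x)"
    "\<And>D x. 1 \<le> D \<Longrightarrow> x \<in> F D \<Longrightarrow> (\<integral>u. \<bar>X D x u\<bar> \<partial>noise D) \<le> c * rate D"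
    using assms by (rule mean_orderE) blast
  show ?thesis
  proof (rule mean_orderI[OF c(1), where c = "\<bar>c\<bar> * 2"])
    fix D x assume D: "1 \<le> D" and x: "x \<in> F D"
    have "c * rate D \<le> \<bar>c\<bar> * 2"
      using rate_nonneg rate_le_2[OF D] by (intro mult_mono) auto
    then show "(\<integral>u. \<bar>X D x u\<bar> \<partial>noise D) \<le> \<bar>c\<bar> * 2 * 1" using c(2)[OF D x] by linarith
  qed
qed

section \<open>The quadratic, mixed and cubic contributions\<close>

definition mean2 :: "nat \<Rightarrow> nat \<Rightarrow> real" where
  "mean2 t i = (\<integral>x. on_path (t + i) (ddwbar FK T t i) x \<partial>pi_law FK T)"

text \<open>The pure second-order term after subtraction of its limiting mean. For
  \<open>n = 0\<close> the increments are zero and the limiting vector has the value 0 by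
  convention, so nothing is subtracted.\<close>

definition quad :: "nat \<Rightarrow> (nat \<Rightarrow> nat \<Rightarrow> real) \<Rightarrow> (nat \<times> nat \<Rightarrow> nat \<Rightarrow> real) \<Rightarrow> nat \<Rightarrow> nat \<Rightarrow> nat \<Rightarrow> real" where
  "quad D x u t i n = ell t / 2 *
     ((\<Sum>d=1..D. ddwbar FK T t i (x (t + i - 1) d, x (t + i) d) * (U u t d n)\<^sup>2) / D - (if n = 0 then 0 else mean2 t i))"

text \<open>The squared increments have mean 1. Replacing them by 1 costs an average of centred
  orthogonal terms with bounded coefficients, of order D^(-1/2); what remains is the deviation of an
  empirical mean, at most D^(-1/4) on the typical set.\<close>

lemma mean_order_quad:
  assumes t: "t \<in> {1..T}" and i: "i \<in> {0, 1}" and n: "n \<le> N"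
  shows "mean_order rate (\<lambda>D x u. quad D x u t i n)"
proof (cases "n = 0")
  case True
  then show ?thesis using mean_order_zero by (simp add: quad_def U_def)
next
  case False
  then have n: "n \<in> {1..N}" using n by simp
  interpret nu: prob_space nu by (rule prob_space_nu)
  obtain B where B: "\<And>z. \<bar>ddwbar FK T t i z\<bar> \<le> B"
    using lipschitz_boundedE[OF dwbar_facts(6)[OF t i]] by metis
  have B0: "0 \<le> B" using B[of undefined] by linarith
  define C where "C = (\<integral>v. ((v n)\<^sup>2 - 1)\<^sup>2 \<partial>nu)"
  have C0: "0 \<le> C" unfolding C_def by (rule integral_nonneg_AE) simp
  have cen: "integrable nu (\<lambda>v. (v n)\<^sup>2 - 1)" "(\<integral>v. (v n)\<^sup>2 - 1 \<partial>nu) = 0"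
    using nu_facts(4)[OF n, of 2] nu_facts(7)[OF n] by (simp_all add: nu.prob_space)
  have "((v n)\<^sup>2 - 1)\<^sup>2 = v n ^ 4 - 2 * (v n)\<^sup>2 + 1" for v :: "nat \<Rightarrow> real"
    by (simp add: power2_eq_square power4_eq_xxxx algebra_simps)
  then have csq: "integrable nu (\<lambda>v. ((v n)\<^sup>2 - 1)\<^sup>2)"
    using nu_facts(4)[OF n, of 2] nu_facts(2)[OF n] by simp
  define c where "c = ell t / 2 * (B * sqrt C + 1)"
  have main: "integrable (noise D) (\<lambda>u. quad D x u t i n) \<and> (\<integral>u. \<bar>quad D x u t i n\<bar> \<partial>noise D) \<le> c * rate D"
    if D: "1 \<le> D" and x: "x \<in> F D" for D x
  proof -
    interpret P: prob_space "noise D" by (rule prob_space_noise)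
    define g where "g d = ddwbar FK T t i (x (t + i - 1) d, x (t + i) d)" for d
    define S where "S u = (\<Sum>d=1..D. g d * ((u (t, d) n)\<^sup>2 - 1)) / D" for u :: "nat \<times> nat \<Rightarrow> nat \<Rightarrow> real"
    define r where "r = (\<Sum>d=1..D. g d) / D - mean2 t i"
    have mem: "(t, d) \<in> {1..T} \<times> {1..D}" if "d \<in> {1..D}" for d using t that by simp
    have h: "(\<lambda>u. (u (t, d) n)\<^sup>2 - 1) \<in> borel_measurable (noise D)"
      "integrable (noise D) (\<lambda>u. ((u (t, d) n)\<^sup>2 - 1)\<^sup>2)"
      "P.expectation (\<lambda>u. ((u (t, d) n)\<^sup>2 - 1)\<^sup>2) \<le> C" if "d \<in> {1..D}" for d
      by (rule borel_measurable_integrable[OF noise_component(1)[OF mem[OF that] cen(1)]]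
          noise_component(1)[OF mem[OF that] csq]
          eq_refl[OF noise_component(2)[OF mem[OF that] csq, folded C_def]])+
    have orth: "P.expectation (\<lambda>u. ((u (t, d) n)\<^sup>2 - 1) * ((u (t, e) n)\<^sup>2 - 1)) = 0"
      if "d \<in> {1..D}" "e \<in> {1..D}" "d \<noteq> e" for d e
      using noise_two_components(1)[OF mem[OF that(1)] mem[OF that(2)] _ cen(1) cen(1)] that(3) cen(2) by simp
    have gB: "\<bar>g d\<bar> \<le> B" for d unfolding g_def by (rule B)
    have S: "integrable (noise D) S" "P.expectation (\<lambda>u. \<bar>S u\<bar>) \<le> B * sqrt (C / D)"
      unfolding S_def
      using P.orthogonal_average_bound[where X = "\<lambda>d u. (u (t, d) n)\<^sup>2 - 1" and c = g, OF h orth gB C0 D]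
      by blast+
    have k: "(t, i, 2) \<in> test_indices" using t i by (auto simp: test_indices_def)
    have r: "\<bar>r\<bar> \<le> sqrt (sqrt (1 / D))"
      using F_empirical_mean[OF x k]
      unfolding r_def g_def empirical_mean_def test_fun_def mean2_def on_path_def by simp
    have q: "quad D x u t i n = ell t / 2 * (S u + r)" for u
      using False t D
      by (simp add: quad_def U_def S_def r_def g_def algebra_simps sum_subtractf sum.distrib diff_divide_distrib)
    have int: "integrable (noise D) (\<lambda>u. quad D x u t i n)"
      unfolding q using S(1) by simp
    have "(\<integral>u. \<bar>quad D x u t i n\<bar> \<partial>noise D) \<le> (\<integral>u. ell t / 2 * (\<bar>S u\<bar> + \<bar>r\<bar>) \<partial>noise D)"
    proof (rule integral_mono)
      show "integrable (noise D) (\<lambda>u. \<bar>quad D x u t i n\<bar>)" using int by simp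
      show "integrable (noise D) (\<lambda>u. ell t / 2 * (\<bar>S u\<bar> + \<bar>r\<bar>))" using S(1) by simp
      fix u
      have "\<bar>quad D x u t i n\<bar> = ell t / 2 * \<bar>S u + r\<bar>" using ell[OF t] by (simp add: q abs_mult)
      also have "\<dots> \<le> ell t / 2 * (\<bar>S u\<bar> + \<bar>r\<bar>)"
        using ell[OF t] by (intro mult_left_mono abs_triangle_ineq) auto
      finally show "\<bar>quad D x u t i n\<bar> \<le> ell t / 2 * (\<bar>S u\<bar> + \<bar>r\<bar>)" .
    qed
    also have "\<dots> = ell t / 2 * (P.expectation (\<lambda>u. \<bar>S u\<bar>) + \<bar>r\<bar>)"
      using S(1) by (simp add: P.prob_space)
    also have "\<dots> \<le> ell t / 2 * (B * sqrt (C / D) + sqrt (sqrt (1 / D)))"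
      using ell[OF t] S(2) r by (intro mult_left_mono add_mono) auto
    also have "\<dots> \<le> ell t / 2 * ((B * sqrt C + 1) * rate D)"
    proof (rule mult_left_mono)
      have e: "B * sqrt (C / D) = B * sqrt C * sqrt (1 / D)" by (simp add: real_sqrt_divide)
      have "B * sqrt C * sqrt (1 / D) \<le> B * sqrt C * rate D"
        using B0 C0 by (intro mult_left_mono) (auto simp: rate_def)
      moreover have "sqrt (sqrt (1 / D)) \<le> rate D" by (simp add: rate_def)
      ultimately show "B * sqrt (C / D) + sqrt (sqrt (1 / D)) \<le> (B * sqrt C + 1) * rate D"
        unfolding e distrib_right by linarith
    qed (use ell[OF t] in simp)
    also have "\<dots> = c * rate D" by (simp add: c_def)
    finally show ?thesis using int by blast
  qed
  show ?thesis by (rule mean_orderI[where c = c]) (use main in blast)+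
qed

definition cross :: "nat \<Rightarrow> (nat \<Rightarrow> nat \<Rightarrow> real) \<Rightarrow> (nat \<times> nat \<Rightarrow> nat \<Rightarrow> real) \<Rightarrow> nat \<Rightarrow> nat \<Rightarrow> nat \<Rightarrow> real" where
  "cross D x u t a l =
     (\<Sum>d=1..D. pd1 (pd2 (w t)) (x (t - 1) d, x t d) * (U u (t - 1) d a * U u t d l)) / D"

definition cubic :: "nat \<Rightarrow> (nat \<times> nat \<Rightarrow> nat \<Rightarrow> real) \<Rightarrow> nat \<Rightarrow> nat \<Rightarrow> real" where
  "cubic D u t n = (\<Sum>d=1..D. \<bar>sqrt (ell t / D) * U u t d n\<bar> ^ 3)"

text \<open>Since \<open>t \<ge> 2\<close>, the two increments belong to distinct times and are
  independent, so their product has second moment 1. For \<open>d \<noteq> e\<close> four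
  independent centred factors meet, which gives orthogonality; there is no drift to
  subtract.\<close>

lemma cross_bound:
  assumes t: "t \<in> {2..T}" and a: "a \<in> {1..N}" and l: "l \<in> {1..N}" and D: "1 \<le> D"
    and g: "\<And>d. d \<in> {1..D} \<Longrightarrow> \<bar>g d\<bar> \<le> B"
  shows "integrable (noise D) (\<lambda>u. (\<Sum>d=1..D. g d * (u (t - 1, d) a * u (t, d) l)) / D)"
    "(\<integral>u. \<bar>(\<Sum>d=1..D. g d * (u (t - 1, d) a * u (t, d) l)) / D\<bar> \<partial>noise D) \<le> B * sqrt (1 / D)"
proof -
  interpret P: prob_space "noise D" by (rule prob_space_noise)
  have mem: "(t - 1, d) \<in> {1..T} \<times> {1..D}" "(t, d) \<in> {1..T} \<times> {1..D}" if "d \<in> {1..D}" for d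
    using t that by auto
  have h: "(\<lambda>u. u (t - 1, d) a * u (t, d) l) \<in> borel_measurable (noise D)"
    "integrable (noise D) (\<lambda>u. (u (t - 1, d) a * u (t, d) l)\<^sup>2)"
    "P.expectation (\<lambda>u. (u (t - 1, d) a * u (t, d) l)\<^sup>2) \<le> 1" if d: "d \<in> {1..D}" for d
  proof -
    have ne: "(t - 1, d) \<noteq> (t, d)" using t by auto
    show "(\<lambda>u. u (t - 1, d) a * u (t, d) l) \<in> borel_measurable (noise D)"
      by (intro borel_measurable_times noise_borel mem d a l)
    show "integrable (noise D) (\<lambda>u. (u (t - 1, d) a * u (t, d) l)\<^sup>2)"
      "P.expectation (\<lambda>u. (u (t - 1, d) a * u (t, d) l)\<^sup>2) \<le> 1"
      using noise_two_components[OF mem[OF d] ne nu_facts(4)[OF a, of 2] nu_facts(4)[OF l, of 2]]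
        nu_facts(7)[OF a] nu_facts(7)[OF l]
      by (simp_all add: power_mult_distrib)
  qed
  have orth: "P.expectation (\<lambda>u. u (t - 1, d) a * u (t, d) l * (u (t - 1, e) a * u (t, e) l)) = 0"
    if d: "d \<in> {1..D}" and e: "e \<in> {1..D}" and de: "d \<noteq> e" for d e
  proof -
    \<comment> \<open>The time of a noise coordinate decides which particle is read off:
      \<open>l\<close> at time \<open>t\<close> and \<open>a\<close> at time \<open>t - 1\<close>.
      This writes the fourfold product as a product over distinct coordinates.\<close>
    define f where "f j v = (if fst j = t then v l else v a)" for j :: "nat \<times> nat" and v :: "nat \<Rightarrow> real"
    let ?S = "{(t - 1, d), (t, d), (t - 1, e), (t, e)}"
    have f: "integrable nu (f j)" for j
      unfolding f_def using nu_facts(5)[OF a] nu_facts(5)[OF l] by (cases "fst j = t") simp_all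
    have f0: "(\<integral>v. f j v \<partial>nu) = 0" for j
      unfolding f_def using nu_facts(6)[OF a] nu_facts(6)[OF l] by (cases "fst j = t") simp_all
    have "(\<integral>u. (\<Prod>j\<in>?S. f j (u j)) \<partial>noise D) = (\<Prod>j\<in>?S. \<integral>v. f j v \<partial>nu)"
      unfolding noise_def
      by (rule PiM_integral_prod[OF prob_space_nu _ _ f]) (use mem[OF d] mem[OF e] in auto)
    also have "\<dots> = 0" using f0 by (simp add: card_gt_0_iff)
    also have "(\<lambda>u. \<Prod>j\<in>?S. f j (u j)) = (\<lambda>u. u (t - 1, d) a * u (t, d) l * (u (t - 1, e) a * u (t, e) l))"
      using t de by (auto simp: fun_eq_iff f_def mult_ac)
    finally show ?thesis .
  qed
  show "integrable (noise D) (\<lambda>u. (\<Sum>d=1..D. g d * (u (t - 1, d) a * u (t, d) l)) / D)"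
    "(\<integral>u. \<bar>(\<Sum>d=1..D. g d * (u (t - 1, d) a * u (t, d) l)) / D\<bar> \<partial>noise D) \<le> B * sqrt (1 / D)"
    using P.orthogonal_average_bound[where X = "\<lambda>d u. u (t - 1, d) a * u (t, d) l" and c = g, OF h orth g _ D]
    by auto
qed

lemma mean_order_cross:
  assumes t: "t \<in> {1..T}" and a: "a \<le> N" and l: "l \<le> N"
  shows "mean_order rate (\<lambda>D x u. cross D x u t a l)" (is "mean_order _ ?X")
proof (cases "t = 1 \<or> a = 0 \<or> l = 0")
  case True
  then have "?X = (\<lambda>_ _ _. 0)" by (auto simp: cross_def U_def)
  then show ?thesis by (simp only: mean_order_zero)
next
  case False
  then have *: "t \<in> {2..T}" "a \<in> {1..N}" "l \<in> {1..N}" using t a l by auto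
  obtain B where B: "\<And>z. \<bar>pd1 (pd2 (w t)) z\<bar> \<le> B"
    using lipschitz_boundedE[OF second_order(3)[OF t]] by metis
  have B0: "0 \<le> B" using B[of undefined] by linarith
  have X: "?X = (\<lambda>D x u. (\<Sum>d=1..D. pd1 (pd2 (w t)) (x (t - 1) d, x t d) * (u (t - 1, d) a * u (t, d) l)) / D)"
    using * by (auto simp: fun_eq_iff cross_def U_def)
  show ?thesis unfolding X
  proof (rule mean_orderI[where c = B])
    fix D :: nat and x assume D: "1 \<le> D"
    show "integrable (noise D) (\<lambda>u. (\<Sum>d=1..D. pd1 (pd2 (w t)) (x (t - 1) d, x t d) * (u (t - 1, d) a * u (t, d) l)) / D)"
      by (rule cross_bound(1)[OF * D B])
    have "B * sqrt (1 / D) \<le> B * rate D" using B0 by (intro mult_left_mono) (auto simp: rate_def)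
    with cross_bound(2)[OF * D B]
    show "(\<integral>u. \<bar>(\<Sum>d=1..D. pd1 (pd2 (w t)) (x (t - 1) d, x t d) * (u (t - 1, d) a * u (t, d) l)) / D\<bar> \<partial>noise D) \<le> B * rate D"
      by (rule order_trans)
  qed
qed

text \<open>There are \<open>D\<close> terms, each of mean order D^(-3/2), which leaves
  D^(-1/2).\<close>

lemma mean_order_cubic:
  assumes t: "t \<le> T" and n: "n \<le> N"
  shows "mean_order rate (\<lambda>D x u. cubic D u t n)"
proof (cases "t = 0 \<or> n = 0")
  case True
  then show ?thesis using mean_order_zero by (auto simp: cubic_def U_def)
next
  case False
  then have tn: "t \<in> {1..T}" "n \<in> {1..N}" using t n by auto
  define c where "c = sqrt (ell t) ^ 3 * (\<integral>v. \<bar>v n\<bar> ^ 3 \<partial>nu)"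
  have i3: "integrable nu (\<lambda>v. \<bar>v n\<bar> ^ 3)" using nu_facts(3)[OF tn(2), of 3] by simp
  have c0: "0 \<le> c" unfolding c_def using ell[OF tn(1)] by (intro mult_nonneg_nonneg integral_nonneg_AE) auto
  have eq: "cubic D u t n = (\<Sum>d=1..D. sqrt (ell t / D) ^ 3 * \<bar>u (t, d) n\<bar> ^ 3)" for D u
    using False ell[OF tn(1)] by (simp add: cubic_def U_def abs_mult power_mult_distrib)
  have comp: "integrable (noise D) (\<lambda>u. \<bar>u (t, d) n\<bar> ^ 3)"
    "(\<integral>u. \<bar>u (t, d) n\<bar> ^ 3 \<partial>noise D) = (\<integral>v. \<bar>v n\<bar> ^ 3 \<partial>nu)" if "d \<in> {1..D}" for d D
    using noise_component[of "(t, d)" D, OF _ i3] tn that by auto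
  show ?thesis
  proof (rule mean_orderI[where c = c])
    fix D :: nat
    show "integrable (noise D) (\<lambda>u. cubic D u t n)"
      unfolding eq using comp(1) by (intro Bochner_Integration.integrable_sum integrable_mult_right)
    have "(\<integral>u. cubic D u t n \<partial>noise D)
      = (\<Sum>d=1..D. sqrt (ell t / D) ^ 3 * (\<integral>u. \<bar>u (t, d) n\<bar> ^ 3 \<partial>noise D))"
      unfolding eq using comp(1) by (subst Bochner_Integration.integral_sum) auto
    also have "\<dots> = D * (sqrt (ell t / D) ^ 3 * (\<integral>v. \<bar>v n\<bar> ^ 3 \<partial>nu))"
      using comp(2) by simp
    also have "\<dots> = c * (real D * (sqrt (1 / D)) ^ 3)"
      by (simp add: c_def real_sqrt_divide power_divide)
    also have "\<dots> \<le> c * rate D"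
    proof (rule mult_left_mono[OF _ c0])
      have "real D * (sqrt (1 / D)) ^ 3 = real D * (sqrt (1 / D))\<^sup>2 * sqrt (1 / D)"
        by (simp add: power3_eq_cube power2_eq_square mult_ac)
      also have "\<dots> \<le> sqrt (1 / D)" by simp
      also have "\<dots> \<le> rate D" by (simp add: rate_def)
      finally show "real D * (sqrt (1 / D)) ^ 3 \<le> rate D" .
    qed
    finally show "(\<integral>u. \<bar>cubic D u t n\<bar> \<partial>noise D) \<le> c * rate D"
      by (simp add: cubic_def sum_nonneg)
  qed
qed

definition log_ratio ::
  "nat \<Rightarrow> (nat \<Rightarrow> nat \<Rightarrow> real) \<Rightarrow> (nat \<times> nat \<Rightarrow> nat \<Rightarrow> real) \<Rightarrow> nat \<times> nat \<times> nat \<Rightarrow> real" where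
  "log_ratio D x u = (\<lambda>(t, a, l). \<Sum>d=1..D.
     w t (particles ell D x u (t - 1) a d, particles ell D x u t l d)
     - w t (particles ell D x u (t - 1) 0 d, particles ell D x u t 0 d))"

text \<open>The first-order part of the log-weights, recentred at the limiting mean of the second-order
  part: block \<open>i\<close> stands for \<open>V\<^bsub>t\<^esub>\<close> or \<open>W\<^bsub>t\<^esub>\<close>, as in \<^const>\<open>VW_law\<close>.\<close>

definition lin_part ::
  "nat \<Rightarrow> (nat \<Rightarrow> nat \<Rightarrow> real) \<Rightarrow> (nat \<times> nat \<Rightarrow> nat \<Rightarrow> real) \<Rightarrow> nat \<Rightarrow> nat \<times> nat \<Rightarrow> real" where
  "lin_part D x u t = (\<lambda>(i, n). sqrt (ell t / D) *
     (\<Sum>d=1..D. dwbar FK T t i (x (t + i - 1) d, x (t + i) d) * u (t, d) n) + ell t / 2 * mean2 t i)"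

text \<open>The same linear map is applied to the limiting vectors and to \<open>lin_part\<close>;
  weak convergence of the latter thus passes to the log-weights.\<close>

definition limit_ratio :: "(nat \<Rightarrow> nat \<times> nat \<Rightarrow> real) \<Rightarrow> nat \<times> nat \<times> nat \<Rightarrow> real" where
  "limit_ratio v = (\<lambda>(t, a, l). V_part v t l + W_part v (t - 1) a)"

lemma log_ratio_eq:
  assumes t: "t \<in> {1..T}"
  shows "log_ratio D x u (t, a, l) = (\<Sum>d=1..D.
     w t (x (t - 1) d + sqrt (ell (t - 1) / D) * U u (t - 1) d a, x t d + sqrt (ell t / D) * U u t d l)
     - w t (x (t - 1) d, x t d))"
proof -
  have Z: "particles ell D x u s n d = x s d + sqrt (ell s / D) * U u s d n" if "s \<noteq> 0" for s n d
    using that by (simp add: particles_def U_def)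
  have "w t (particles ell D x u (t - 1) a d, y) = w t (x (t - 1) d + sqrt (ell (t - 1) / D) * U u (t - 1) d a, y)"
    for d y
  proof (cases "t = 1")
    case True
    show ?thesis unfolding True by (rule first_freeD[OF wbar_first_free])
  next
    case False
    then show ?thesis using t by (subst Z) auto
  qed
  moreover have "particles ell D x u s 0 d = x s d" for s d by (simp add: particles_def)
  moreover have "particles ell D x u t l d = x t d + sqrt (ell t / D) * U u t d l" for d
    using t by (intro Z) auto
  ultimately show ?thesis by (simp add: log_ratio_def)
qed

lemma log_ratio_borel:
  assumes t: "t \<in> {1..T}" and a: "a \<le> N" and l: "l \<le> N"
  shows "(\<lambda>u. log_ratio D x u (t, a, l)) \<in> borel_measurable (noise D)"
  unfolding log_ratio_eq[OF t] using t
  by (intro borel_measurable_sum borel_measurable_diff borel_measurable_const borel_measurable_add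
      borel_measurable_times U_borel a l
      continuous_real_pair_borel[OF twice_cont_diff_continuous[OF smooth[OF t]]]) auto

lemma lin_part_borel:
  assumes t: "t \<in> {1..T}" and p: "p \<in> {0, 1} \<times> {1..N}"
  shows "(\<lambda>u. lin_part D x u t p) \<in> borel_measurable (noise D)"
proof -
  obtain i n where p: "p = (i, n)" and n: "n \<in> {1..N}" using p by blast
  show ?thesis unfolding p lin_part_def prod.case using t
    by (intro borel_measurable_sum borel_measurable_const borel_measurable_add
        borel_measurable_times noise_borel n) auto
qed

definition I2 :: "(nat \<times> nat \<times> nat) set" where
  "I2 = {1..T} \<times> {0..N} \<times> {0..N}"

text \<open>Each component is a sum of at most two coordinates, because the conventions for index 0
  and time 0 drop terms. Any property that holds for zero and for coordinates and is preserved by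
  addition is inherited; measurability, integrability, continuity and orders in mean are all
  obtained in this way.\<close>

lemma limit_ratio_induct:
  assumes k: "k \<in> I2" and zero: "P (\<lambda>_. 0)"
    and coord: "\<And>t p. t \<in> {1..T} \<Longrightarrow> p \<in> {0, 1} \<times> {1..N} \<Longrightarrow> P (\<lambda>v. v t p)"
    and add: "\<And>f g. P f \<Longrightarrow> P g \<Longrightarrow> P (\<lambda>v. f v + g v)"
  shows "P (\<lambda>v. limit_ratio v k)"
proof -
  obtain t a l where kk: "k = (t, a, l)" and t: "t \<in> {1..T}" and al: "a \<le> N" "l \<le> N"
    using k by (auto simp: I2_def)
  have "P (\<lambda>v. V_part v t l)"
  proof (cases "l = 0")
    case False
    then show ?thesis using coord[OF t, of "(0, l)"] al by (simp add: V_part_def)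
  qed (simp add: V_part_def zero)
  moreover have "P (\<lambda>v. W_part v (t - 1) a)"
  proof (cases "t - 1 = 0 \<or> a = 0")
    case True
    then have "(\<lambda>v. W_part v (t - 1) a) = (\<lambda>_. 0)" by (auto simp: W_part_def)
    then show ?thesis by (simp only: zero)
  next
    case False
    then have "t - 1 \<in> {1..T}" "(1, a) \<in> {0, 1} \<times> {1..N}" using t al by auto
    from coord[OF this] show ?thesis using False by (simp add: W_part_def)
  qed
  ultimately show ?thesis unfolding kk limit_ratio_def prod.case by (rule add)
qed

lemma limit_ratio_lin_part_borel:
  assumes "k \<in> I2"
  shows "(\<lambda>u. limit_ratio (lin_part D x u) k) \<in> borel_measurable (noise D)"
  by (rule limit_ratio_induct[OF assms, of "\<lambda>f. (\<lambda>u. f (lin_part D x u)) \<in> borel_measurable (noise D)"])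
    (intro borel_measurable_const lin_part_borel borel_measurable_add; assumption)+

text \<open>The Taylor expansion is summed over the coordinates, with \<open>p d\<close> and
  \<open>q d\<close> the scaled increments of the earlier and the later state. The constant depends
  on \<open>t\<close> alone; the factor 4 comes from splitting the cube of a sum.\<close>

lemma remainder_decomposition:
  assumes t: "t \<in> {1..T}"
  obtains L where "\<And>D x u a l. 1 \<le> D \<Longrightarrow>
    \<bar>log_ratio D x u (t, a, l) - limit_ratio (lin_part D x u) (t, a, l)\<bar>
    \<le> \<bar>quad D x u t 0 l\<bar> + (if t = 1 then 0 else \<bar>quad D x u (t - 1) 1 a\<bar>)
      + sqrt (ell (t - 1) * ell t) * \<bar>cross D x u t a l\<bar>
      + 4 * L * (cubic D u (t - 1) a + cubic D u t l)"
proof -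
  obtain L where L0: "0 \<le> L" and L: "\<And>x y a b. \<bar>w t (x + a, y + b) - w t (x, y) - pd1 (w t) (x, y) * a - pd2 (w t) (x, y) * b
     - pd1 (pd1 (w t)) (x, y) / 2 * a\<^sup>2 - pd2 (pd2 (w t)) (x, y) / 2 * b\<^sup>2 - pd1 (pd2 (w t)) (x, y) * a * b\<bar>
    \<le> L * (\<bar>a\<bar> + \<bar>b\<bar>) ^ 3" by (rule Taylor_wbar[OF t]) blast
  have "\<bar>log_ratio D x u (t, a, l) - limit_ratio (lin_part D x u) (t, a, l)\<bar>
    \<le> \<bar>quad D x u t 0 l\<bar> + (if t = 1 then 0 else \<bar>quad D x u (t - 1) 1 a\<bar>)
      + sqrt (ell (t - 1) * ell t) * \<bar>cross D x u t a l\<bar>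
      + 4 * L * (cubic D u (t - 1) a + cubic D u t l)"
    if D: "1 \<le> D" for D x u a l
  proof -
    define p q where "p d = sqrt (ell (t - 1) / D) * U u (t - 1) d a" and "q d = sqrt (ell t / D) * U u t d l" for d
    define z where "z d = (x (t - 1) d, x t d)" for d
    define R where "R d = w t (x (t - 1) d + p d, x t d + q d) - w t (z d) - pd1 (w t) (z d) * p d - pd2 (w t) (z d) * q d
     - pd1 (pd1 (w t)) (z d) / 2 * (p d)\<^sup>2 - pd2 (pd2 (w t)) (z d) / 2 * (q d)\<^sup>2 - pd1 (pd2 (w t)) (z d) * p d * q d" for d
    have R: "\<bar>R d\<bar> \<le> 4 * L * (\<bar>p d\<bar> ^ 3 + \<bar>q d\<bar> ^ 3)" for d
    proof -
      have "\<bar>R d\<bar> \<le> L * (\<bar>p d\<bar> + \<bar>q d\<bar>) ^ 3" unfolding R_def z_def by (rule L)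
      also have "\<dots> \<le> L * (4 * (\<bar>p d\<bar> ^ 3 + \<bar>q d\<bar> ^ 3))"
        by (intro mult_left_mono power3_add_le L0) auto
      finally show ?thesis by (simp only: mult_ac)
    qed
    have ellt: "0 < ell t" by (rule ell[OF t])
    have "log_ratio D x u (t, a, l) = (\<Sum>d=1..D. pd1 (w t) (z d) * p d + pd2 (w t) (z d) * q d
        + pd1 (pd1 (w t)) (z d) / 2 * (p d)\<^sup>2 + pd2 (pd2 (w t)) (z d) / 2 * (q d)\<^sup>2
        + pd1 (pd2 (w t)) (z d) * p d * q d + R d)"
      unfolding log_ratio_eq[OF t] by (intro sum.cong refl) (simp add: R_def p_def q_def z_def)
    also have "\<dots> = ((\<Sum>d=1..D. pd1 (w t) (z d) * p d) + (\<Sum>d=1..D. pd1 (pd1 (w t)) (z d) / 2 * (p d)\<^sup>2))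
       + ((\<Sum>d=1..D. pd2 (w t) (z d) * q d) + (\<Sum>d=1..D. pd2 (pd2 (w t)) (z d) / 2 * (q d)\<^sup>2))
       + (\<Sum>d=1..D. pd1 (pd2 (w t)) (z d) * p d * q d) + (\<Sum>d=1..D. R d)"
      by (simp add: sum.distrib)
    \<comment> \<open>The limiting drift is added to the linear term, where it completes
      \<open>lin_part\<close>, and subtracted from the quadratic one, where it centres
      \<open>quad\<close>.\<close>
    also have "(\<Sum>d=1..D. pd2 (w t) (z d) * q d) + (\<Sum>d=1..D. pd2 (pd2 (w t)) (z d) / 2 * (q d)\<^sup>2)
      = V_part (lin_part D x u) t l + quad D x u t 0 l"
    proof -
      have 1: "(\<Sum>d=1..D. pd2 (w t) (z d) * q d) = sqrt (ell t / D) * (\<Sum>d=1..D. pd2 (w t) (z d) * U u t d l)"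
        by (simp add: q_def sum_distrib_left mult_ac)
      have 2: "(\<Sum>d=1..D. pd2 (pd2 (w t)) (z d) / 2 * (q d)\<^sup>2)
        = ell t / 2 * ((\<Sum>d=1..D. pd2 (pd2 (w t)) (z d) * (U u t d l)\<^sup>2) / D)"
        using ellt by (simp add: q_def power_mult_distrib sum_distrib_left sum_divide_distrib mult_ac)
      show ?thesis
      proof (cases "l = 0")
        case False
        then have "U u t d l = u (t, d) l" for d using t by (simp add: U_def)
        then show ?thesis unfolding 1 2 using False
          by (simp add: V_part_def lin_part_def quad_def dwbar_def ddwbar_def z_def right_diff_distrib)
      qed (unfold 1 2, simp add: V_part_def quad_def U_def)
    qed
    also have "(\<Sum>d=1..D. pd1 (w t) (z d) * p d) + (\<Sum>d=1..D. pd1 (pd1 (w t)) (z d) / 2 * (p d)\<^sup>2)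
      = W_part (lin_part D x u) (t - 1) a + (if t = 1 then 0 else quad D x u (t - 1) 1 a)"
    proof (cases "t = 1")
      case True
      then show ?thesis by (simp add: p_def U_def W_part_def)
    next
      case t1: False
      then have t': "t - 1 \<in> {1..T}" "t - 1 \<noteq> 0" "t - 1 + 1 = t" using t by auto
      have 1: "(\<Sum>d=1..D. pd1 (w t) (z d) * p d) = sqrt (ell (t - 1) / D) * (\<Sum>d=1..D. pd1 (w t) (z d) * U u (t - 1) d a)"
        by (simp add: p_def sum_distrib_left mult_ac)
      have 2: "(\<Sum>d=1..D. pd1 (pd1 (w t)) (z d) / 2 * (p d)\<^sup>2)
        = ell (t - 1) / 2 * ((\<Sum>d=1..D. pd1 (pd1 (w t)) (z d) * (U u (t - 1) d a)\<^sup>2) / D)"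
        using ell[OF t'(1)] by (simp add: p_def power_mult_distrib sum_distrib_left sum_divide_distrib mult_ac)
      have e: "dwbar FK T (t - 1) 1 = pd1 (w t)" "ddwbar FK T (t - 1) 1 = pd1 (pd1 (w t))"
        unfolding dwbar_def ddwbar_def t'(3) by simp_all
      show ?thesis
      proof (cases "a = 0")
        case False
        then have U: "U u (t - 1) d a = u (t - 1, d) a" for d using t'(2) by (simp add: U_def)
        have "W_part (lin_part D x u) (t - 1) a
          = sqrt (ell (t - 1) / D) * (\<Sum>d=1..D. pd1 (w t) (z d) * u (t - 1, d) a) + ell (t - 1) / 2 * mean2 (t - 1) 1"
          unfolding W_part_def lin_part_def prod.case e t'(3) z_def using False t'(2) by simp
        moreover have "quad D x u (t - 1) 1 a
          = ell (t - 1) / 2 * ((\<Sum>d=1..D. pd1 (pd1 (w t)) (z d) * (u (t - 1, d) a)\<^sup>2) / D - mean2 (t - 1) 1)"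
          unfolding quad_def e t'(3) z_def U using False by simp
        ultimately show ?thesis unfolding 1 2 U using t1 by (simp add: right_diff_distrib)
      qed (unfold 1 2, simp add: W_part_def quad_def U_def)
    qed
    also have "(\<Sum>d=1..D. pd1 (pd2 (w t)) (z d) * p d * q d)
      = sqrt (ell (t - 1) * ell t) * cross D x u t a l"
    proof -
      have ss: "sqrt (ell (t - 1) / D) * sqrt (ell t / D) = sqrt (ell (t - 1) * ell t) / D"
        using D by (simp add: real_sqrt_mult real_sqrt_divide)
      have "pd1 (pd2 (w t)) (z d) * p d * q d
          = (sqrt (ell (t - 1) / D) * sqrt (ell t / D)) * (pd1 (pd2 (w t)) (z d) * (U u (t - 1) d a * U u t d l))" for d
        unfolding p_def q_def by (simp only: mult_ac)
      then have "pd1 (pd2 (w t)) (z d) * p d * q d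
          = sqrt (ell (t - 1) * ell t) / D * (pd1 (pd2 (w t)) (z d) * (U u (t - 1) d a * U u t d l))" for d
        unfolding ss .
      then show ?thesis by (simp add: cross_def z_def sum_distrib_left[symmetric] sum_divide_distrib[symmetric])
    qed
    finally have eq: "log_ratio D x u (t, a, l) - limit_ratio (lin_part D x u) (t, a, l)
      = quad D x u t 0 l + (if t = 1 then 0 else quad D x u (t - 1) 1 a)
        + sqrt (ell (t - 1) * ell t) * cross D x u t a l
        + (\<Sum>d=1..D. R d)"
      by (simp add: limit_ratio_def)
    have "\<bar>\<Sum>d=1..D. R d\<bar> \<le> (\<Sum>d=1..D. 4 * L * (\<bar>p d\<bar> ^ 3 + \<bar>q d\<bar> ^ 3))"
      using R by (intro order_trans[OF sum_abs] sum_mono)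
    also have "\<dots> = 4 * L * (cubic D u (t - 1) a + cubic D u t l)"
      by (simp add: cubic_def p_def q_def sum_distrib_left sum.distrib distrib_left)
    finally have RR: "\<bar>\<Sum>d=1..D. R d\<bar> \<le> 4 * L * (cubic D u (t - 1) a + cubic D u t l)" .
    have tri: "\<bar>A + B + s * C + E\<bar> \<le> \<bar>A\<bar> + \<bar>B\<bar> + \<bar>s\<bar> * \<bar>C\<bar> + \<bar>E\<bar>" for A B s C E :: real
      unfolding abs_mult[symmetric] by linarith
    \<comment> \<open>Nothing is known about the sign of \<open>ell 0\<close>, and
      \<open>sqrt\<close> of a negative number is negative. At \<open>t = 1\<close> the mixed term
      is zero anyway, because increments at time 0 vanish.\<close>
    have ell': "0 \<le> ell (t - 1) * ell t \<or> (\<forall>d. U u (t - 1) d a = 0)"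
    proof (cases "t = 1")
      case True
      then show ?thesis by (simp add: U_def)
    next
      case False
      then have "t - 1 \<in> {1..T}" using t by auto
      then show ?thesis using ell[OF t] ell[of "t - 1"] by (simp add: less_imp_le)
    qed
    have "\<bar>log_ratio D x u (t, a, l) - limit_ratio (lin_part D x u) (t, a, l)\<bar>
      \<le> \<bar>quad D x u t 0 l\<bar> + \<bar>if t = 1 then 0 else quad D x u (t - 1) 1 a\<bar>
        + \<bar>sqrt (ell (t - 1) * ell t)\<bar> * \<bar>cross D x u t a l\<bar>
        + \<bar>\<Sum>d=1..D. R d\<bar>"
      unfolding eq by (rule tri)
    also have "\<bar>if t = 1 then 0 else quad D x u (t - 1) 1 a\<bar> = (if t = 1 then 0 else \<bar>quad D x u (t - 1) 1 a\<bar>)"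
      by simp
    also have "\<bar>sqrt (ell (t - 1) * ell t)\<bar> * \<bar>cross D x u t a l\<bar>
      = sqrt (ell (t - 1) * ell t) * \<bar>cross D x u t a l\<bar>"
      using ell' by (auto simp: cross_def)
    finally show ?thesis using RR by linarith
  qed
  then show ?thesis using that by blast
qed

lemma mean_order_remainder:
  assumes k: "k \<in> I2"
  shows "mean_order rate (\<lambda>D x u. log_ratio D x u k - limit_ratio (lin_part D x u) k)"
proof -
  obtain t a l where kk: "k = (t, a, l)" and t: "t \<in> {1..T}" and a: "a \<le> N" and l: "l \<le> N"
    using k by (auto simp: I2_def)
  have q: "mean_order rate (\<lambda>D x u. if t = 1 then 0 else \<bar>quad D x u (t - 1) 1 a\<bar>)"
  proof (cases "t = 1")
    case False
    then have "t - 1 \<in> {1..T}" using t by auto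
    from mean_order_abs[OF mean_order_quad[OF this _ a, of 1]] show ?thesis using False by simp
  qed (simp add: mean_order_zero)
  have tT: "t \<le> T" "t - 1 \<le> T" using t by auto
  show ?thesis unfolding kk
  proof (rule remainder_decomposition[OF t])
    fix L assume dec: "\<And>D x u a l. 1 \<le> D \<Longrightarrow>
      \<bar>log_ratio D x u (t, a, l) - limit_ratio (lin_part D x u) (t, a, l)\<bar>
      \<le> \<bar>quad D x u t 0 l\<bar> + (if t = 1 then 0 else \<bar>quad D x u (t - 1) 1 a\<bar>)
        + sqrt (ell (t - 1) * ell t) * \<bar>cross D x u t a l\<bar>
        + 4 * L * (cubic D u (t - 1) a + cubic D u t l)"
    show "mean_order rate (\<lambda>D x u. log_ratio D x u (t, a, l) - limit_ratio (lin_part D x u) (t, a, l))"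
    proof (rule mean_order_dominated[OF _ _ dec])
      show "mean_order rate (\<lambda>D x u. \<bar>quad D x u t 0 l\<bar> + (if t = 1 then 0 else \<bar>quad D x u (t - 1) 1 a\<bar>)
        + sqrt (ell (t - 1) * ell t) * \<bar>cross D x u t a l\<bar>
        + 4 * L * (cubic D u (t - 1) a + cubic D u t l))"
        by (intro mean_order_add mean_order_cmult mean_order_abs mean_order_cross[OF t a l] q
            mean_order_quad[OF t _ l] mean_order_cubic[OF tT(1) l] mean_order_cubic[OF tT(2) a] insertI1)
      show "(\<lambda>u. log_ratio D x u (t, a, l) - limit_ratio (lin_part D x u) (t, a, l)) \<in> borel_measurable (noise D)" for D x
        by (intro borel_measurable_diff log_ratio_borel t a l limit_ratio_lin_part_borel k[unfolded kk])
    qed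
  qed
qed

end

section \<open>Convergence of the log-weights\<close>

text \<open>For each \<open>D\<close> choose a point whose value is within \<open>1 / Suc n\<close>
  of the supremum; the values along this single sequence bound the suprema. The upper bound
  \<open>B\<close> makes the real suprema meaningful.\<close>

lemma SUP_tendsto_0_from_sequences:
  fixes a :: "nat \<Rightarrow> 'x \<Rightarrow> real"
  assumes ne: "\<forall>\<^sub>F D in sequentially. F D \<noteq> {}"
    and a0: "\<And>D x. 0 \<le> a D x" and aB: "\<And>D x. a D x \<le> B"
    and seq: "\<And>dd x. (\<And>n. 1 \<le> dd n) \<Longrightarrow> filterlim dd at_top sequentially \<Longrightarrow> (\<And>n. x n \<in> F (dd n))
      \<Longrightarrow> (\<lambda>n. a (dd n) (x n)) \<longlonglongrightarrow> 0"
  shows "(\<lambda>D. SUP x\<in>F D. a D x) \<longlonglongrightarrow> 0"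
proof -
  obtain D0 where D0: "\<And>D. D0 \<le> D \<Longrightarrow> F D \<noteq> {}" using ne unfolding eventually_sequentially by blast
  \<comment> \<open>The shift guarantees both a nonempty set and dimension at least 1.\<close>
  define dd where "dd n = n + Suc D0" for n
  have ne': "F (dd n) \<noteq> {}" for n by (rule D0) (simp add: dd_def)
  have bdd: "bdd_above (a D ` F D)" for D using aB by (intro bdd_aboveI2[of _ _ B])
  have "\<exists>y. y \<in> F (dd n) \<and> (SUP x\<in>F (dd n). a (dd n) x) - 1 / Suc n < a (dd n) y" for n
  proof -
    have "(SUP x\<in>F (dd n). a (dd n) x) - 1 / Suc n < (SUP x\<in>F (dd n). a (dd n) x)" by simp
    then show ?thesis using less_cSUP_iff[OF ne' bdd] by blast
  qed
  then obtain x where x: "\<And>n. x n \<in> F (dd n)"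
    "\<And>n. (SUP x\<in>F (dd n). a (dd n) x) - 1 / Suc n < a (dd n) (x n)" by metis
  have "filterlim (\<lambda>n. n + Suc D0) at_top sequentially" by (rule filterlim_add_const_nat_at_top)
  then have "(\<lambda>n. a (dd n) (x n)) \<longlonglongrightarrow> 0"
    by (intro seq x(1)) (simp_all add: dd_def)
  moreover have "(\<lambda>n. 1 / real (Suc n)) \<longlonglongrightarrow> 0" by (rule LIMSEQ_Suc[OF lim_1_over_n])
  ultimately have up: "(\<lambda>n. a (dd n) (x n) + 1 / real (Suc n)) \<longlonglongrightarrow> 0" by (rule tendsto_add_zero)
  have "(\<lambda>n. SUP x\<in>F (dd n). a (dd n) x) \<longlonglongrightarrow> 0"
  proof (rule tendsto_sandwich[OF _ _ tendsto_const up])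
    have "0 \<le> (SUP x\<in>F (dd n). a (dd n) x)" for n
      using cSUP_upper[OF x(1) bdd, of n] a0[of "dd n" "x n"] by linarith
    then show "\<forall>\<^sub>F n in sequentially. 0 \<le> (SUP x\<in>F (dd n). a (dd n) x)" by simp
    have "(SUP x\<in>F (dd n). a (dd n) x) \<le> a (dd n) (x n) + 1 / real (Suc n)" for n
      using x(2)[of n] by linarith
    then show "\<forall>\<^sub>F n in sequentially. (SUP x\<in>F (dd n). a (dd n) x) \<le> a (dd n) (x n) + 1 / real (Suc n)"
      by simp
  qed
  then show ?thesis unfolding dd_def by (rule LIMSEQ_offset)
qed

text \<open>Relates two forms of one variance: the left side is per increment, with the coefficients
  of both blocks already added; the right side is the Kronecker form on pairs of block and particle
  in which the limiting covariance is given.\<close>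

lemma sum_over_pairs:
  fixes A :: "'i \<times> 'n \<Rightarrow> real"
  shows "(\<Sum>m\<in>S. \<Sum>n\<in>S. (\<Sum>i\<in>R. A (i, m)) * (\<Sum>j\<in>R. A (j, n)) * B m n)
    = (\<Sum>p\<in>R \<times> S. \<Sum>q\<in>R \<times> S. A p * A q * B (snd p) (snd q))"
proof -
  have pairs: "(\<Sum>p\<in>R \<times> S. f p) = (\<Sum>n\<in>S. \<Sum>i\<in>R. f (i, n))" for f :: "'i \<times> 'n \<Rightarrow> real"
  proof -
    have "(\<Sum>p\<in>R \<times> S. f p) = (\<Sum>i\<in>R. \<Sum>n\<in>S. f (i, n))" by (simp add: sum.cartesian_product)
    also have "\<dots> = (\<Sum>n\<in>S. \<Sum>i\<in>R. f (i, n))" by (rule sum.swap)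
    finally show ?thesis .
  qed
  have "(\<Sum>p\<in>R \<times> S. \<Sum>q\<in>R \<times> S. A p * A q * B (snd p) (snd q))
    = (\<Sum>m\<in>S. \<Sum>i\<in>R. \<Sum>n\<in>S. \<Sum>j\<in>R. A (i, m) * A (j, n) * B m n)"
    by (simp add: pairs)
  also have "\<dots> = (\<Sum>m\<in>S. \<Sum>n\<in>S. \<Sum>i\<in>R. \<Sum>j\<in>R. A (i, m) * A (j, n) * B m n)"
    by (rule sum.cong[OF refl], rule sum.swap)
  also have "\<dots> = (\<Sum>m\<in>S. \<Sum>n\<in>S. (\<Sum>i\<in>R. A (i, m)) * (\<Sum>j\<in>R. A (j, n)) * B m n)"
    unfolding sum_distrib_right[symmetric] sum_product[symmetric] ..
  finally show ?thesis ..
qed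

lemma abs_cos_diff_le: "\<bar>cos x - cos y\<bar> \<le> \<bar>x - y\<bar>" for x y :: real
proof -
  have "\<bar>cos x - cos y\<bar> = 2 * \<bar>sin ((x + y) / 2)\<bar> * \<bar>sin ((y - x) / 2)\<bar>"
    by (simp add: cos_diff_cos abs_mult)
  also have "\<dots> \<le> 2 * 1 * \<bar>(y - x) / 2\<bar>"
    by (intro mult_mono abs_sin_x_le_abs_x) (auto simp: abs_sin_le_one)
  finally show ?thesis by simp
qed

context csmc_setting
begin

section \<open>The limiting Gaussian vectors\<close>

definition cov :: "nat \<Rightarrow> nat \<Rightarrow> nat \<Rightarrow> real" where
  "cov t i j = ell t *
     (\<integral>x. on_path (t + i) (dwbar FK T t i) x * on_path (t + j) (dwbar FK T t j) x \<partial>pi_law FK T)"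

abbreviation "IN \<equiv> {0, 1} \<times> {1..N} :: (nat \<times> nat) set"

definition VW_mean :: "nat \<Rightarrow> nat \<times> nat \<Rightarrow> real" where
  "VW_mean t p = ell t / 2 * mean2 t (fst p)"

definition VW_cov :: "nat \<Rightarrow> nat \<times> nat \<Rightarrow> nat \<times> nat \<Rightarrow> real" where
  "VW_cov t p q = cov t (fst p) (fst q) * Sigma_mat (snd p) (snd q)"

lemma VW_law_eq: "VW_law FK T N ell t = mvnormal IN (VW_mean t) (VW_cov t)"
proof -
  have "(\<lambda>(i, n). ell t / 2 * (\<integral>x. on_path (t + i) (ddwbar FK T t i) x \<partial>pi_law FK T)) = VW_mean t"
    by (auto simp: VW_mean_def mean2_def fun_eq_iff)
  moreover have "(\<lambda>(i, m) (j, n). ell t *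
          (\<integral>x. on_path (t + i) (dwbar FK T t i) x * on_path (t + j) (dwbar FK T t j) x \<partial>pi_law FK T)
          * Sigma_mat m n) = VW_cov t"
    by (auto simp: VW_cov_def cov_def fun_eq_iff)
  ultimately show ?thesis unfolding VW_law_def by (simp only:)
qed

text \<open>The Cauchy-Schwarz inequality makes the 2 by 2 block positive semidefinite, and its
  Kronecker product with \<open>Sigma_mat\<close> then has a factor. Without this
  \<open>VW_law\<close> would be an unspecified law.\<close>

lemma VW_cov_factor:
  assumes t: "t \<in> {1..T}"
  shows "has_cov_factor IN (VW_cov t)"
proof -
  let ?f = "\<lambda>i. on_path (t + i) (dwbar FK T t i)"
  note m = dwbar_facts(1)[OF t, folded pi_law_borel_iff]
  note sq = dwbar_square_integrable[OF t]
  have "0 \<le> cov t i i" for i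
    unfolding cov_def using ell[OF t] by (intro mult_nonneg_nonneg integral_nonneg_AE) auto
  moreover have "cov t 0 1 = cov t 1 0" unfolding cov_def by (simp add: mult.commute)
  moreover have "(cov t 0 1)\<^sup>2 \<le> cov t 0 0 * cov t 1 1"
  proof -
    have "(\<integral>x. ?f 0 x * ?f 1 x \<partial>pi_law FK T)\<^sup>2
        \<le> (\<integral>x. (?f 0 x)\<^sup>2 \<partial>pi_law FK T) * (\<integral>x. (?f 1 x)\<^sup>2 \<partial>pi_law FK T)"
      by (intro Cauchy_Schwarz_integral m sq insertI1 insertI2)
    then have "(ell t)\<^sup>2 * (\<integral>x. ?f 0 x * ?f 1 x \<partial>pi_law FK T)\<^sup>2
        \<le> (ell t)\<^sup>2 * ((\<integral>x. (?f 0 x)\<^sup>2 \<partial>pi_law FK T) * (\<integral>x. (?f 1 x)\<^sup>2 \<partial>pi_law FK T))"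
      by (rule mult_left_mono) simp
    then show ?thesis unfolding cov_def by (simp add: power2_eq_square mult_ac)
  qed
  ultimately show ?thesis
    using Kronecker_Sigma_mat_factor[OF N, of "cov t"] unfolding has_cov_factor_def VW_cov_def by simp
qed

definition limit_noise :: "(nat \<Rightarrow> nat \<times> nat \<Rightarrow> real) measure" where
  "limit_noise = PiM {1..T} (VW_law FK T N ell)"

lemma limit_noise_eq: "limit_noise = PiM {1..T} (\<lambda>t. mvnormal IN (VW_mean t) (VW_cov t))"
  unfolding limit_noise_def by (rule PiM_cong) (simp_all add: VW_law_eq)

lemma prob_space_VW: "prob_space (mvnormal IN (VW_mean t) (VW_cov t))"
  by (rule prob_space_mvnormal) simp

lemma prob_space_limit_noise: "prob_space limit_noise"
  unfolding limit_noise_eq by (intro prob_space_PiM prob_space_VW)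

lemma limit_noise_integrable:
  assumes t: "t \<in> {1..T}" and p: "p \<in> IN"
  shows "integrable limit_noise (\<lambda>v. v t p)"
proof -
  have fin: "finite IN" by simp
  interpret V: prob_space "mvnormal IN (VW_mean t) (VW_cov t)" by (rule prob_space_VW)
  have "integrable (mvnormal IN (VW_mean t) (VW_cov t)) (\<lambda>v. v p ^ 1)"
    by (rule V.integrable_lower_power(2)[OF measurable_mvnormal_component[OF p]
        mvnormal_power4[OF fin VW_cov_factor[OF t] p]]) simp
  then have "integrable (mvnormal IN (VW_mean t) (VW_cov t)) (\<lambda>v. v p)" by simp
  then show ?thesis
    unfolding limit_noise_eq
    by (intro PiM_integrable_component[where M = "\<lambda>t. mvnormal IN (VW_mean t) (VW_cov t)" and f = "\<lambda>v. v p"]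
        prob_space_VW t) simp_all
qed

definition I1 :: "(nat \<times> nat \<times> nat) set" where
  "I1 = {1..T} \<times> {0, 1} \<times> {1..N}"

lemma finite_I1: "finite I1" and finite_I2: "finite I2"
  by (simp_all add: I1_def I2_def)

text \<open>The weak convergence theorem works with families over one countable type that vanish
  outside a finite index set; \<open>flat1\<close> and \<open>restr2\<close> bring the Gaussian
  vectors and the log-weights into this shape.\<close>

definition flat1 :: "(nat \<Rightarrow> nat \<times> nat \<Rightarrow> real) \<Rightarrow> nat \<times> nat \<times> nat \<Rightarrow> real" where
  "flat1 v k = (if k \<in> I1 then v (fst k) (snd k) else 0)"

definition restr2 :: "(nat \<times> nat \<times> nat \<Rightarrow> real) \<Rightarrow> nat \<times> nat \<times> nat \<Rightarrow> real" where
  "restr2 h k = (if k \<in> I2 then h k else 0)"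

lemma sum_flat1: "(\<Sum>k\<in>I1. \<theta> k * flat1 v k) = (\<Sum>t=1..T. \<Sum>p\<in>IN. \<theta> (t, p) * v t p)"
proof -
  have "(\<Sum>k\<in>I1. \<theta> k * flat1 v k) = (\<Sum>k\<in>I1. \<theta> k * v (fst k) (snd k))"
    by (intro sum.cong refl) (simp add: flat1_def)
  then show ?thesis unfolding I1_def by (simp add: sum.cartesian_product case_prod_beta)
qed

lemma limit_cos:
  "(\<integral>v. cos ((\<Sum>k\<in>I1. \<theta> k * flat1 v k) + b) \<partial>limit_noise)
   = cos ((\<Sum>t=1..T. \<Sum>p\<in>IN. \<theta> (t, p) * VW_mean t p) + b)
     * exp (- (\<Sum>t=1..T. \<Sum>p\<in>IN. \<Sum>q\<in>IN. \<theta> (t, p) * \<theta> (t, q) * VW_cov t p q) / 2)"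
proof -
  have fin: "finite IN" by simp
  show ?thesis unfolding sum_flat1 limit_noise_eq
    by (rule PiM_mvnormal_cos[OF finite_atLeastAtMost fin VW_cov_factor, where \<theta> = "\<lambda>t p. \<theta> (t, p)"])
qed

text \<open>An identity for every \<open>D\<close>, not an asymptotic statement. It differs from
  \<open>limit_cos\<close> only by empirical means in place of means under \<open>pi_law\<close>, so
  that on typical paths convergence reduces to finitely many numbers.\<close>

lemma lin_part_cos:
  assumes D: "1 \<le> D"
  shows "(\<integral>u. cos ((\<Sum>k\<in>I1. \<theta> k * flat1 (lin_part D x u) k) + b) \<partial>noise D)
   = cos ((\<Sum>t=1..T. \<Sum>p\<in>IN. \<theta> (t, p) * VW_mean t p) + b)
     * exp (- (\<Sum>t=1..T. \<Sum>p\<in>IN. \<Sum>q\<in>IN. \<theta> (t, p) * \<theta> (t, q) *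
         (ell t * empirical_mean (test_fun (t, fst p, fst q)) D x * Sigma_mat (snd p) (snd q))) / 2)"
proof -
  define g where "g t d i = dwbar FK T t i (x (t + i - 1) d, x (t + i) d)" for t d i
  define A where "A t d p = \<theta> (t, p) * (sqrt (ell t / D) * g t d (fst p))" for t d and p :: "nat \<times> nat"
  \<comment> \<open>Both blocks are driven by the same increment \<open>u j n\<close>, so its total
    coefficient adds the contributions of \<open>V\<close> and \<open>W\<close>. The squares of
    these sums produce the covariance between the two blocks.\<close>
  define \<alpha> where "\<alpha> j n = (\<Sum>i\<in>{0,1}. A (fst j) (snd j) (i, n))" for j :: "nat \<times> nat" and n :: nat
  define c where "c = (\<Sum>t=1..T. \<Sum>p\<in>IN. \<theta> (t, p) * VW_mean t p)"
  let ?J = "{1..T} \<times> {1..D}"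
  have sum_J: "(\<Sum>j\<in>?J. h j) = (\<Sum>t=1..T. \<Sum>d=1..D. h (t, d))" for h :: "nat \<times> nat \<Rightarrow> real"
    by (simp add: sum.cartesian_product)
  have lin: "(\<Sum>k\<in>I1. \<theta> k * flat1 (lin_part D x u) k) = (\<Sum>j\<in>?J. \<Sum>n=1..N. \<alpha> j n * u j n) + c" for u
  proof -
    have lp: "\<theta> (t, p) * lin_part D x u t p = (\<Sum>d=1..D. A t d p * u (t, d) (snd p)) + \<theta> (t, p) * VW_mean t p"
      for t and p :: "nat \<times> nat"
      by (cases p) (simp add: lin_part_def A_def g_def VW_mean_def sum_distrib_left distrib_left mult_ac)
    have in_t: "(\<Sum>p\<in>IN. \<Sum>d=1..D. A t d p * u (t, d) (snd p)) = (\<Sum>d=1..D. \<Sum>n=1..N. \<alpha> (t, d) n * u (t, d) n)" for t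
    proof -
      have "(\<Sum>p\<in>IN. \<Sum>d=1..D. A t d p * u (t, d) (snd p)) = (\<Sum>d=1..D. \<Sum>p\<in>IN. A t d p * u (t, d) (snd p))"
        by (rule sum.swap)
      also have "\<dots> = (\<Sum>d=1..D. \<Sum>n=1..N. \<alpha> (t, d) n * u (t, d) n)"
      proof (rule sum.cong[OF refl])
        fix d
        have "(\<Sum>p\<in>IN. A t d p * u (t, d) (snd p)) = (\<Sum>i\<in>{0,1}. \<Sum>n=1..N. A t d (i, n) * u (t, d) n)"
          unfolding sum.cartesian_product by (rule sum.cong[OF refl]) auto
        also have "\<dots> = (\<Sum>n=1..N. \<Sum>i\<in>{0,1}. A t d (i, n) * u (t, d) n)" by (rule sum.swap)
        also have "\<dots> = (\<Sum>n=1..N. \<alpha> (t, d) n * u (t, d) n)"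
          unfolding \<alpha>_def fst_conv snd_conv sum_distrib_right ..
        finally show "(\<Sum>p\<in>IN. A t d p * u (t, d) (snd p)) = (\<Sum>n=1..N. \<alpha> (t, d) n * u (t, d) n)" .
      qed
      finally show ?thesis .
    qed
    have "(\<Sum>k\<in>I1. \<theta> k * flat1 (lin_part D x u) k)
      = (\<Sum>t=1..T. \<Sum>d=1..D. \<Sum>n=1..N. \<alpha> (t, d) n * u (t, d) n) + c"
      unfolding sum_flat1 lp sum.distrib in_t c_def ..
    then show ?thesis by (simp only: sum_J)
  qed
  have var: "(\<Sum>j\<in>?J. \<Sum>m=1..N. \<Sum>n=1..N. \<alpha> j m * \<alpha> j n * Sigma_mat m n)
    = (\<Sum>t=1..T. \<Sum>p\<in>IN. \<Sum>q\<in>IN. \<theta> (t, p) * \<theta> (t, q) *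
         (ell t * empirical_mean (test_fun (t, fst p, fst q)) D x * Sigma_mat (snd p) (snd q)))"
  proof -
    have "(\<Sum>j\<in>?J. \<Sum>m=1..N. \<Sum>n=1..N. \<alpha> j m * \<alpha> j n * Sigma_mat m n)
      = (\<Sum>j\<in>?J. \<Sum>p\<in>IN. \<Sum>q\<in>IN. A (fst j) (snd j) p * A (fst j) (snd j) q * Sigma_mat (snd p) (snd q))"
      unfolding \<alpha>_def by (rule sum.cong[OF refl], rule sum_over_pairs)
    also have "\<dots> = (\<Sum>t=1..T. \<Sum>d=1..D. \<Sum>p\<in>IN. \<Sum>q\<in>IN. A t d p * A t d q * Sigma_mat (snd p) (snd q))"
      by (simp only: sum_J fst_conv snd_conv)
    also have "\<dots> = (\<Sum>t=1..T. \<Sum>p\<in>IN. \<Sum>q\<in>IN. \<Sum>d=1..D. A t d p * A t d q * Sigma_mat (snd p) (snd q))"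
      by (rule sum.cong[OF refl], subst sum.swap, rule sum.cong[OF refl], rule sum.swap)
    also have "\<dots> = (\<Sum>t=1..T. \<Sum>p\<in>IN. \<Sum>q\<in>IN. \<theta> (t, p) * \<theta> (t, q) *
         (ell t * empirical_mean (test_fun (t, fst p, fst q)) D x * Sigma_mat (snd p) (snd q)))"
    proof (intro sum.cong refl)
      fix t p q assume t: "t \<in> {1..T}" and p: "p \<in> IN" and q: "q \<in> IN"
      have q2: "fst q \<noteq> 2" using q by auto
      have s: "sqrt (ell t / D) * sqrt (ell t / D) = ell t / D" using ell[OF t] by simp
      have "A t d p * A t d q * Sigma_mat (snd p) (snd q)
        = \<theta> (t, p) * \<theta> (t, q) * Sigma_mat (snd p) (snd q) * (sqrt (ell t / D) * sqrt (ell t / D)) * (g t d (fst p) * g t d (fst q))" for d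
        unfolding A_def by (simp only: mult_ac)
      then have "(\<Sum>d=1..D. A t d p * A t d q * Sigma_mat (snd p) (snd q))
        = \<theta> (t, p) * \<theta> (t, q) * Sigma_mat (snd p) (snd q) * (ell t / D) * (\<Sum>d=1..D. g t d (fst p) * g t d (fst q))"
        unfolding s by (simp only: sum_distrib_left)
      moreover have "empirical_mean (test_fun (t, fst p, fst q)) D x = (\<Sum>d=1..D. g t d (fst p) * g t d (fst q)) / D"
        unfolding empirical_mean_def test_fun_def on_path_def g_def using q2 by simp
      ultimately show "(\<Sum>d=1..D. A t d p * A t d q * Sigma_mat (snd p) (snd q))
        = \<theta> (t, p) * \<theta> (t, q) * (ell t * empirical_mean (test_fun (t, fst p, fst q)) D x * Sigma_mat (snd p) (snd q))"
        by (simp add: mult_ac)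
    qed
    finally show ?thesis .
  qed
  have fin: "finite ?J" by simp
  have "(\<integral>u. cos ((\<Sum>k\<in>I1. \<theta> k * flat1 (lin_part D x u) k) + b) \<partial>noise D)
    = (\<integral>u. cos ((\<Sum>j\<in>?J. \<Sum>n=1..N. \<alpha> j n * u j n) + (c + b)) \<partial>noise D)"
    unfolding lin by (simp only: add.assoc)
  also have "\<dots> = cos ((\<Sum>j\<in>?J. \<Sum>n=1..N. \<alpha> j n * 0) + (c + b))
      * exp (- (\<Sum>j\<in>?J. \<Sum>m=1..N. \<Sum>n=1..N. \<alpha> j m * \<alpha> j n * Sigma_mat m n) / 2)"
    unfolding noise_def nu_def by (rule PiM_mvnormal_cos[OF fin finite_atLeastAtMost Sigma_has_factor])
  finally show ?thesis unfolding var c_def by simp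
qed

text \<open>The centred part has second moment at most \<open>ell t\<close> times the empirical mean
  of the squared derivative. On a typical path that mean exceeds its limit by at most 1, which gives
  a bound uniform in the path and in \<open>D\<close>.\<close>

lemma mean_order_lin_part:
  assumes t: "t \<in> {1..T}" and p: "p \<in> IN"
  shows "mean_order (\<lambda>_. 1) (\<lambda>D x u. lin_part D x u t p)"
proof -
  obtain i n where p: "p = (i, n)" and i: "i \<in> {0, 1}" and n: "n \<in> {1..N}" using p by auto
  define m where "m = (\<integral>v. test_fun (t, i, i) v \<partial>pi_law FK T)"
  define c where "c = sqrt (ell t * (\<bar>m\<bar> + 1)) + \<bar>ell t / 2 * mean2 t i\<bar>"
  show ?thesis
  proof (rule mean_orderI[where c = c])
    fix D x assume D: "1 \<le> D" and x: "x \<in> F D"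
    interpret P: prob_space "noise D" by (rule prob_space_noise)
    define g where "g d = dwbar FK T t i (x (t + i - 1) d, x (t + i) d)" for d
    define S where "S u = (\<Sum>d=1..D. g d * u (t, d) n)" for u :: "nat \<times> nat \<Rightarrow> nat \<Rightarrow> real"
    have mem: "(t, d) \<in> {1..T} \<times> {1..D}" if "d \<in> {1..D}" for d using t that by simp
    have h: "(\<lambda>u. u (t, d) n) \<in> borel_measurable (noise D)" "integrable (noise D) (\<lambda>u. (u (t, d) n)\<^sup>2)"
      "P.expectation (\<lambda>u. (u (t, d) n)\<^sup>2) \<le> 1" if d: "d \<in> {1..D}" for d
    proof -
      have sq: "integrable nu (\<lambda>v. (v n)\<^sup>2)" using nu_facts(4)[OF n, of 2] by simp
      show "(\<lambda>u. u (t, d) n) \<in> borel_measurable (noise D)" by (rule noise_borel[OF mem[OF d] n])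
      show "integrable (noise D) (\<lambda>u. (u (t, d) n)\<^sup>2)" by (rule noise_component(1)[OF mem[OF d] sq])
      show "P.expectation (\<lambda>u. (u (t, d) n)\<^sup>2) \<le> 1"
        using noise_component(2)[OF mem[OF d] sq] nu_facts(7)[OF n] by simp
    qed
    have orth: "P.expectation (\<lambda>u. u (t, d) n * u (t, e) n) = 0" if "d \<in> {1..D}" "e \<in> {1..D}" "d \<noteq> e" for d e
      using noise_two_components(1)[OF mem[OF that(1)] mem[OF that(2)] _ nu_facts(5)[OF n] nu_facts(5)[OF n]]
        that(3) nu_facts(6)[OF n] by simp
    have S: "integrable (noise D) S" "P.expectation (\<lambda>u. \<bar>S u\<bar>) \<le> sqrt (1 * (\<Sum>d=1..D. (g d)\<^sup>2))"
      unfolding S_def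
      using P.orthogonal_sum_bound[where X = "\<lambda>d u. u (t, d) n" and c = g, OF finite_atLeastAtMost h orth]
      by blast+
    have eq: "lin_part D x u t p = sqrt (ell t / D) * S u + ell t / 2 * mean2 t i" for u
      by (simp add: lin_part_def p S_def g_def)
    show int: "integrable (noise D) (\<lambda>u. lin_part D x u t p)"
      unfolding eq using S(1) by simp
    show "(\<integral>u. \<bar>lin_part D x u t p\<bar> \<partial>noise D) \<le> c * 1"
    proof -
      have sq0: "0 \<le> sqrt (ell t / D)" using ell[OF t] by simp
      have "(\<integral>u. \<bar>lin_part D x u t p\<bar> \<partial>noise D)
        \<le> (\<integral>u. sqrt (ell t / D) * \<bar>S u\<bar> + \<bar>ell t / 2 * mean2 t i\<bar> \<partial>noise D)"
      proof (rule integral_mono)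
        show "integrable (noise D) (\<lambda>u. \<bar>lin_part D x u t p\<bar>)" using int by (rule integrable_abs)
        show "integrable (noise D) (\<lambda>u. sqrt (ell t / D) * \<bar>S u\<bar> + \<bar>ell t / 2 * mean2 t i\<bar>)" using S(1) by simp
        fix u
        have "\<bar>sqrt (ell t / D) * S u\<bar> = sqrt (ell t / D) * \<bar>S u\<bar>"
          unfolding abs_mult using sq0 by (simp only: abs_of_nonneg)
        then show "\<bar>lin_part D x u t p\<bar> \<le> sqrt (ell t / D) * \<bar>S u\<bar> + \<bar>ell t / 2 * mean2 t i\<bar>"
          unfolding eq using abs_triangle_ineq[of "sqrt (ell t / D) * S u" "ell t / 2 * mean2 t i"] by linarith
      qed
      also have "\<dots> = sqrt (ell t / D) * P.expectation (\<lambda>u. \<bar>S u\<bar>) + \<bar>ell t / 2 * mean2 t i\<bar>"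
        using S(1) by (simp add: P.prob_space)
      also have "\<dots> \<le> sqrt (ell t / D) * sqrt (1 * (\<Sum>d=1..D. (g d)\<^sup>2)) + \<bar>ell t / 2 * mean2 t i\<bar>"
        by (intro add_right_mono mult_left_mono S(2) sq0)
      also have "sqrt (ell t / D) * sqrt (1 * (\<Sum>d=1..D. (g d)\<^sup>2)) = sqrt (ell t * empirical_mean (test_fun (t, i, i)) D x)"
      proof -
        have "empirical_mean (test_fun (t, i, i)) D x = (\<Sum>d=1..D. (g d)\<^sup>2) / D"
          unfolding empirical_mean_def test_fun_def on_path_def g_def power2_eq_square using i by auto
        then show ?thesis by (simp add: real_sqrt_mult[symmetric])
      qed
      also have "\<dots> \<le> sqrt (ell t * (\<bar>m\<bar> + 1))"
      proof (intro real_sqrt_le_mono mult_left_mono)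
        have "(t, i, i) \<in> test_indices" using t i by (auto simp: test_indices_def)
        from F_empirical_mean[OF x this]
        have "\<bar>empirical_mean (test_fun (t, i, i)) D x - m\<bar> \<le> sqrt (sqrt (1 / D))" by (simp add: m_def)
        moreover have "sqrt (sqrt (1 / D)) \<le> 1" using D by simp
        ultimately show "empirical_mean (test_fun (t, i, i)) D x \<le> \<bar>m\<bar> + 1" by linarith
      qed (use ell[OF t] in simp)
      finally show ?thesis by (simp add: c_def)
    qed
  qed
qed

lemma mean_order_limit_ratio:
  assumes "k \<in> I2"
  shows "mean_order (\<lambda>_. 1) (\<lambda>D x u. limit_ratio (lin_part D x u) k)"
  by (rule limit_ratio_induct[OF assms, of "\<lambda>f. mean_order (\<lambda>_. 1) (\<lambda>D x u. f (lin_part D x u))"])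
    (intro mean_order_zero mean_order_lin_part mean_order_add; assumption)+

lemma limit_ratio_flat1:
  assumes "k \<in> I2"
  shows "limit_ratio v k = limit_ratio (\<lambda>t p. flat1 v (t, p)) k"
proof -
  have "\<forall>v. limit_ratio v k = limit_ratio (\<lambda>t p. flat1 v (t, p)) k"
    by (rule limit_ratio_induct[OF assms, of "\<lambda>f. \<forall>v. f v = f (\<lambda>t p. flat1 v (t, p))"])
      (auto simp: flat1_def I1_def)
  then show ?thesis ..
qed

lemma continuous_limit_ratio:
  assumes "k \<in> I2"
  shows "continuous_on UNIV (\<lambda>X. limit_ratio (\<lambda>t p. X (t, p)) k)"
  by (rule limit_ratio_induct[OF assms, of "\<lambda>f. continuous_on UNIV (\<lambda>X :: nat \<times> nat \<times> nat \<Rightarrow> real. f (\<lambda>t p. X (t, p)))"])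
    (simp_all add: continuous_on_add)

lemma integrable_limit_ratio:
  assumes "k \<in> I2"
  shows "integrable limit_noise (\<lambda>v. limit_ratio v k)"
  by (rule limit_ratio_induct[OF assms, of "integrable limit_noise"])
    (intro integrable_zero limit_noise_integrable Bochner_Integration.integrable_add; assumption)+

section \<open>Weak limits along a sequence of typical paths\<close>

context
  fixes dd :: "nat \<Rightarrow> nat" and x :: "nat \<Rightarrow> nat \<Rightarrow> nat \<Rightarrow> real"
  assumes dd1: "\<And>n. 1 \<le> dd n" and dd_lim: "filterlim dd at_top sequentially"
    and xF: "\<And>n. x n \<in> F (dd n)"
begin

lemma empirical_mean_tendsto:
  assumes k: "k \<in> test_indices"
  shows "(\<lambda>n. empirical_mean (test_fun k) (dd n) (x n)) \<longlonglongrightarrow> (\<integral>v. test_fun k v \<partial>pi_law FK T)"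
proof -
  have "(\<lambda>D. sqrt (sqrt (1 / real D))) \<longlonglongrightarrow> sqrt (sqrt 0)" by (intro tendsto_intros lim_1_over_n)
  then have "(\<lambda>D. sqrt (sqrt (1 / real D))) \<longlonglongrightarrow> 0" by simp
  from filterlim_compose[OF this dd_lim] have e: "(\<lambda>n. sqrt (sqrt (1 / real (dd n)))) \<longlonglongrightarrow> 0" .
  have "(\<lambda>n. empirical_mean (test_fun k) (dd n) (x n) - (\<integral>v. test_fun k v \<partial>pi_law FK T)) \<longlonglongrightarrow> 0"
    by (rule Lim_null_comparison[OF _ e]) (use F_empirical_mean[OF xF k] in simp)
  then show ?thesis by (rule LIM_zero_cancel)
qed

lemma mean_order_Bseq:
  assumes "mean_order (\<lambda>_. 1) X"
  shows "integrable (noise (dd n)) (X (dd n) (x n))"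
    and "Bseq (\<lambda>n. \<integral>u. \<bar>X (dd n) (x n) u\<bar> \<partial>noise (dd n))"
proof -
  obtain c where c: "\<And>D x. 1 \<le> D \<Longrightarrow> x \<in> F D \<Longrightarrow> integrable (noise D) (X D x)"
    "\<And>D x. 1 \<le> D \<Longrightarrow> x \<in> F D \<Longrightarrow> (\<integral>u. \<bar>X D x u\<bar> \<partial>noise D) \<le> c * 1"
    using assms by (rule mean_orderE) blast
  show "integrable (noise (dd n)) (X (dd n) (x n))" by (rule c(1)[OF dd1 xF])
  show "Bseq (\<lambda>n. \<integral>u. \<bar>X (dd n) (x n) u\<bar> \<partial>noise (dd n))"
    by (rule BseqI'[of _ c]) (use c(2)[OF dd1 xF] in simp)
qed

lemma mean_order_rate_tendsto:
  assumes "mean_order rate X"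
  shows "(\<lambda>n. \<integral>u. \<bar>X (dd n) (x n) u\<bar> \<partial>noise (dd n)) \<longlonglongrightarrow> 0"
proof -
  obtain c where c: "\<And>D x. 1 \<le> D \<Longrightarrow> x \<in> F D \<Longrightarrow> (\<integral>u. \<bar>X D x u\<bar> \<partial>noise D) \<le> c * rate D"
    using assms by (rule mean_orderE) blast
  have lim: "(\<lambda>n. c * rate (dd n)) \<longlonglongrightarrow> 0"
    by (rule tendsto_mult_right_zero[OF filterlim_compose[OF rate_tendsto dd_lim]])
  show ?thesis
    by (rule Lim_null_comparison[OF always_eventually lim]) (use c[OF dd1 xF] in simp)
qed

lemma lin_part_weak_limit:
  fixes f :: "(nat \<times> nat \<times> nat \<Rightarrow> real) \<Rightarrow> real"
  assumes f: "continuous_on UNIV f" and B: "\<And>h. \<bar>f h\<bar> \<le> B"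
  shows "(\<lambda>n. \<integral>u. f (flat1 (lin_part (dd n) (x n) u)) \<partial>noise (dd n)) \<longlonglongrightarrow> (\<integral>v. f (flat1 v) \<partial>limit_noise)"
proof (rule weak_convergence_from_cos[OF finite_I1 f B prob_space_noise prob_space_limit_noise])
  fix k assume k: "k \<in> I1"
  then have tp: "fst k \<in> {1..T}" "snd k \<in> IN" by (auto simp: I1_def)
  note lin = mean_order_Bseq[OF mean_order_lin_part[OF tp]]
  show "integrable (noise (dd n)) (\<lambda>u. flat1 (lin_part (dd n) (x n) u) k)" for n
    unfolding flat1_def if_P[OF k] by (rule lin(1))
  show "Bseq (\<lambda>n. \<integral>u. \<bar>flat1 (lin_part (dd n) (x n) u) k\<bar> \<partial>noise (dd n))"
    unfolding flat1_def if_P[OF k] by (rule lin(2))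
  show "integrable limit_noise (\<lambda>v. flat1 v k)"
    unfolding flat1_def if_P[OF k] by (rule limit_noise_integrable[OF tp])
next
  fix \<theta> :: "nat \<times> nat \<times> nat \<Rightarrow> real" and b :: real
  have lim: "(\<lambda>n. ell t * empirical_mean (test_fun (t, fst p, fst q)) (dd n) (x n) * Sigma_mat (snd p) (snd q))
      \<longlonglongrightarrow> VW_cov t p q" if t: "t \<in> {1..T}" and p: "p \<in> IN" and q: "q \<in> IN" for t p q
  proof -
    have pq: "fst p \<in> {0, 1}" "fst q \<in> {0, 1}" using p q unfolding mem_Times_iff by blast+
    have k: "(t, fst p, fst q) \<in> test_indices" unfolding test_indices_def using t pq by blast
    have "fst q \<noteq> 2" using pq(2) by auto
    then have "cov t (fst p) (fst q) = ell t * (\<integral>v. test_fun (t, fst p, fst q) v \<partial>pi_law FK T)"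
      by (simp add: cov_def test_fun_def)
    then show ?thesis unfolding VW_cov_def
      by (simp only:) (intro tendsto_intros empirical_mean_tendsto k)
  qed
  show "(\<lambda>n. \<integral>u. cos ((\<Sum>k\<in>I1. \<theta> k * flat1 (lin_part (dd n) (x n) u) k) + b) \<partial>noise (dd n))
      \<longlonglongrightarrow> (\<integral>v. cos ((\<Sum>k\<in>I1. \<theta> k * flat1 v k) + b) \<partial>limit_noise)"
    unfolding limit_cos lin_part_cos[OF dd1]
    by (intro tendsto_mult tendsto_const tendsto_exp tendsto_divide tendsto_minus tendsto_sum lim) simp_all
qed (auto simp: flat1_def)

text \<open>A cosine of a linear form in the log-weights differs in mean by at most a weighted sum
  of mean remainders from the same cosine at \<open>limit_ratio\<close> of the linear part. The
  latter is a bounded continuous function of the linear part, whose weak limit is known.\<close>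

lemma log_ratio_weak_limit:
  fixes f :: "(nat \<times> nat \<times> nat \<Rightarrow> real) \<Rightarrow> real"
  assumes f: "continuous_on UNIV f" and B: "\<And>h. \<bar>f h\<bar> \<le> B"
  shows "(\<lambda>n. \<integral>u. f (restr2 (log_ratio (dd n) (x n) u)) \<partial>noise (dd n))
    \<longlonglongrightarrow> (\<integral>v. f (restr2 (limit_ratio v)) \<partial>limit_noise)"
proof -
  let ?h = "\<lambda>n u k. log_ratio (dd n) (x n) u k" and ?g = "\<lambda>n u k. limit_ratio (lin_part (dd n) (x n) u) k"
  have r: "integrable (noise (dd n)) (\<lambda>u. ?h n u k - ?g n u k)"
    and r0: "(\<lambda>n. \<integral>u. \<bar>?h n u k - ?g n u k\<bar> \<partial>noise (dd n)) \<longlonglongrightarrow> 0" if "k \<in> I2" for n k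
    using mean_order_Bseq(1)[OF mean_order_rate_imp_bounded] mean_order_rate_tendsto mean_order_remainder[OF that]
    by blast+
  have gi: "integrable (noise (dd n)) (\<lambda>u. ?g n u k)" if "k \<in> I2" for n k
    by (rule mean_order_Bseq(1)[OF mean_order_limit_ratio[OF that]])
  have "mean_order (\<lambda>_. 1) (\<lambda>D x u. log_ratio D x u k)" if "k \<in> I2" for k
    using mean_order_add[OF mean_order_rate_imp_bounded[OF mean_order_remainder] mean_order_limit_ratio, OF that that]
    by simp
  note h = mean_order_Bseq[OF this]
  show ?thesis
  proof (rule weak_convergence_from_cos[OF finite_I2 f B prob_space_noise prob_space_limit_noise])
    fix k assume k: "k \<in> I2"
    show "integrable (noise (dd n)) (\<lambda>u. restr2 (?h n u) k)" for n
      unfolding restr2_def if_P[OF k] by (rule h(1)[OF k])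
    show "Bseq (\<lambda>n. \<integral>u. \<bar>restr2 (?h n u) k\<bar> \<partial>noise (dd n))"
      unfolding restr2_def if_P[OF k] by (rule h(2)[OF k])
    show "integrable limit_noise (\<lambda>v. restr2 (limit_ratio v) k)"
      unfolding restr2_def if_P[OF k] by (rule integrable_limit_ratio[OF k])
  next
    fix \<theta> :: "nat \<times> nat \<times> nat \<Rightarrow> real" and b :: real
    \<comment> \<open>Written as a function of the flattened vector. Components in \<open>I2\<close>
      do not change when the vector is flattened, so \<open>G\<close> evaluates the intended
      cosine.\<close>
    define G where "G X = cos ((\<Sum>k\<in>I2. \<theta> k * limit_ratio (\<lambda>t p. X (t, p)) k) + b)" for X
    have "continuous_on UNIV G" unfolding G_def
      by (intro continuous_intros continuous_limit_ratio)
    then have G: "(\<lambda>n. \<integral>u. G (flat1 (lin_part (dd n) (x n) u)) \<partial>noise (dd n)) \<longlonglongrightarrow> (\<integral>v. G (flat1 v) \<partial>limit_noise)"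
      by (rule lin_part_weak_limit[where B = 1]) (simp add: G_def)
    have G_flat: "G (flat1 v) = cos ((\<Sum>k\<in>I2. \<theta> k * limit_ratio v k) + b)" for v
      unfolding G_def
      by (intro arg_cong[of _ _ cos] arg_cong2[of _ _ _ _ "(+)"] refl sum.cong
          arg_cong2[of _ _ _ _ "(*)"] limit_ratio_flat1[symmetric])
    have restr: "(\<Sum>k\<in>I2. \<theta> k * restr2 h k) = (\<Sum>k\<in>I2. \<theta> k * h k)" for h
      by (intro sum.cong refl) (simp add: restr2_def)
    let ?c = "\<lambda>n u. cos ((\<Sum>k\<in>I2. \<theta> k * ?h n u k) + b)" and ?e = "\<lambda>n u. cos ((\<Sum>k\<in>I2. \<theta> k * ?g n u k) + b)"
    have close: "\<bar>(\<integral>u. ?c n u \<partial>noise (dd n)) - (\<integral>u. ?e n u \<partial>noise (dd n))\<bar>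
        \<le> (\<Sum>k\<in>I2. \<bar>\<theta> k\<bar> * (\<integral>u. \<bar>?h n u k - ?g n u k\<bar> \<partial>noise (dd n)))" for n
    proof -
      interpret P: prob_space "noise (dd n)" by (rule prob_space_noise)
      have hm: "(\<lambda>u. ?h n u k) \<in> borel_measurable (noise (dd n))"
        and gm: "(\<lambda>u. ?g n u k) \<in> borel_measurable (noise (dd n))" if "k \<in> I2" for k
        using h(1)[OF that] gi[OF that] by (blast intro: borel_measurable_integrable)+
      have ic: "integrable (noise (dd n)) (?c n)"
      proof (rule P.integrable_const_bound[of _ 1])
        show "?c n \<in> borel_measurable (noise (dd n))"
          by (intro measurable_compose[OF _ borel_measurable_cos] borel_measurable_add borel_measurable_sum
              borel_measurable_times borel_measurable_const hm)
      qed simp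
      have ie: "integrable (noise (dd n)) (?e n)"
      proof (rule P.integrable_const_bound[of _ 1])
        show "?e n \<in> borel_measurable (noise (dd n))"
          by (intro measurable_compose[OF _ borel_measurable_cos] borel_measurable_add borel_measurable_sum
              borel_measurable_times borel_measurable_const gm)
      qed simp
      have id: "integrable (noise (dd n)) (\<lambda>u. \<Sum>k\<in>I2. \<bar>\<theta> k\<bar> * \<bar>?h n u k - ?g n u k\<bar>)"
        by (intro Bochner_Integration.integrable_sum integrable_mult_right integrable_abs r)
      have pw: "\<bar>?c n u - ?e n u\<bar> \<le> (\<Sum>k\<in>I2. \<bar>\<theta> k\<bar> * \<bar>?h n u k - ?g n u k\<bar>)" for u
      proof -
        have "\<bar>?c n u - ?e n u\<bar> \<le> \<bar>(\<Sum>k\<in>I2. \<theta> k * ?h n u k) + b - ((\<Sum>k\<in>I2. \<theta> k * ?g n u k) + b)\<bar>"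
          by (rule abs_cos_diff_le)
        also have "\<dots> = \<bar>\<Sum>k\<in>I2. \<theta> k * (?h n u k - ?g n u k)\<bar>" by (simp add: right_diff_distrib sum_subtractf)
        also have "\<dots> \<le> (\<Sum>k\<in>I2. \<bar>\<theta> k * (?h n u k - ?g n u k)\<bar>)" by (rule sum_abs)
        finally show ?thesis by (simp only: abs_mult)
      qed
      have "\<bar>(\<integral>u. ?c n u \<partial>noise (dd n)) - (\<integral>u. ?e n u \<partial>noise (dd n))\<bar> = \<bar>\<integral>u. ?c n u - ?e n u \<partial>noise (dd n)\<bar>"
        using ic ie by (simp only: Bochner_Integration.integral_diff)
      also have "\<dots> \<le> (\<integral>u. \<bar>?c n u - ?e n u\<bar> \<partial>noise (dd n))" by (rule integral_abs_bound)
      also have "\<dots> \<le> (\<integral>u. (\<Sum>k\<in>I2. \<bar>\<theta> k\<bar> * \<bar>?h n u k - ?g n u k\<bar>) \<partial>noise (dd n))"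
        by (intro integral_mono integrable_abs Bochner_Integration.integrable_diff ic ie id pw)
      also have "\<dots> = (\<Sum>k\<in>I2. \<bar>\<theta> k\<bar> * (\<integral>u. \<bar>?h n u k - ?g n u k\<bar> \<partial>noise (dd n)))"
        using r by (subst Bochner_Integration.integral_sum) auto
      finally show ?thesis .
    qed
    have "(\<lambda>n. \<Sum>k\<in>I2. \<bar>\<theta> k\<bar> * (\<integral>u. \<bar>?h n u k - ?g n u k\<bar> \<partial>noise (dd n))) \<longlonglongrightarrow> (\<Sum>k\<in>I2. \<bar>\<theta> k\<bar> * 0)"
      by (intro tendsto_sum tendsto_mult tendsto_const r0)
    then have lim0: "(\<lambda>n. \<Sum>k\<in>I2. \<bar>\<theta> k\<bar> * (\<integral>u. \<bar>?h n u k - ?g n u k\<bar> \<partial>noise (dd n))) \<longlonglongrightarrow> 0"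
      by (simp only: mult_zero_right sum.neutral_const)
    have "(\<lambda>n. (\<integral>u. ?c n u \<partial>noise (dd n)) - (\<integral>u. ?e n u \<partial>noise (dd n))) \<longlonglongrightarrow> 0"
      by (rule Lim_null_comparison[OF always_eventually lim0]) (unfold real_norm_def, intro allI close)
    from tendsto_add[OF this G[unfolded G_flat]]
    show "(\<lambda>n. \<integral>u. cos ((\<Sum>k\<in>I2. \<theta> k * restr2 (?h n u) k) + b) \<partial>noise (dd n))
        \<longlonglongrightarrow> (\<integral>v. cos ((\<Sum>k\<in>I2. \<theta> k * restr2 (limit_ratio v) k) + b) \<partial>limit_noise)"
      unfolding restr by simp
  qed (auto simp: restr2_def)
qed

end

end

section \<open>Convergence of the genealogies\<close>

lemma integral_cont_pmf_unit:
  fixes p :: "('i::countable \<Rightarrow> real) \<Rightarrow> 'a pmf"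
  assumes p: "cont_pmf p" and M: "prob_space M" and X: "\<And>i. (\<lambda>w. X w i) \<in> borel_measurable M"
  shows "(\<integral>w. pmf (p (X w)) y \<partial>M) \<in> {0..1}"
proof -
  interpret prob_space M by (rule M)
  have cont: "continuous_on UNIV (\<lambda>h. pmf (p h) y)" using p unfolding cont_pmf_def by blast
  have "integrable M (\<lambda>w. pmf (p (X w)) y)"
  proof (rule integrable_const_bound[of _ 1])
    show "(\<lambda>w. pmf (p (X w)) y) \<in> borel_measurable M" by (rule continuous_family_borel[OF cont X])
  qed (simp add: pmf_le_1)
  then show ?thesis by (auto intro!: integral_le_const integral_nonneg_AE simp: pmf_le_1)
qed

lemma abs_diff_le_1: "a \<in> {0..1} \<Longrightarrow> b \<in> {0..1} \<Longrightarrow> \<bar>a - b\<bar> \<le> 1" for a b :: real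
  by auto

context csmc_setting
begin

lemma restr2_log_ratio_borel: "(\<lambda>u. restr2 (log_ratio D x u) k) \<in> borel_measurable (noise D)"
proof (cases "k \<in> I2")
  case True
  then obtain t a l where k: "k = (t, a, l)" "t \<in> {1..T}" "a \<le> N" "l \<le> N" by (auto simp: I2_def)
  show ?thesis unfolding restr2_def if_P[OF True] unfolding k(1) by (rule log_ratio_borel[OF k(2-4)])
qed (simp add: restr2_def)

lemma restr2_limit_ratio_borel: "(\<lambda>v. restr2 (limit_ratio v) k) \<in> borel_measurable limit_noise"
proof (cases "k \<in> I2")
  case True
  show ?thesis unfolding restr2_def if_P[OF True]
    by (rule borel_measurable_integrable[OF integrable_limit_ratio[OF True]])
qed (simp add: restr2_def)

lemma log_genealogy_restr2: "log_genealogy T N bs fm h = log_genealogy T N bs fm (restr2 h)"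
  by (rule log_genealogy_cong[OF T]) (simp add: restr2_def I2_def)

lemma csmc_law_eq:
  "csmc_law FK T N ell bs fm D x
    = bind (noise D) (\<lambda>u. measure_pmf (log_genealogy T N bs fm (restr2 (log_ratio D x u))))"
proof -
  have pot_pos: "0 < pot FK s y" if "s \<in> {1..T}" for s y
    using model that unfolding fk_valid_def by (elim conjE) blast
  have "csmc_genealogy FK T N D bs fm (particles ell D x u) = log_genealogy T N bs fm (restr2 (log_ratio D x u))" for u
  proof -
    have "csmc_genealogy FK T N D bs fm (particles ell D x u) = log_genealogy T N bs fm (log_ratio D x u)"
      unfolding log_ratio_def by (rule csmc_genealogy_eq[OF T]) (erule dens_pos, erule pot_pos)
    then show ?thesis by (simp only: log_genealogy_restr2[symmetric])
  qed
  then show ?thesis unfolding csmc_law_def noise_def nu_def by (simp only:)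
qed

lemma limit_law_eq:
  "limit_law FK T N ell bs fm
    = bind limit_noise (\<lambda>v. measure_pmf (log_genealogy T N bs fm (restr2 (limit_ratio v))))"
proof -
  have "limit_genealogy T N bs fm (V_part v) (W_part v) = log_genealogy T N bs fm (restr2 (limit_ratio v))" for v
  proof -
    have "limit_genealogy T N bs fm (V_part v) (W_part v) = log_genealogy T N bs fm (limit_ratio v)"
      unfolding limit_ratio_def by (rule limit_genealogy_eq[OF T]) (simp_all add: V_part_def W_part_def)
    then show ?thesis by (simp only: log_genealogy_restr2[symmetric])
  qed
  then show ?thesis unfolding limit_law_def limit_noise_def by (simp only:)
qed

text \<open>The conditional probability given the Gaussian vectors is positive at every point, hence
  so is its integral. No quantitative lower bound is required.\<close>

lemma accept_rate_limit_pos: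
  assumes t: "t \<in> {1..T}"
  shows "0 < accept_rate (limit_law FK T N ell bs fm) t"
proof -
  interpret L: prob_space limit_noise by (rule prob_space_limit_noise)
  let ?E = "{(A, K). K t \<noteq> 0} :: ((nat \<Rightarrow> nat \<Rightarrow> nat) \<times> (nat \<Rightarrow> nat)) set"
  let ?p = "\<lambda>v. measure_pmf.prob (log_genealogy T N bs fm (restr2 (limit_ratio v))) ?E"
  have m: "?p \<in> borel_measurable limit_noise"
    by (rule cont_pmf_prob_borel[OF prob_space_limit_noise cont_pmf_log_genealogy restr2_limit_ratio_borel])
  have i: "integrable limit_noise ?p"
  proof (rule L.integrable_const_bound[OF _ m])
    show "AE v in limit_noise. norm (?p v) \<le> 1" by simp
  qed
  have "0 < (\<integral>v. ?p v \<partial>limit_noise)"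
    by (rule L.expectation_greater[OF i]) (rule AE_I2, rule log_genealogy_all_ones[OF T N t])
  then show ?thesis
    unfolding accept_rate_def limit_law_eq
    by (simp only: measure_bind_cont_pmf[OF prob_space_limit_noise cont_pmf_log_genealogy restr2_limit_ratio_borel])
qed

text \<open>The sum of the absolute differences of mean point masses over the finite common support.
  It dominates every event at once, is at most the size of the support, and tends to zero along
  typical sequences since each point mass is a bounded continuous function of the
  log-weights.\<close>

lemma total_variation_bound:
  obtains \<delta> :: "nat \<Rightarrow> (nat \<Rightarrow> nat \<Rightarrow> real) \<Rightarrow> real" and B :: real where
    "\<And>D x. \<delta> D x \<le> B"
    "\<And>D x E. \<bar>measure (csmc_law FK T N ell bs fm D x) E - measure (limit_law FK T N ell bs fm) E\<bar> \<le> \<delta> D x"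
    "\<And>dd x. (\<And>n. 1 \<le> dd n) \<Longrightarrow> filterlim dd at_top sequentially \<Longrightarrow> (\<And>n. x n \<in> F (dd n))
      \<Longrightarrow> (\<lambda>n. \<delta> (dd n) (x n)) \<longlonglongrightarrow> 0"
proof -
  let ?p = "log_genealogy T N bs fm"
  obtain S where S: "finite S" "\<And>h. set_pmf (?p h) \<subseteq> S"
    using cont_pmf_log_genealogy[of T N bs fm] unfolding cont_pmf_def by blast
  define \<delta> where "\<delta> D x = (\<Sum>y\<in>S. \<bar>(\<integral>u. pmf (?p (restr2 (log_ratio D x u))) y \<partial>noise D)
      - (\<integral>v. pmf (?p (restr2 (limit_ratio v))) y \<partial>limit_noise)\<bar>)" for D x
  have cont: "continuous_on UNIV (\<lambda>h. pmf (?p h) y)" for y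
    using cont_pmf_log_genealogy[of T N bs fm] unfolding cont_pmf_def by blast
  note unit = integral_cont_pmf_unit[OF cont_pmf_log_genealogy]
  show ?thesis
  proof (rule that[of \<delta> "\<Sum>y\<in>S. 1"])
    fix D x
    show "\<delta> D x \<le> (\<Sum>y\<in>S. 1)" unfolding \<delta>_def
    proof (rule sum_mono)
      fix y
      show "\<bar>(\<integral>u. pmf (?p (restr2 (log_ratio D x u))) y \<partial>noise D)
        - (\<integral>v. pmf (?p (restr2 (limit_ratio v))) y \<partial>limit_noise)\<bar> \<le> 1"
        by (rule abs_diff_le_1[OF unit[OF prob_space_noise restr2_log_ratio_borel]
              unit[OF prob_space_limit_noise restr2_limit_ratio_borel]])
    qed
  next
    fix D x and E :: "((nat \<Rightarrow> nat \<Rightarrow> nat) \<times> (nat \<Rightarrow> nat)) set"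
    show "\<bar>measure (csmc_law FK T N ell bs fm D x) E - measure (limit_law FK T N ell bs fm) E\<bar> \<le> \<delta> D x"
      unfolding csmc_law_eq limit_law_eq \<delta>_def
      by (rule sum_abs_bound_cont_pmf[OF cont_pmf_log_genealogy S prob_space_noise restr2_log_ratio_borel
          prob_space_limit_noise restr2_limit_ratio_borel])
  next
    fix dd x
    assume dd: "\<And>n. 1 \<le> dd n" "filterlim dd at_top sequentially" "\<And>n. x n \<in> F (dd n)"
    have "(\<lambda>n. \<integral>u. pmf (?p (restr2 (log_ratio (dd n) (x n) u))) y \<partial>noise (dd n))
      \<longlonglongrightarrow> (\<integral>v. pmf (?p (restr2 (limit_ratio v))) y \<partial>limit_noise)" for y
      by (rule log_ratio_weak_limit[OF dd cont, where B = 1]) (simp add: pmf_le_1)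
    then have "(\<lambda>n. \<delta> (dd n) (x n)) \<longlonglongrightarrow> (\<Sum>y\<in>S. \<bar>(\<integral>v. pmf (?p (restr2 (limit_ratio v))) y \<partial>limit_noise)
        - (\<integral>v. pmf (?p (restr2 (limit_ratio v))) y \<partial>limit_noise)\<bar>)"
      unfolding \<delta>_def by (intro tendsto_sum tendsto_rabs tendsto_diff tendsto_const)
    then show "(\<lambda>n. \<delta> (dd n) (x n)) \<longlonglongrightarrow> 0" by (simp only: diff_self abs_zero sum.neutral_const)
  qed
qed

text \<open>A real supremum over the empty set would be uninformative; probability above one half
  excludes this for large \<open>D\<close>.\<close>

lemma F_eventually_nonempty: "\<forall>\<^sub>F D in sequentially. F D \<noteq> {}"
proof -
  have "\<forall>\<^sub>F D in sequentially. 1 / 2 < measure (target_law FK T D) (F D)"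
    using order_tendstoD(1)[OF F_measure, of "1 / 2"] by simp
  then show ?thesis by (rule eventually_mono) auto
qed

lemma uniform_limits:
  shows "(\<lambda>D. SUP x\<in>F D. tv_dist (csmc_law FK T N ell bs fm D x) (limit_law FK T N ell bs fm)) \<longlonglongrightarrow> 0"
    and "(\<lambda>D. SUP x\<in>F D. \<bar>accept_rate (csmc_law FK T N ell bs fm D x) t
                            - accept_rate (limit_law FK T N ell bs fm) t\<bar>) \<longlonglongrightarrow> 0"
proof -
  obtain \<delta> :: "nat \<Rightarrow> (nat \<Rightarrow> nat \<Rightarrow> real) \<Rightarrow> real" and B :: real where
    B: "\<And>D x. \<delta> D x \<le> B" and
    d: "\<And>D x E. \<bar>measure (csmc_law FK T N ell bs fm D x) E - measure (limit_law FK T N ell bs fm) E\<bar> \<le> \<delta> D x" and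
    lim: "\<And>dd x. (\<And>n. 1 \<le> dd n) \<Longrightarrow> filterlim dd at_top sequentially \<Longrightarrow> (\<And>n. x n \<in> F (dd n))
      \<Longrightarrow> (\<lambda>n. \<delta> (dd n) (x n)) \<longlonglongrightarrow> 0"
    by (rule total_variation_bound) blast
  have sandwich: "(\<lambda>D. SUP x\<in>F D. a D x) \<longlonglongrightarrow> 0"
    if a: "\<And>D x. 0 \<le> a D x" "\<And>D x. a D x \<le> \<delta> D x" for a
  proof (rule SUP_tendsto_0_from_sequences[OF F_eventually_nonempty a(1), where B = B])
    show "a D x \<le> B" for D x using a(2) B by (rule order_trans)
    fix dd x assume dd: "\<And>n. 1 \<le> dd n" "filterlim dd at_top sequentially" "\<And>n. x n \<in> F (dd n)"
    show "(\<lambda>n. a (dd n) (x n)) \<longlonglongrightarrow> 0"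
      by (rule tendsto_sandwich[OF always_eventually always_eventually tendsto_const lim[OF dd]])
        (use a in blast)+
  qed
  show "(\<lambda>D. SUP x\<in>F D. \<bar>accept_rate (csmc_law FK T N ell bs fm D x) t
      - accept_rate (limit_law FK T N ell bs fm) t\<bar>) \<longlonglongrightarrow> 0"
    unfolding accept_rate_def by (rule sandwich[OF abs_ge_zero d])
  show "(\<lambda>D. SUP x\<in>F D. tv_dist (csmc_law FK T N ell bs fm D x) (limit_law FK T N ell bs fm)) \<longlonglongrightarrow> 0"
  proof (rule sandwich)
    fix D x
    let ?P = "csmc_law FK T N ell bs fm D x" and ?Q = "limit_law FK T N ell bs fm"
    have ne: "sets ?P \<noteq> {}" using sets.empty_sets[of ?P] by blast
    have bdd: "bdd_above ((\<lambda>E. \<bar>measure ?P E - measure ?Q E\<bar>) ` sets ?P)"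
      by (intro bdd_aboveI2[of _ _ "\<delta> D x"] d)
    have "\<bar>measure ?P {} - measure ?Q {}\<bar> \<le> tv_dist ?P ?Q"
      unfolding tv_dist_def by (rule cSUP_upper[OF sets.empty_sets bdd])
    then show "0 \<le> tv_dist ?P ?Q" by simp
    show "tv_dist ?P ?Q \<le> \<delta> D x"
      unfolding tv_dist_def by (rule cSUP_least[OF ne d])
  qed
qed

end

theorem corollary4p6:
  fixes FK :: fk_model and T N :: nat and ell :: "nat \<Rightarrow> real" and bs fm :: bool
  assumes T: "1 \<le> T" and N: "1 \<le> N"
    and ell: "\<And>s. s \<in> {1..T} \<Longrightarrow> 0 < ell s"
    and model: "fk_valid FK T"
    and dens_pos: "\<And>s x y. s \<in> {1..T} \<Longrightarrow> 0 < tdens FK s x y"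
    and smooth: "\<And>s. s \<in> {1..T} \<Longrightarrow> twice_cont_diff (wbar FK T s)"
    and second: "\<And>s. s \<in> {1..T} \<Longrightarrow>
          lipschitz_bounded (pd2 (pd2 (wbar FK T s))) \<and>
          lipschitz_bounded (pd1 (pd1 (wbar FK T (s + 1)))) \<and>
          lipschitz_bounded (pd1 (pd2 (wbar FK T (s + 1))))"
    and moments: "\<And>s. s \<in> {1..T} \<Longrightarrow>
          integrable (pi_law FK T) (\<lambda>x. \<bar>on_path s (pd2 (wbar FK T s)) x\<bar> ^ 4) \<and>
          integrable (pi_law FK T) (\<lambda>x. \<bar>on_path (s + 1) (pd1 (wbar FK T (s + 1))) x\<bar> ^ 4)"
  shows "(\<forall>t\<in>{1..T}. 0 < accept_rate (limit_law FK T N ell bs fm) t) \<and>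
    (\<exists>F :: nat \<Rightarrow> (nat \<Rightarrow> nat \<Rightarrow> real) set.
       (\<forall>D. F D \<in> sets (state_space T D)) \<and>
       (\<lambda>D. measure (target_law FK T D) (F D)) \<longlonglongrightarrow> 1 \<and>
       (\<lambda>D. SUP x\<in>F D. tv_dist (csmc_law FK T N ell bs fm D x) (limit_law FK T N ell bs fm))
         \<longlonglongrightarrow> 0 \<and>
       (\<forall>t\<in>{1..T}.
          (\<lambda>D. SUP x\<in>F D. \<bar>accept_rate (csmc_law FK T N ell bs fm D x) t
                            - accept_rate (limit_law FK T N ell bs fm) t\<bar>) \<longlonglongrightarrow> 0))"
proof -
  interpret csmc_setting FK T N ell
    by unfold_locales (fact T, fact N, fact ell, fact model, fact dens_pos, fact smooth, fact second, fact moments)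
  show ?thesis
    \<comment> \<open>The witness \<open>F\<close> involves neither the time \<open>t\<close> nor
      the switches \<open>bs\<close> and \<open>fm\<close>, so it is the same for all versions of
      the algorithm.\<close>
    by (intro conjI ballI exI[of _ F] allI accept_rate_limit_pos F_sets F_measure uniform_limits)
qed

end
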